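(* Assume the setting described in the context. Fix a time partition $\{\tau_n\}_{n=1}^N$ of $[0,T]$. For a regular family of partitionings $\{\mathcal T^h\}_{h>0}$ of $\Omega$, let $\{W_A^n,Q_A^n\}_{n=1}^N$ be a solution of the fully discrete problem $(\mathrm Q_A^{h,\tau})$. Then there exists a subsequence of $\{\{W_A^n,Q_A^n\}_{n=1}^N\}_{h>0}$ (not relabelled) such that, as $h\to0$, \begin{align*} \nabla W_A^n&\to\nabla w^n&&\text{weak-}\star\text{ in }[L^\infty(\Omega)]^d,&&n=0,\dots,N,\\ W_A^n&\to w^n&&\text{strongly in }C(\overline\Omega),&&n=0,\dots,N,\\ M_\varepsilon^h(P^hW_A^n)&\to M_\varepsilon(w^n)&&\text{strongly in }L^\infty(\Omega),&&n=0,\dots,N,\\ Q_A^n&\to q^n&&\text{vaguely in }[\mathcal M(\overline\Omega)]^d,&&n=1,\dots,N, \end{align*} where $\{w^n,q^n\}_{n=1}^N$ is a solution of the semi-discrete problem $(\mathrm Q^\tau)$.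
   Context: Data. $d\in\{1,2\}$; $\Omega\subset\mathbb R^d$ is a bounded convex polygonal domain (an open interval if $d=1$) with Lipschitz boundary and outward unit normal $\nu$; $T>0$; $k_0>0$ and $\varepsilon>0$ are fixed constants; $f\in L^2(0,T;L^2(\Omega))$ is nonnegative; $w_0^\varepsilon\in W^{1,\infty}_0(\Omega)\cap C^1(\overline\Omega)$ satisfies $\nabla w_0^\varepsilon\cdot\nu<k_0$ on $\partial\Omega$. Here $W^{1,s}_0(\Omega)=\{\eta\in W^{1,s}(\Omega):\eta=0\text{ on }\partial\Omega\}$. The operator $M_\varepsilon:C(\overline\Omega)\to C(\overline\Omega)$ is defined, with $k_1^\varepsilon(x):=\max(k_0,|\nabla w_0^\varepsilon(x)|)$, by $M_\varepsilon(\eta)(x)=k_0$ if $\eta(x)\ge w_0^\varepsilon(x)+\varepsilon$; $M_\varepsilon(\eta)(x)=k_1^\varepsilon(x)+(k_0-k_1^\varepsilon(x))\frac{\eta(x)-w_0^\varepsilon(x)}{\varepsilon}$ if $\eta(x)\in[w_0^\varepsilon(x),w_0^\varepsilon(x)+\varepsilon]$; $M_\varepsilon(\eta)(x)=k_1^\varepsilon(x)$ if $\eta(x)\le w_0^\varepsilon(x)$. Notation. $(\cdot,\cdot)$ is the $L^2(\Omega)$ inner product (also for vector functions). $\mathcal M(\overline\Omega)=[C(\overline\Omega)]^\star$ is the space of bounded Radon measures on $\overline\Omega$, with duality pairing $\langle\cdot,\cdot\rangle_{C(\overline\Omega)}$ (also used componentwise for vector measures); $L^1(\Omega)\subset\mathcal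 M(\overline\Omega)$. For $v\in[\mathcal M(\overline\Omega)]^d$, $|v|$ is its total variation measure. $\mu_j\to\mu$ vaguely means $\langle\mu_j-\mu,\eta\rangle_{C(\overline\Omega)}\to0$ for all continuous $\eta$ on $\overline\Omega$. $V^{\mathcal M}(\Omega):=\{v\in[\mathcal M(\overline\Omega)]^d:\nabla\cdot v\in L^2(\Omega)\}$, where $\nabla\cdot v\in L^2(\Omega)$ means that there is $u\in L^2(\Omega)$ (denoted $\nabla\cdot v$) with $\langle v,\nabla\phi\rangle_{C(\overline\Omega)}=-(u,\phi)$ for all $C^1$ functions $\phi$ with compact support in $\Omega$. Mesh and spaces. $\{\mathcal T^h\}_{h>0}$ is a regular (shape-regular, conforming) family of partitionings of $\Omega$ into disjoint open simplices $\sigma$, $h=\max_{\sigma}\mathrm{diam}(\sigma)$. $S^h$ (resp. $\underline S^h$) is the space of functions on $\Omega$ that are constant on each $\sigma$ with values in $\mathbb R$ (resp. $\mathbb R^d$). $U^h$ is the space of continuous functions on $\overline\Omega$ affine on each $\sigma$, $U_0^h=U^h\cap W_0^{1,\infty}(\Omega)$. $\pi^h:C(\overline\Omega)\to U^h$ is nodal interpolation at the vertices; $P^h:L^1(\Omega)\to S^h$ is the elementwise mean, $P^hv|_\sigma=\frac1{|\sigma|}\int_\sigma v\,dx$. For functions continuous on each closed element, $(\eta,\chi)^h:=\sum_{\sigma\in\mathcal T^h}\frac{|\sigma|}{d+1}\sum_{j=1}^{d+1}\eta(x_j^\sigma)\chi(x_j^\sigma)$, with $x_j^\sigma$ the vertices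 of $\sigma$. With $w_0^{\varepsilon,h}:=P^h[\pi^hw_0^\varepsilon]$ and $k_{1,\sigma}^{\varepsilon,h}:=\max(k_0,|\nabla\pi^hw_0^\varepsilon|_\sigma|)$, $M_\varepsilon^h:S^h\to S^h$ is defined on each $\sigma$ by: $M_\varepsilon^h(\eta^h)=k_0$ if $\eta^h\ge w_0^{\varepsilon,h}+\varepsilon$; $=k_{1,\sigma}^{\varepsilon,h}+(k_0-k_{1,\sigma}^{\varepsilon,h})\frac{\eta^h-w_0^{\varepsilon,h}}{\varepsilon}$ if $\eta^h\in[w_0^{\varepsilon,h},w_0^{\varepsilon,h}+\varepsilon]$; $=k_{1,\sigma}^{\varepsilon,h}$ if $\eta^h\le w_0^{\varepsilon,h}$. Time discretization. $0=t_0<t_1<\dots<t_N=T$, $\tau_n=t_n-t_{n-1}$, $\tau=\max_n\tau_n$, $f^n:=\frac1{\tau_n}\int_{t_{n-1}}^{t_n}f(\cdot,t)\,dt$. Problem $(\mathrm Q_A^{h,\tau})$: with $W_A^0=\pi^hw_0^\varepsilon$, for $n=1,\dots,N$ find $W_A^n\in U_0^h$ and $Q_A^n\in\underline S^h$ such that $\left(\frac{W_A^n-W_A^{n-1}}{\tau_n},\eta^h\right)^h-(Q_A^n,\nabla\eta^h)=(f^n,\eta^h)$ for all $\eta^h\in U_0^h$, and $(M_\varepsilon^h(P^hW_A^n),|v^h|-|Q_A^n|)+(\nabla W_A^n,v^h-Q_A^n)\ge0$ for all $v^h\in\underline S^h$. Problem $(\mathrm Q^\tau)$: with $w^0=w_0^\varepsilon$,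 for $n=1,\dots,N$ find $w^n\in W^{1,\infty}_0(\Omega)$ and $q^n\in V^{\mathcal M}(\Omega)$ such that $\left(\frac{w^n-w^{n-1}}{\tau_n},\eta\right)+(\nabla\cdot q^n,\eta)=(f^n,\eta)$ for all $\eta\in L^2(\Omega)$, and $\langle|v|-|q^n|,M_\varepsilon(w^n)\rangle_{C(\overline\Omega)}-(\nabla\cdot(v-q^n),w^n)\ge0$ for all $v\in V^{\mathcal M}(\Omega)$. *)

theory Defs
  imports "HOL-Analysis.Analysis" "HOL-Probability.Essential_Supremum"
begin

text \<open>Functions on \<open>\<Omega>\<close> or on its closure are total functions on \<open>real ^ 'n\<close>; only their values on
  \<open>\<Omega>\<close> (up to null sets) or on the closure, respectively, are used.\<close>

text \<open>The boundary of a bounded convex open set is automatically Lipschitz. For \<open>CARD('n) = 1\<close>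
  these sets are exactly the bounded nonempty open intervals.\<close>
definition convex_polygonal_domain :: "(real ^ 'n) set \<Rightarrow> bool" where
  "convex_polygonal_domain \<Omega> \<longleftrightarrow>
     open \<Omega> \<and> \<Omega> \<noteq> {} \<and> bounded \<Omega> \<and> convex \<Omega> \<and> polytope (closure \<Omega>)"

text \<open>For a convex domain: \<open>\<nu>\<close> is the only unit vector pointing away from a supporting
  hyperplane at \<open>x\<close>. At a corner there are several such vectors, hence no normal.\<close>
definition outward_unit_normal :: "(real ^ 'n) set \<Rightarrow> real ^ 'n \<Rightarrow> real ^ 'n \<Rightarrow> bool" where
  "outward_unit_normal \<Omega> x \<nu> \<longleftrightarrow>
     x \<in> frontier \<Omega> \<and> {n. norm n = 1 \<and> (\<forall>y\<in>\<Omega>. n \<bullet> (y - x) \<le> 0)} = {\<nu>}"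

text \<open>Classical gradient; unspecified where the function is not differentiable (for a piecewise
  affine function, at most on the element boundaries inside the domain).\<close>
definition grad :: "(real ^ 'n \<Rightarrow> real) \<Rightarrow> real ^ 'n \<Rightarrow> real ^ 'n" where
  "grad u x = (THE D. GDERIV u x :> D)"

text \<open>\<open>u\<close> is \<open>C\<^sup>1\<close> up to the boundary; \<open>g\<close> is its gradient, extended continuously to the closure
  (and hence uniquely determined there).\<close>
definition C1_closure :: "(real ^ 'n) set \<Rightarrow> (real ^ 'n \<Rightarrow> real) \<Rightarrow> (real ^ 'n \<Rightarrow> real ^ 'n) \<Rightarrow> bool" where
  "C1_closure \<Omega> u g \<longleftrightarrow> continuous_on (closure \<Omega>) u \<and> continuous_on (closure \<Omega>) g \<and>
     (\<forall>x\<in>\<Omega>. GDERIV u x :> g x)"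

definition C1_compact :: "(real ^ 'n) set \<Rightarrow> (real ^ 'n \<Rightarrow> real) set" where
  "C1_compact \<Omega> = {\<phi>. (\<forall>x. \<phi> differentiable (at x)) \<and> continuous_on UNIV (grad \<phi>) \<and>
     (\<exists>S. compact S \<and> S \<subseteq> \<Omega> \<and> (\<forall>x. x \<notin> S \<longrightarrow> \<phi> x = 0))}"

definition L1_space :: "(real ^ 'n) set \<Rightarrow> (real ^ 'n \<Rightarrow> 'b::{banach,second_countable_topology}) set" where
  "L1_space \<Omega> = {u. integrable (lebesgue_on \<Omega>) u}"

definition L2_space :: "(real ^ 'n) set \<Rightarrow> (real ^ 'n \<Rightarrow> real) set" where
  "L2_space \<Omega> = {u \<in> borel_measurable (lebesgue_on \<Omega>). integrable (lebesgue_on \<Omega>) (\<lambda>x. (u x)\<^sup>2)}"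

definition L2_inner :: "(real ^ 'n) set \<Rightarrow> (real ^ 'n \<Rightarrow> 'b::real_inner) \<Rightarrow> (real ^ 'n \<Rightarrow> 'b) \<Rightarrow> real" where
  "L2_inner \<Omega> u v = (\<integral>x. u x \<bullet> v x \<partial>lebesgue_on \<Omega>)"

definition Linf_norm :: "(real ^ 'n) set \<Rightarrow> (real ^ 'n \<Rightarrow> 'b::real_normed_vector) \<Rightarrow> ereal" where
  "Linf_norm \<Omega> u = esssup (lebesgue_on \<Omega>) (\<lambda>x. ereal (norm (u x)))"

definition Linf_space :: "(real ^ 'n) set \<Rightarrow> (real ^ 'n \<Rightarrow> 'b::real_normed_vector) set" where
  "Linf_space \<Omega> = {u \<in> borel_measurable (lebesgue_on \<Omega>). Linf_norm \<Omega> u < \<infinity>}"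

text \<open>The Bochner space \<open>L\<^sup>2(0,T;L\<^sup>2(\<Omega>))\<close>, in terms of jointly measurable representatives.\<close>
definition L2_time_space :: "real \<Rightarrow> (real ^ 'n) set \<Rightarrow> (real \<Rightarrow> real ^ 'n \<Rightarrow> real) set" where
  "L2_time_space T \<Omega> =
     {f. (\<lambda>(t, x). f t x) \<in> borel_measurable (lebesgue_on {0<..<T} \<Otimes>\<^sub>M lebesgue_on \<Omega>) \<and>
         integrable (lebesgue_on {0<..<T} \<Otimes>\<^sub>M lebesgue_on \<Omega>) (\<lambda>(t, x). (f t x)\<^sup>2)}"

definition has_weak_grad :: "(real ^ 'n) set \<Rightarrow> (real ^ 'n \<Rightarrow> real) \<Rightarrow> (real ^ 'n \<Rightarrow> real ^ 'n) \<Rightarrow> bool" where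
  "has_weak_grad \<Omega> u g \<longleftrightarrow> (\<forall>\<phi>\<in>C1_compact \<Omega>.
     (\<integral>x. u x *\<^sub>R grad \<phi> x \<partial>lebesgue_on \<Omega>) = - (\<integral>x. \<phi> x *\<^sub>R g x \<partial>lebesgue_on \<Omega>))"

definition W1inf :: "(real ^ 'n) set \<Rightarrow> (real ^ 'n \<Rightarrow> real) set" where
  "W1inf \<Omega> = {u \<in> Linf_space \<Omega>. \<exists>g\<in>Linf_space \<Omega>. has_weak_grad \<Omega> u g}"

text \<open>Elements of \<open>W\<^sup>1\<^sup>,\<^sup>\<infinity>(\<Omega>)\<close> have a representative that is continuous on the closure; the
  elements of this set are these representatives.\<close>
definition W1inf_0 :: "(real ^ 'n) set \<Rightarrow> (real ^ 'n \<Rightarrow> real) set" where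
  "W1inf_0 \<Omega> = {u \<in> W1inf \<Omega>. continuous_on (closure \<Omega>) u \<and> (\<forall>x\<in>frontier \<Omega>. u x = 0)}"

text \<open>Some representative; unique almost everywhere in \<open>\<Omega>\<close>.\<close>
definition weak_grad :: "(real ^ 'n) set \<Rightarrow> (real ^ 'n \<Rightarrow> real) \<Rightarrow> real ^ 'n \<Rightarrow> real ^ 'n" where
  "weak_grad \<Omega> u = (SOME g. g \<in> Linf_space \<Omega> \<and> has_weak_grad \<Omega> u g)"

definition weak_star_Linf :: "(real ^ 'n) set \<Rightarrow> (nat \<Rightarrow> real ^ 'n \<Rightarrow> real ^ 'n) \<Rightarrow> (real ^ 'n \<Rightarrow> real ^ 'n) \<Rightarrow> bool" where
  "weak_star_Linf \<Omega> us u \<longleftrightarrow> (\<forall>j. us j \<in> Linf_space \<Omega>) \<and> u \<in> Linf_space \<Omega> \<and>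
     (\<forall>\<psi>\<in>L1_space \<Omega>. (\<lambda>j. L2_inner \<Omega> (us j) \<psi>) \<longlonglongrightarrow> L2_inner \<Omega> u \<psi>)"

text \<open>The dual of \<open>C(K)\<close> for compact nonempty \<open>K\<close>: linear functionals, bounded with respect to
  the supremum norm on \<open>K\<close> (so that the values of the argument off \<open>K\<close> do not matter).\<close>
definition radon_measures :: "(real ^ 'n) set \<Rightarrow> ((real ^ 'n \<Rightarrow> real) \<Rightarrow> real) set" where
  "radon_measures K = {\<mu>.
     (\<forall>\<eta> \<zeta>. continuous_on K \<eta> \<longrightarrow> continuous_on K \<zeta> \<longrightarrow> \<mu> (\<lambda>x. \<eta> x + \<zeta> x) = \<mu> \<eta> + \<mu> \<zeta>) \<and>
     (\<forall>c \<eta>. continuous_on K \<eta> \<longrightarrow> \<mu> (\<lambda>x. c * \<eta> x) = c * \<mu> \<eta>) \<and>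
     (\<exists>C. \<forall>\<eta>. continuous_on K \<eta> \<longrightarrow> \<bar>\<mu> \<eta>\<bar> \<le> C * (SUP x\<in>K. \<bar>\<eta> x\<bar>))}"

type_synonym 'n vmeasure = "((real ^ 'n \<Rightarrow> real) \<Rightarrow> real) ^ 'n"

definition vector_radon_measures :: "(real ^ 'n) set \<Rightarrow> 'n vmeasure set" where
  "vector_radon_measures K = {v. \<forall>i. v $ i \<in> radon_measures K}"

definition pairing :: "'n vmeasure \<Rightarrow> (real ^ 'n \<Rightarrow> real ^ 'n) \<Rightarrow> real" where
  "pairing v \<phi> = (\<Sum>i\<in>UNIV. (v $ i) (\<lambda>x. \<phi> x $ i))"

text \<open>The total variation measure, as a functional on \<open>C(K)\<close>: for nonnegative \<open>\<eta>\<close> it is the supremum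
  of \<open>\<langle>v,\<phi>\<rangle>\<close> over the continuous vector fields with \<open>|\<phi>| \<le> \<eta>\<close> (Euclidean norm), and it is
  extended linearly. This is the usual definition of the variation of a measure given as
  a functional; under Riesz' theorem it corresponds to the set function defined by partitions.\<close>
definition total_variation :: "(real ^ 'n) set \<Rightarrow> 'n vmeasure \<Rightarrow> (real ^ 'n \<Rightarrow> real) \<Rightarrow> real" where
  "total_variation K v \<eta> =
     (let tv = (\<lambda>\<zeta>. Sup {pairing v \<phi> |\<phi>. continuous_on K \<phi> \<and> (\<forall>x\<in>K. norm (\<phi> x) \<le> \<zeta> x)})
      in tv (\<lambda>x. max (\<eta> x) 0) - tv (\<lambda>x. max (- \<eta> x) 0))"

definition has_measure_div :: "(real ^ 'n) set \<Rightarrow> 'n vmeasure \<Rightarrow> (real ^ 'n \<Rightarrow> real) \<Rightarrow> bool" where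
  "has_measure_div \<Omega> v u \<longleftrightarrow> u \<in> L2_space \<Omega> \<and>
     (\<forall>\<phi>\<in>C1_compact \<Omega>. pairing v (grad \<phi>) = - L2_inner \<Omega> u \<phi>)"

text \<open>Some representative; unique almost everywhere in \<open>\<Omega>\<close>.\<close>
definition measure_div :: "(real ^ 'n) set \<Rightarrow> 'n vmeasure \<Rightarrow> real ^ 'n \<Rightarrow> real" where
  "measure_div \<Omega> v = (SOME u. has_measure_div \<Omega> v u)"

definition V_M :: "(real ^ 'n) set \<Rightarrow> 'n vmeasure set" where
  "V_M \<Omega> = {v \<in> vector_radon_measures (closure \<Omega>). \<exists>u. has_measure_div \<Omega> v u}"

text \<open>The identification of \<open>[L\<^sup>1(\<Omega>)]\<^sup>d\<close> with a subspace of the vector measures.\<close>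
definition L1_vmeasure :: "(real ^ 'n) set \<Rightarrow> (real ^ 'n \<Rightarrow> real ^ 'n) \<Rightarrow> 'n vmeasure" where
  "L1_vmeasure \<Omega> v = (\<chi> i. (\<lambda>\<eta>. \<integral>x. v x $ i * \<eta> x \<partial>lebesgue_on \<Omega>))"

definition vague_conv :: "(real ^ 'n) set \<Rightarrow> (nat \<Rightarrow> 'n vmeasure) \<Rightarrow> 'n vmeasure \<Rightarrow> bool" where
  "vague_conv K vs v \<longleftrightarrow>
     (\<forall>i \<eta>. continuous_on K \<eta> \<longrightarrow> (\<lambda>j. (vs j $ i) \<eta>) \<longlonglongrightarrow> (v $ i) \<eta>)"

text \<open>The elements are the open simplices. The library's \<open>triangulation\<close> states conformity:
  any two closed elements meet in a common (possibly empty) face.\<close>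
definition simplicial_mesh :: "(real ^ 'n) set \<Rightarrow> (real ^ 'n) set set \<Rightarrow> bool" where
  "simplicial_mesh \<Omega> \<T> \<longleftrightarrow> finite \<T> \<and> disjoint \<T> \<and>
     (\<forall>\<sigma>\<in>\<T>. \<exists>C. int CARD('n) simplex C \<and> \<sigma> = interior C) \<and>
     triangulation (closure ` \<T>) \<and> (\<Union>\<sigma>\<in>\<T>. closure \<sigma>) = closure \<Omega>"

definition mesh_size :: "(real ^ 'n) set set \<Rightarrow> real" where
  "mesh_size \<T> = Max (diameter ` \<T>)"

text \<open>The index set \<open>H\<close> of mesh parameters is any set of positive reals accumulating at 0: a
  mesh whose size is exactly \<open>h\<close> cannot exist for large \<open>h\<close>. Shape regularity bounds the
  ratio of diameter and inradius of all elements uniformly.\<close>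
definition regular_mesh_family :: "(real ^ 'n) set \<Rightarrow> real set \<Rightarrow> (real \<Rightarrow> (real ^ 'n) set set) \<Rightarrow> bool" where
  "regular_mesh_family \<Omega> H \<T> \<longleftrightarrow> H \<subseteq> {0<..} \<and> 0 islimpt H \<and>
     (\<forall>h\<in>H. simplicial_mesh \<Omega> (\<T> h) \<and> mesh_size (\<T> h) = h) \<and>
     (\<exists>\<kappa>>0. \<forall>h\<in>H. \<forall>\<sigma>\<in>\<T> h. \<exists>x. ball x (\<kappa> * diameter \<sigma>) \<subseteq> \<sigma>)"

definition mesh_vertices :: "(real ^ 'n) set \<Rightarrow> (real ^ 'n) set" where
  "mesh_vertices \<sigma> = {x. x extreme_point_of closure \<sigma>}"

text \<open>Scalar or vector valued; values off the open elements (a null set in \<open>\<Omega>\<close>) are arbitrary.\<close>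
definition S_h :: "(real ^ 'n) set set \<Rightarrow> (real ^ 'n \<Rightarrow> 'b) set" where
  "S_h \<T> = {v. \<forall>\<sigma>\<in>\<T>. v constant_on \<sigma>}"

definition U_h :: "(real ^ 'n) set \<Rightarrow> (real ^ 'n) set set \<Rightarrow> (real ^ 'n \<Rightarrow> real) set" where
  "U_h \<Omega> \<T> = {\<eta>. continuous_on (closure \<Omega>) \<eta> \<and> (\<forall>\<sigma>\<in>\<T>. \<exists>a b. \<forall>x\<in>\<sigma>. \<eta> x = a \<bullet> x + b)}"

definition U_h0 :: "(real ^ 'n) set \<Rightarrow> (real ^ 'n) set set \<Rightarrow> (real ^ 'n \<Rightarrow> real) set" where
  "U_h0 \<Omega> \<T> = U_h \<Omega> \<T> \<inter> W1inf_0 \<Omega>"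

text \<open>Uniquely determined on the closure of \<open>\<Omega>\<close>.\<close>
definition nodal_interp :: "(real ^ 'n) set \<Rightarrow> (real ^ 'n) set set \<Rightarrow> (real ^ 'n \<Rightarrow> real) \<Rightarrow> real ^ 'n \<Rightarrow> real" where
  "nodal_interp \<Omega> \<T> v = (SOME u. u \<in> U_h \<Omega> \<T> \<and> (\<forall>\<sigma>\<in>\<T>. \<forall>x\<in>mesh_vertices \<sigma>. u x = v x))"

definition elem_mean :: "(real ^ 'n) set set \<Rightarrow> (real ^ 'n \<Rightarrow> real) \<Rightarrow> real ^ 'n \<Rightarrow> real" where
  "elem_mean \<T> v x =
     (\<Sum>\<sigma>\<in>\<T>. indicator \<sigma> x * ((\<integral>y. v y \<partial>lebesgue_on \<sigma>) / measure lebesgue \<sigma>))"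

definition lumped_inner :: "(real ^ 'n) set set \<Rightarrow> (real ^ 'n \<Rightarrow> real) \<Rightarrow> (real ^ 'n \<Rightarrow> real) \<Rightarrow> real" where
  "lumped_inner \<T> \<eta> \<zeta> =
     (\<Sum>\<sigma>\<in>\<T>. measure lebesgue \<sigma> / (real CARD('n) + 1) * (\<Sum>x\<in>mesh_vertices \<sigma>. \<eta> x * \<zeta> x))"

text \<open>The common pointwise formula: \<open>k\<^sub>1\<close> below \<open>w\<close>, \<open>k\<^sub>0\<close> above \<open>w + \<epsilon>\<close>, affine in between.\<close>
definition ramp :: "real \<Rightarrow> real \<Rightarrow> real \<Rightarrow> real \<Rightarrow> real \<Rightarrow> real" where
  "ramp k0 \<epsilon> k1 w s =
     (if s \<ge> w + \<epsilon> then k0 else if s \<ge> w then k1 + (k0 - k1) * ((s - w) / \<epsilon>) else k1)"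

text \<open>\<open>Dw0\<close> is the gradient of \<open>w0\<close> on the closure of the domain.\<close>
definition M_eps :: "real \<Rightarrow> real \<Rightarrow> (real ^ 'n \<Rightarrow> real) \<Rightarrow> (real ^ 'n \<Rightarrow> real ^ 'n) \<Rightarrow>
    (real ^ 'n \<Rightarrow> real) \<Rightarrow> real ^ 'n \<Rightarrow> real" where
  "M_eps k0 \<epsilon> w0 Dw0 \<eta> x = ramp k0 \<epsilon> (max k0 (norm (Dw0 x))) (w0 x) (\<eta> x)"

definition M_eps_h :: "(real ^ 'n) set \<Rightarrow> (real ^ 'n) set set \<Rightarrow> real \<Rightarrow> real \<Rightarrow> (real ^ 'n \<Rightarrow> real) \<Rightarrow>
    (real ^ 'n \<Rightarrow> real) \<Rightarrow> real ^ 'n \<Rightarrow> real" where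
  "M_eps_h \<Omega> \<T> k0 \<epsilon> w0 \<eta> x =
     ramp k0 \<epsilon> (max k0 (norm (grad (nodal_interp \<Omega> \<T> w0) x)))
       (elem_mean \<T> (nodal_interp \<Omega> \<T> w0) x) (\<eta> x)"

definition time_partition :: "real \<Rightarrow> nat \<Rightarrow> (nat \<Rightarrow> real) \<Rightarrow> bool" where
  "time_partition T N t \<longleftrightarrow> t 0 = 0 \<and> t N = T \<and> (\<forall>n<N. t n < t (Suc n))"

definition time_step :: "(nat \<Rightarrow> real) \<Rightarrow> nat \<Rightarrow> real" where
  "time_step t n = t n - t (n - 1)"

definition time_mean :: "(nat \<Rightarrow> real) \<Rightarrow> (real \<Rightarrow> real ^ 'n \<Rightarrow> real) \<Rightarrow> nat \<Rightarrow> real ^ 'n \<Rightarrow> real" where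
  "time_mean t f n x = (\<integral>s. f s x \<partial>lebesgue_on {t (n - 1)<..<t n}) / time_step t n"

definition solves_Q_A :: "(real ^ 'n) set \<Rightarrow> (real ^ 'n) set set \<Rightarrow> real \<Rightarrow> real \<Rightarrow> (real ^ 'n \<Rightarrow> real) \<Rightarrow>
    nat \<Rightarrow> (nat \<Rightarrow> real) \<Rightarrow> (real \<Rightarrow> real ^ 'n \<Rightarrow> real) \<Rightarrow>
    (nat \<Rightarrow> real ^ 'n \<Rightarrow> real) \<Rightarrow> (nat \<Rightarrow> real ^ 'n \<Rightarrow> real ^ 'n) \<Rightarrow> bool" where
  "solves_Q_A \<Omega> \<T> k0 \<epsilon> w0 N t f W Q \<longleftrightarrow>
     (\<forall>x\<in>closure \<Omega>. W 0 x = nodal_interp \<Omega> \<T> w0 x) \<and>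
     (\<forall>n\<in>{1..N}.
        W n \<in> U_h0 \<Omega> \<T> \<and> Q n \<in> S_h \<T> \<and>
        (\<forall>\<eta>\<in>U_h0 \<Omega> \<T>.
           lumped_inner \<T> (\<lambda>x. (W n x - W (n - 1) x) / time_step t n) \<eta>
             - L2_inner \<Omega> (Q n) (grad \<eta>) = L2_inner \<Omega> (time_mean t f n) \<eta>) \<and>
        (\<forall>v\<in>S_h \<T>.
           L2_inner \<Omega> (M_eps_h \<Omega> \<T> k0 \<epsilon> w0 (elem_mean \<T> (W n))) (\<lambda>x. norm (v x) - norm (Q n x))
             + L2_inner \<Omega> (grad (W n)) (\<lambda>x. v x - Q n x) \<ge> 0))"

definition solves_Q_tau :: "(real ^ 'n) set \<Rightarrow> real \<Rightarrow> real \<Rightarrow> (real ^ 'n \<Rightarrow> real) \<Rightarrow>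
    (real ^ 'n \<Rightarrow> real ^ 'n) \<Rightarrow> nat \<Rightarrow> (nat \<Rightarrow> real) \<Rightarrow> (real \<Rightarrow> real ^ 'n \<Rightarrow> real) \<Rightarrow>
    (nat \<Rightarrow> real ^ 'n \<Rightarrow> real) \<Rightarrow> (nat \<Rightarrow> 'n vmeasure) \<Rightarrow> bool" where
  "solves_Q_tau \<Omega> k0 \<epsilon> w0 Dw0 N t f w q \<longleftrightarrow>
     (\<forall>x\<in>closure \<Omega>. w 0 x = w0 x) \<and>
     (\<forall>n\<in>{1..N}.
        w n \<in> W1inf_0 \<Omega> \<and> q n \<in> V_M \<Omega> \<and>
        (\<forall>\<eta>\<in>L2_space \<Omega>.
           L2_inner \<Omega> (\<lambda>x. (w n x - w (n - 1) x) / time_step t n) \<eta>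
             + L2_inner \<Omega> (measure_div \<Omega> (q n)) \<eta> = L2_inner \<Omega> (time_mean t f n) \<eta>) \<and>
        (\<forall>v\<in>V_M \<Omega>.
           total_variation (closure \<Omega>) v (M_eps k0 \<epsilon> w0 Dw0 (w n))
             - total_variation (closure \<Omega>) (q n) (M_eps k0 \<epsilon> w0 Dw0 (w n))
             - L2_inner \<Omega> (measure_div \<Omega> (v - q n)) (w n) \<ge> 0))"

end

theory Submission
  imports Defs "HOL-Complex_Analysis.Great_Picard"
begin

text \<open>Testing the discrete variational inequality on one element gives \<open>|\<nabla>W| \<le> M\<close> and
  \<open>M |Q| + \<nabla>W \<cdot> Q = 0\<close> there. Hence the iterates are equi-Lipschitz, and testing the discrete equation
  with \<open>W\<close> bounds \<open>Q\<close> in \<open>L\<^sup>1\<close>, so that Arzela--Ascoli and vague compactness yield a convergent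
  subsequence. In the limit \<open>\<langle>|q|, M\<rangle> \<le> lim (M, |Q|) = (\<nabla> \<cdot> q, w)\<close> by lower semicontinuity of the
  total variation. Conversely \<open>(\<nabla> \<cdot> v, w) \<le> \<langle>|v|, M\<rangle>\<close> for every competitor \<open>v\<close>, since contracting the
  zero extension of \<open>w\<close> towards an interior point and mollifying approximates \<open>w\<close> by \<open>C\<^sup>1\<close> functions with
  compact support whose gradients are bounded by \<open>M\<close> up to a small error. The two inequalities add
  up to the limiting variational inequality.\<close>

section \<open>Mollification\<close>

text \<open>The obstacle is that \<open>q\<close> is only a measure on the closure: it may charge
  the boundary and null sets, so it cannot be paired with the merely bounded gradient of
  \<open>w\<close>. Bounds on that gradient are therefore carried as increment bounds along
  segments, which also control mollified functions pointwise. Convexity enters three times: segments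
  stay in the closure, shrinking towards an interior point moves the closure into
  \<open>\<Omega>\<close>, and the closest-point projection extends \<open>M\<close> continuously to
  the whole space. The positivity of \<open>k0\<close> has two roles: it turns the bound on
  \<open>(M, |Q|)\<close> into an L1 bound on \<open>Q\<close>, and it absorbs an additive error
  \<open>e\<close> in a gradient bound into the factor \<open>1 + e / k0\<close>. Time levels
  interact only through the uniform limit of the previous iterate, so on a common subsequence each
  level passes to the limit separately.\<close>

definition bump :: "real \<Rightarrow> 'a::real_inner \<Rightarrow> real" where
  "bump d z = (max 0 (d\<^sup>2 - z \<bullet> z))\<^sup>2"

text \<open>The kernel \<open>bump\<close> is a squared positive part, hence C1 with an explicit
  gradient; this is the regularity that \<open>C1_compact\<close> asks for. Normalisation is a
  division outside the integral, so that differentiation concerns the bare kernel.\<close>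

definition mollify :: "real \<Rightarrow> ('a::euclidean_space \<Rightarrow> real) \<Rightarrow> 'a \<Rightarrow> real" where
  "mollify d u x = (\<integral>y. bump d (x - y) * u y \<partial>lborel) / (\<integral>z. bump d (z::'a) \<partial>lborel)"

text \<open>Squaring removes the kink of the positive part: the difference quotient deviates from
  \<open>2 * max 0 s\<close> by at most \<open>\<bar>y - s\<bar>\<close>, uniformly over the four
  sign cases.\<close>

lemma DERIV_pos_part_square:
  "((\<lambda>s::real. (max 0 s)\<^sup>2) has_field_derivative 2 * max 0 s) (at s)"
proof -
  have bound: "\<bar>((max 0 y)\<^sup>2 - (max 0 s)\<^sup>2) / (y - s) - 2 * max 0 s\<bar> \<le> \<bar>y - s\<bar>" if "y \<noteq> s" for y
  proof -
    have "\<bar>(max 0 y)\<^sup>2 - (max 0 s)\<^sup>2 - 2 * max 0 s * (y - s)\<bar> \<le> (y - s)\<^sup>2"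
    proof (cases "0 \<le> s"; cases "0 \<le> y")
      assume "0 \<le> s" "0 \<le> y"
      then have "(max 0 y)\<^sup>2 - (max 0 s)\<^sup>2 - 2 * max 0 s * (y - s) = (y - s)\<^sup>2"
        by (simp add: max_def power2_eq_square algebra_simps)
      then show ?thesis by simp
    next
      assume *: "0 \<le> s" "\<not> 0 \<le> y"
      then have "s * y \<le> 0" by (simp add: mult_nonneg_nonpos)
      moreover have "(max 0 y)\<^sup>2 - (max 0 s)\<^sup>2 - 2 * max 0 s * (y - s) = s * s - 2 * (s * y)"
        using * by (simp add: max_def power2_eq_square algebra_simps)
      moreover have "(y - s)\<^sup>2 = y * y + s * s - 2 * (s * y)"
        by (simp add: power2_eq_square algebra_simps)
      ultimately show ?thesis using zero_le_square[of y] zero_le_square[of s] by linarith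
    next
      assume *: "\<not> 0 \<le> s" "0 \<le> y"
      then have "s * y \<le> 0" by (simp add: mult_nonpos_nonneg)
      then show ?thesis using * zero_le_square[of y] zero_le_square[of s]
        by (auto simp: max_def power2_eq_square algebra_simps abs_if)
    next
      assume *: "\<not> 0 \<le> s" "\<not> 0 \<le> y"
      then show ?thesis by (simp add: max_def)
    qed
    then have "\<bar>((max 0 y)\<^sup>2 - (max 0 s)\<^sup>2 - 2 * max 0 s * (y - s)) / (y - s)\<bar> \<le> (y - s)\<^sup>2 / \<bar>y - s\<bar>"
      unfolding abs_divide by (rule divide_right_mono) simp
    also have "(y - s)\<^sup>2 / \<bar>y - s\<bar> = \<bar>y - s\<bar>"
      by (metis power2_abs power2_eq_square nonzero_mult_div_cancel_left abs_zero divide_eq_0_iff mult_zero_left)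
    finally show ?thesis using that by (simp add: diff_divide_distrib)
  qed
  have "(\<lambda>y. ((max 0 y)\<^sup>2 - (max 0 s)\<^sup>2) / (y - s) - 2 * max 0 s) \<midarrow>s\<rightarrow> 0"
  proof (rule Lim_null_comparison)
    show "\<forall>\<^sub>F y in at s. norm (((max 0 y)\<^sup>2 - (max 0 s)\<^sup>2) / (y - s) - 2 * max 0 s) \<le> \<bar>y - s\<bar>"
      unfolding eventually_at_filter using bound by (auto simp: eventually_at)
    show "(\<lambda>y. \<bar>y - s\<bar>) \<midarrow>s\<rightarrow> 0"
      by (intro tendsto_eq_intros) auto
  qed
  then show ?thesis
    unfolding has_field_derivative_iff by (rule LIM_zero_cancel)
qed

lemma bump_has_derivative:
  "(bump d has_derivative (\<lambda>h. h \<bullet> ((- 4 * max 0 (d\<^sup>2 - z \<bullet> z)) *\<^sub>R z))) (at z)"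
proof -
  have "((\<lambda>z. d\<^sup>2 - z \<bullet> z) has_derivative (\<lambda>h. - 2 * (h \<bullet> z))) (at z)"
    by (auto intro!: derivative_eq_intros simp: inner_commute)
  from has_derivative_compose[OF this DERIV_pos_part_square[unfolded has_field_derivative_def]]
  show ?thesis unfolding bump_def[abs_def] by (simp add: algebra_simps)
qed

lemma continuous_on_bump [continuous_intros]:
  "continuous_on S f \<Longrightarrow> continuous_on S (\<lambda>x. bump d (f x))"
  unfolding bump_def by (intro continuous_intros)

lemma bump_nonneg [simp]: "0 \<le> bump d z"
  by (simp add: bump_def)

lemma bump_eq_0: "0 < d \<Longrightarrow> d \<le> norm z \<Longrightarrow> bump d z = 0"
  by (auto simp: bump_def dot_square_norm intro!: power_mono)

lemma bump_pos: "norm z < d \<Longrightarrow> 0 < bump d z"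
  unfolding bump_def using power_strict_mono[of "norm z" d 2] by (simp add: dot_square_norm)

lemma integrable_continuous_compact_support:
  fixes f :: "'a::euclidean_space \<Rightarrow> 'b::euclidean_space"
  assumes "continuous_on UNIV f" "\<And>x. x \<notin> cbox a b \<Longrightarrow> f x = 0"
  shows "integrable lborel f" and "(\<integral>x. f x \<partial>lborel) = integral (cbox a b) f"
proof -
  have eq: "indicator (cbox a b) x *\<^sub>R f x = f x" for x
    using assms(2)[of x] by (cases "x \<in> cbox a b") auto
  have "set_integrable lborel (cbox a b) f"
    unfolding set_integrable_def
    by (intro borel_integrable_compact) (auto intro: continuous_on_subset[OF assms(1)])
  from this set_borel_integral_eq_integral(2)[OF this]
  show "integrable lborel f" "(\<integral>x. f x \<partial>lborel) = integral (cbox a b) f"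
    unfolding set_integrable_def set_lebesgue_integral_def eq by auto
qed

lemma integrable_bump: "0 < d \<Longrightarrow> integrable lborel (bump d :: 'a::euclidean_space \<Rightarrow> real)"
proof (rule integrable_continuous_compact_support(1)[of _ "- (\<Sum>i\<in>Basis. d *\<^sub>R i)" "\<Sum>i\<in>Basis. d *\<^sub>R i"])
  assume "0 < d"
  show "continuous_on UNIV (bump d :: 'a \<Rightarrow> real)"
    by (intro continuous_intros)
  fix x :: 'a
  assume "x \<notin> cbox (- (\<Sum>i\<in>Basis. d *\<^sub>R i)) (\<Sum>i\<in>Basis. d *\<^sub>R i)"
  then obtain i where i: "i \<in> Basis" "d < \<bar>x \<bullet> i\<bar>"
    by (auto simp: mem_box not_le)
  then have "d \<le> norm x" using Basis_le_norm[OF i(1), of x] by linarith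
  then show "bump d x = 0" using \<open>0 < d\<close> by (rule bump_eq_0[rotated])
qed

lemma integral_bump_pos:
  assumes "0 < d" shows "0 < (\<integral>z. bump d (z::'a::euclidean_space) \<partial>lborel)"
proof -
  have "0 \<le> (\<integral>z. bump d (z::'a) \<partial>lborel)" by simp
  moreover have "(\<integral>z. bump d (z::'a) \<partial>lborel) \<noteq> 0"
  proof
    assume "(\<integral>z. bump d (z::'a) \<partial>lborel) = 0"
    then have "AE z in lborel. bump d (z::'a) = 0"
      using integral_nonneg_eq_0_iff_AE[OF integrable_bump[where 'a='a, OF assms]] by simp
    then have "AE z in lborel. (z::'a) \<notin> ball 0 d"
      by eventually_elim (use bump_pos in \<open>force simp: dist_norm\<close>)
    then have "ball (0::'a) d \<in> null_sets lborel"
      by (subst AE_iff_null_sets) auto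
    then have "negligible (ball (0::'a) d)"
      using null_sets_completionI negligible_iff_null_sets by blast
    then show False
      using assms open_not_negligible[of "ball (0::'a) d"] by auto
  qed
  ultimately show ?thesis by linarith
qed

text \<open>Putting the shift on \<open>u\<close> instead of on the kernel lets pointwise
  information about \<open>u\<close> pass to the mollification; the original form is the one to
  differentiate.\<close>

lemma mollify_translate:
  fixes u :: "'a::euclidean_space \<Rightarrow> real"
  assumes "continuous_on UNIV u"
  shows "(\<integral>y. bump d (x - y) * u y \<partial>lborel) = (\<integral>z. bump d z * u (x - z) \<partial>lborel)"
proof -
  have [measurable]: "u \<in> borel_measurable borel" "(bump d :: 'a \<Rightarrow> real) \<in> borel_measurable borel"
    using assms by (auto intro!: borel_measurable_continuous_onI continuous_intros)
  \<comment> \<open>Reflection followed by a shift preserves Lebesgue measure, so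
    \<open>lborel\<close> may be replaced by its image under this map.\<close>
  have "(\<integral>y. bump d (x - y) * u y \<partial>lborel)
      = (\<integral>y. bump d (x - y) * u y \<partial>(distr lborel borel (\<lambda>z. x + (-1) *\<^sub>R z)))"
    by (subst lborel_affine[of "-1" x]) (simp_all add: density_1)
  also have "\<dots> = (\<integral>z. bump d z * u (x - z) \<partial>lborel)"
    by (subst integral_distr) auto
  finally show ?thesis .
qed


lemma integrable_bump_mult:
  fixes u :: "'a::euclidean_space \<Rightarrow> real"
  assumes "continuous_on UNIV u" and supp: "\<And>x. x \<notin> cbox a b \<Longrightarrow> u x = 0"
  shows "integrable lborel (\<lambda>z. bump d z * u (x - z))"
proof (rule integrable_continuous_compact_support(1)[of _ "x - b" "x - a"])
  show "continuous_on UNIV (\<lambda>z. bump d z * u (x - z))"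
    by (intro continuous_intros continuous_on_compose2[OF assms(1)]) auto
  fix z assume "z \<notin> cbox (x - b) (x - a)"
  then have "x - z \<notin> cbox a b" by (auto simp: mem_box algebra_simps)
  then show "bump d z * u (x - z) = 0" using supp by simp
qed

text \<open>Averaging with equal weights preserves a one-sided comparison of two translates of
  \<open>u\<close>. Taken with \<open>B\<close> proportional to the distance of \<open>x\<close> and
  \<open>y\<close>, it yields a Lipschitz bound for the mollification.\<close>

lemma mollify_average:
  fixes u :: "'a::euclidean_space \<Rightarrow> real"
  assumes "continuous_on UNIV u" "0 < d"
    and le: "\<And>z. norm z \<le> d \<Longrightarrow> u (x - z) \<le> u (y - z) + B"
    and supp: "\<And>x. x \<notin> cbox a b \<Longrightarrow> u x = 0"
  shows "mollify d u x \<le> mollify d u y + B"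
proof -
  have int: "integrable lborel (\<lambda>z. bump d z * u (x - z))" for x
    by (rule integrable_bump_mult[OF assms(1) supp])
  have "(\<integral>z. bump d z * u (x - z) \<partial>lborel) \<le> (\<integral>z. bump d z * u (y - z) + B * bump d z \<partial>lborel)"
  proof (rule integral_mono)
    show "integrable lborel (\<lambda>z. bump d z * u (y - z) + B * bump d z)"
      using int integrable_bump[where 'a='a, OF assms(2)] by auto
    fix z :: 'a
    show "bump d z * u (x - z) \<le> bump d z * u (y - z) + B * bump d z"
    proof (cases "norm z \<le> d")
      case True
      from mult_left_mono[OF le[OF this] bump_nonneg[of d z]] show ?thesis by (simp add: algebra_simps)
    next
      case False
      then show ?thesis using bump_eq_0[OF assms(2), of z] by simp
    qed
  qed (rule int)
  also have "\<dots> = (\<integral>z. bump d z * u (y - z) \<partial>lborel) + B * (\<integral>z. bump d (z::'a) \<partial>lborel)"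
    using int integrable_bump[where 'a='a, OF assms(2)] by simp
  finally show ?thesis
    using integral_bump_pos[where 'a='a, OF assms(2)]
    unfolding mollify_def mollify_translate[OF assms(1)] by (simp add: field_simps)
qed

text \<open>A weighted mean of the values of \<open>u\<close> on the ball of radius \<open>d\<close>
  stays in every interval that contains them. With \<open>l = r\<close> this evaluates the
  mollification exactly, which gives supports and plateaus of cutoffs.\<close>

lemma mollify_bounds:
  fixes u :: "'a::euclidean_space \<Rightarrow> real"
  assumes "continuous_on UNIV u" "0 < d"
    and supp: "\<And>x. x \<notin> cbox a b \<Longrightarrow> u x = 0"
    and le: "\<And>z. norm z \<le> d \<Longrightarrow> l \<le> u (x - z) \<and> u (x - z) \<le> r"
  shows "l \<le> mollify d u x \<and> mollify d u x \<le> r"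
proof -
  let ?J = "\<integral>z. bump d (z::'a) \<partial>lborel"
  have int: "integrable lborel (\<lambda>z. bump d z * u (x - z))"
    by (rule integrable_bump_mult[OF assms(1) supp])
  have pw: "l * bump d z \<le> bump d z * u (x - z) \<and> bump d z * u (x - z) \<le> r * bump d z" for z
  proof (cases "norm z \<le> d")
    case True
    with le[OF this] show ?thesis
      by (metis bump_nonneg mult.commute mult_left_mono)
  next
    case False
    then show ?thesis using bump_eq_0[OF assms(2), of z] by simp
  qed
  have "l * ?J \<le> (\<integral>z. bump d z * u (x - z) \<partial>lborel)" "(\<integral>z. bump d z * u (x - z) \<partial>lborel) \<le> r * ?J"
    using integral_mono[OF _ int, of "\<lambda>z. l * bump d z"] integral_mono[OF int, of "\<lambda>z. r * bump d z"]
      integrable_bump[where 'a='a, OF assms(2)] pw by auto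
  then show ?thesis
    using integral_bump_pos[where 'a='a, OF assms(2)]
    unfolding mollify_def mollify_translate[OF assms(1)] by (simp add: field_simps)
qed

text \<open>Only the kernel depends on \<open>x\<close>, and the support of \<open>u\<close> lies in
  a box independent of \<open>x\<close>. The Leibniz rule therefore applies on a fixed compact
  domain; its derivative is a bounded linear map, which has to be rewritten as an inner product with
  a vector integral.\<close>

lemma mollify_gradient:
  fixes u :: "'a::euclidean_space \<Rightarrow> real"
  assumes "continuous_on UNIV u" "0 < d"
    and supp: "\<And>x. x \<notin> cbox a b \<Longrightarrow> u x = 0"
  obtains G where "\<And>x. GDERIV (mollify d u) x :> G x" "continuous_on UNIV G"
proof -
  \<comment> \<open>\<open>k\<close> is the gradient of \<open>bump d\<close>, and \<open>g\<close>
    is the gradient of the mollification before normalisation by \<open>J\<close>.\<close>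
  define k where "k x = (- 4 * max 0 (d\<^sup>2 - x \<bullet> x)) *\<^sub>R x" for x :: 'a
  define J where "J = (\<integral>z. bump d (z::'a) \<partial>lborel)"
  define g where "g x = integral (cbox a b) (\<lambda>y. u y *\<^sub>R k (x - y))" for x
  have cont_uk: "continuous_on (UNIV \<times> cbox a b) (\<lambda>(x, y). u y *\<^sub>R k (x - y))"
    unfolding k_def split_beta
    by (intro continuous_intros continuous_on_compose2[OF assms(1)]) auto
  have eq: "(\<integral>y. bump d (x - y) * u y \<partial>lborel) = integral (cbox a b) (\<lambda>y. bump d (x - y) * u y)" for x
    by (rule integrable_continuous_compact_support(2))
      (auto intro!: continuous_intros continuous_on_compose2[OF assms(1)] simp: supp)
  have "((\<lambda>x. integral (cbox a b) (\<lambda>y. bump d (x - y) * u y)) has_derivative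
      integral (cbox a b) (\<lambda>y. blinfun_inner_left (u y *\<^sub>R k (x - y)))) (at x)" for x
  proof (rule leibniz_rule)
    fix x y
    have "((\<lambda>x. bump d (x - y)) has_derivative (\<lambda>h. h \<bullet> k (x - y))) (at x)"
    proof -
      have "((\<lambda>x. x - y) has_derivative (\<lambda>h. h)) (at x)"
        by (auto intro!: derivative_eq_intros)
      from has_derivative_compose[OF this bump_has_derivative[of d "x - y"]] show ?thesis
        unfolding k_def .
    qed
    then have "((\<lambda>x. bump d (x - y) * u y) has_derivative (\<lambda>h. (h \<bullet> k (x - y)) * u y)) (at x)"
      by (rule has_derivative_mult_left)
    then show "((\<lambda>x. bump d (x - y) * u y) has_derivative
        blinfun_apply (blinfun_inner_left (u y *\<^sub>R k (x - y)))) (at x within UNIV)"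
      by (simp add: mult.commute inner_commute)
  next
    show "(\<lambda>y. bump d (x - y) * u y) integrable_on cbox a b" for x
      by (intro integrable_continuous continuous_intros continuous_on_compose2[OF assms(1)]) auto
    show "continuous_on (UNIV \<times> cbox a b) (\<lambda>(x, y). blinfun_inner_left (u y *\<^sub>R k (x - y)))"
      using bounded_linear.continuous_on[OF bounded_linear_blinfun_inner_left cont_uk]
      by (simp add: split_beta)
  qed auto
  moreover have "blinfun_apply (integral (cbox a b) (\<lambda>y. blinfun_inner_left (u y *\<^sub>R k (x - y)))) h = h \<bullet> g x" for x h
  proof -
    have c: "continuous_on (cbox a b) (\<lambda>y. u y *\<^sub>R k (x - y))"
      unfolding k_def by (intro continuous_intros continuous_on_compose2[OF assms(1)]) auto
    have "integral (cbox a b) (\<lambda>y. blinfun_inner_left (u y *\<^sub>R k (x - y))) = blinfun_inner_left (g x)"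
      using integral_linear[OF integrable_continuous[OF c] bounded_linear_blinfun_inner_left]
      by (simp add: g_def o_def)
    then show ?thesis by (simp add: inner_commute)
  qed
  then have "blinfun_apply (integral (cbox a b) (\<lambda>y. blinfun_inner_left (u y *\<^sub>R k (x - y)))) = (\<lambda>h. h \<bullet> g x)" for x
    by auto
  ultimately have "((\<lambda>x. integral (cbox a b) (\<lambda>y. bump d (x - y) * u y)) has_derivative (\<lambda>h. h \<bullet> g x)) (at x)" for x
    by metis
  then have "((\<lambda>x. integral (cbox a b) (\<lambda>y. bump d (x - y) * u y) / J) has_derivative (\<lambda>h. h \<bullet> ((1 / J) *\<^sub>R g x))) (at x)" for x
    by (auto intro!: derivative_eq_intros simp: divide_inverse mult.commute)
  then have "GDERIV (mollify d u) x :> (1 / J) *\<^sub>R g x" for x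
    unfolding gderiv_def mollify_def[abs_def] eq J_def .
  moreover have "continuous_on UNIV (\<lambda>x. (1 / J) *\<^sub>R g x)"
    unfolding g_def by (intro continuous_intros integral_continuous_on_param cont_uk)
  ultimately show ?thesis by (rule that)
qed

lemma GDERIV_unique: "GDERIV f x :> D \<Longrightarrow> GDERIV f x :> E \<Longrightarrow> D = E"
  unfolding gderiv_def
  by (metis has_derivative_unique vector_eq_rdot inner_commute)

lemma grad_eq: "GDERIV u x :> D \<Longrightarrow> grad u x = D"
  unfolding grad_def by (rule the_equality) (auto dest: GDERIV_unique)

text \<open>The adjoint of the derivative, applied to 1, is the vector that represents it.\<close>

lemma differentiable_imp_GDERIV:
  assumes "f differentiable (at x)" shows "GDERIV f x :> grad f x"
proof -
  from assms obtain D where D: "(f has_derivative D) (at x)"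
    by (auto simp: differentiable_def)
  interpret D: linear D using D by (rule has_derivative_linear)
  have "D h = h \<bullet> adjoint D 1" for h
    using adjoint_works[OF D.linear_axioms, of h 1] by (simp add: inner_commute)
  then have "GDERIV f x :> adjoint D 1"
    using D unfolding gderiv_def by (metis ext)
  then show ?thesis using grad_eq by metis
qed

lemma GDERIV_imp_differentiable: "GDERIV f x :> D \<Longrightarrow> f differentiable (at x)"
  unfolding gderiv_def by (auto simp: differentiable_def)

text \<open>Mollification spreads the support by at most \<open>d\<close>, so the sum of
  \<open>S\<close> and the closed ball of radius \<open>d\<close> is a compact set that carries the
  result.\<close>

lemma mollify_C1_compact:
  assumes "continuous_on UNIV u" "0 < d" "compact S"
    and supp: "\<And>x. x \<notin> S \<Longrightarrow> u x = 0"
    and sub: "\<And>x z. x \<in> S \<Longrightarrow> norm z \<le> d \<Longrightarrow> x + z \<in> \<Omega>"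
  shows "mollify d u \<in> C1_compact \<Omega>"
proof -
  obtain a b where "S \<subseteq> cbox a b"
    using bounded_subset_cbox_symmetric[OF compact_imp_bounded[OF assms(3)]] by metis
  then have supp': "u x = 0" if "x \<notin> cbox a b" for x using that supp by blast
  obtain G where G: "\<And>x. GDERIV (mollify d u) x :> G x" "continuous_on UNIV G"
    using mollify_gradient[OF assms(1,2) supp'] by metis
  have "grad (mollify d u) = G" using grad_eq[OF G(1)] by auto
  moreover have "mollify d u differentiable (at x)" for x
    using G(1) GDERIV_imp_differentiable by blast
  moreover have "\<exists>S. compact S \<and> S \<subseteq> \<Omega> \<and> (\<forall>x. x \<notin> S \<longrightarrow> mollify d u x = 0)"
  proof (intro exI conjI allI impI)
    show "compact {x + y | x y. x \<in> S \<and> y \<in> cball 0 d}"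
      using compact_sums[OF assms(3) compact_cball[of 0 d]] .
    show "{x + y | x y. x \<in> S \<and> y \<in> cball 0 d} \<subseteq> \<Omega>"
      using sub by (auto simp: dist_norm)
    fix x assume x: "x \<notin> {x + y | x y. x \<in> S \<and> y \<in> cball 0 d}"
    have "u (x - z) = 0" if "norm z \<le> d" for z
    proof (rule supp)
      show "x - z \<notin> S"
      proof
        assume "x - z \<in> S"
        then have "(x - z) + z \<in> {x + y | x y. x \<in> S \<and> y \<in> cball 0 d}"
          using that by (intro CollectI exI[of _ "x - z"] exI[of _ z]) simp
        then show False using x by simp
      qed
    qed
    then have "0 \<le> mollify d u x \<and> mollify d u x \<le> 0"
      by (intro mollify_bounds[OF assms(1,2) supp']) auto
    then show "mollify d u x = 0" by auto
  qed
  ultimately show ?thesis using G(2) by (auto simp: C1_compact_def)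
qed

section \<open>Density and weak limits\<close>

text \<open>Near a point off the support the function is identically 0, so its gradient vanishes
  there as well.\<close>

lemma C1_compactE:
  assumes "\<phi> \<in> C1_compact \<Omega>"
  obtains S where "compact S" "S \<subseteq> \<Omega>" "\<And>x. x \<notin> S \<Longrightarrow> \<phi> x = 0" "\<And>x. GDERIV \<phi> x :> grad \<phi> x"
    "continuous_on UNIV \<phi>" "continuous_on UNIV (grad \<phi>)" "\<And>x. x \<notin> S \<Longrightarrow> grad \<phi> x = 0"
proof -
  obtain S where S: "compact S" "S \<subseteq> \<Omega>" "\<And>x. x \<notin> S \<Longrightarrow> \<phi> x = 0"
    using assms by (auto simp: C1_compact_def)
  have D: "\<phi> differentiable (at x)" for x using assms by (auto simp: C1_compact_def)
  have "grad \<phi> x = 0" if "x \<notin> S" for x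
  proof (rule grad_eq)
    have "GDERIV (\<lambda>x. 0) x :> 0" by (rule GDERIV_const)
    then show "GDERIV \<phi> x :> 0" unfolding gderiv_def
      by (rule has_derivative_transform_within_open[of _ _ _ _ "- S"])
        (use S that compact_imp_closed in \<open>auto simp: open_closed\<close>)
  qed
  then show ?thesis
    using that[OF S differentiable_imp_GDERIV[OF D]] assms D
    by (auto simp: C1_compact_def continuous_on_eq_continuous_within differentiable_imp_continuous_within)
qed

lemma C1_compact_add:
  assumes "\<phi> \<in> C1_compact \<Omega>" "\<psi> \<in> C1_compact \<Omega>"
  shows "(\<lambda>x. \<phi> x + \<psi> x) \<in> C1_compact \<Omega>"
proof -
  obtain S where S: "compact S" "S \<subseteq> \<Omega>" "\<And>x. x \<notin> S \<Longrightarrow> \<phi> x = 0" "\<And>x. GDERIV \<phi> x :> grad \<phi> x"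
    "continuous_on UNIV (grad \<phi>)" using C1_compactE[OF assms(1)] by metis
  obtain S' where S': "compact S'" "S' \<subseteq> \<Omega>" "\<And>x. x \<notin> S' \<Longrightarrow> \<psi> x = 0" "\<And>x. GDERIV \<psi> x :> grad \<psi> x"
    "continuous_on UNIV (grad \<psi>)" using C1_compactE[OF assms(2)] by metis
  have G: "GDERIV (\<lambda>x. \<phi> x + \<psi> x) x :> grad \<phi> x + grad \<psi> x" for x
    by (intro GDERIV_add S S')
  have "continuous_on UNIV (grad (\<lambda>x. \<phi> x + \<psi> x))"
    unfolding grad_eq[OF G, abs_def] by (intro continuous_intros S S')
  moreover have "\<exists>C. compact C \<and> C \<subseteq> \<Omega> \<and> (\<forall>x. x \<notin> C \<longrightarrow> \<phi> x + \<psi> x = 0)"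
    using S S' by (intro exI[of _ "S \<union> S'"]) auto
  ultimately show ?thesis
    using GDERIV_imp_differentiable[OF G] by (auto simp: C1_compact_def)
qed

lemma C1_compact_scale:
  assumes "\<phi> \<in> C1_compact \<Omega>"
  shows "(\<lambda>x. c * \<phi> x) \<in> C1_compact \<Omega>"
proof -
  obtain S where S: "compact S" "S \<subseteq> \<Omega>" "\<And>x. x \<notin> S \<Longrightarrow> \<phi> x = 0" "\<And>x. GDERIV \<phi> x :> grad \<phi> x"
    "continuous_on UNIV (grad \<phi>)" using C1_compactE[OF assms(1)] by metis
  have G: "GDERIV (\<lambda>x. c * \<phi> x) x :> c *\<^sub>R grad \<phi> x" for x
    using S(4)[of x] unfolding gderiv_def
    by (auto intro!: derivative_eq_intros)
  have "continuous_on UNIV (grad (\<lambda>x. c * \<phi> x))"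
    unfolding grad_eq[OF G, abs_def] by (intro continuous_intros S)
  moreover have "\<exists>C. compact C \<and> C \<subseteq> \<Omega> \<and> (\<forall>x. x \<notin> C \<longrightarrow> c * \<phi> x = 0)"
    using S by (intro exI[of _ "S"]) auto
  ultimately show ?thesis
    using GDERIV_imp_differentiable[OF G] by (auto simp: C1_compact_def)
qed

lemma C1_compact_integrable:
  assumes "\<phi> \<in> C1_compact \<Omega>" "\<Omega> \<in> lmeasurable"
  shows "integrable (lebesgue_on \<Omega>) \<phi>" "\<phi> \<in> borel_measurable (lebesgue_on \<Omega>)"
    "\<exists>C. \<forall>x. \<bar>\<phi> x\<bar> \<le> C" "\<exists>C. \<forall>x. norm (grad \<phi> x) \<le> C"
    "grad \<phi> \<in> borel_measurable (lebesgue_on \<Omega>)"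
proof -
  interpret finite_measure "lebesgue_on \<Omega>" using assms(2) by (rule finite_measure_lebesgue_on)
  obtain S where S: "compact S" "\<And>x. x \<notin> S \<Longrightarrow> \<phi> x = 0" "continuous_on UNIV \<phi>"
     "continuous_on UNIV (grad \<phi>)" "\<And>x. x \<notin> S \<Longrightarrow> grad \<phi> x = 0"
    using C1_compactE[OF assms(1)] by metis
  have "bounded (\<phi> ` S)" "bounded (grad \<phi> ` S)"
    using S by (auto intro!: compact_imp_bounded compact_continuous_image intro: continuous_on_subset)
  then obtain C D where C: "\<And>x. x \<in> S \<Longrightarrow> norm (\<phi> x) \<le> C" "\<And>x. x \<in> S \<Longrightarrow> norm (grad \<phi> x) \<le> D"
    unfolding bounded_iff by auto
  then have "\<bar>\<phi> x\<bar> \<le> max C 0 \<and> norm (grad \<phi> x) \<le> max D 0" for x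
    using S(2)[of x] S(5)[of x] by (cases "x \<in> S") (force simp: le_max_iff_disj)+
  then show b: "\<exists>C. \<forall>x. \<bar>\<phi> x\<bar> \<le> C" "\<exists>C. \<forall>x. norm (grad \<phi> x) \<le> C" by blast+
  show m: "\<phi> \<in> borel_measurable (lebesgue_on \<Omega>)" "grad \<phi> \<in> borel_measurable (lebesgue_on \<Omega>)"
    using assms(2) S by (auto intro!: continuous_imp_measurable_on_sets_lebesgue intro: continuous_on_subset simp: fmeasurableD)
  from b(1) obtain C where "\<And>x. \<bar>\<phi> x\<bar> \<le> C" by blast
  then show "integrable (lebesgue_on \<Omega>) \<phi>"
    by (intro integrable_const_bound[of _ C] m) auto
qed

text \<open>Regularity of Lebesgue measure places \<open>A\<close> between a compact
  \<open>K\<close> and an open \<open>U\<close> whose difference has measure below \<open>e\<close>.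
  A cutoff that is 1 on \<open>K\<close> and 0 off \<open>U\<close> differs from the indicator only
  on \<open>U - K\<close>, and by at most 1.\<close>

lemma C1_compact_approx_indicator:
  fixes \<Omega> :: "(real ^ 'n) set"
  assumes "open \<Omega>" "bounded \<Omega>" "A \<in> sets lebesgue" "A \<subseteq> \<Omega>" "0 < e"
  obtains \<phi> where "\<phi> \<in> C1_compact \<Omega>" "\<And>x. 0 \<le> \<phi> x \<and> \<phi> x \<le> 1"
    "(\<integral>x. \<bar>indicator A x - \<phi> x\<bar> \<partial>lebesgue_on \<Omega>) \<le> e"
proof -
  have \<Omega>: "\<Omega> \<in> lmeasurable" using assms by (simp add: lmeasurable_open)
  interpret finite_measure "lebesgue_on \<Omega>" using \<Omega> by (rule finite_measure_lebesgue_on)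
  have A: "A \<in> lmeasurable"
    using assms by (meson \<Omega> fmeasurableI2)
  obtain K where K: "closed K" "K \<subseteq> A" "A - K \<in> lmeasurable" "emeasure lebesgue (A - K) < ennreal (e / 2)"
    using sets_lebesgue_inner_closed[OF assms(3), of "e / 2"] \<open>0 < e\<close> by auto
  obtain V where V: "open V" "A \<subseteq> V" "V - A \<in> lmeasurable" "emeasure lebesgue (V - A) < ennreal (e / 2)"
    using sets_lebesgue_outer_open[OF assms(3), of "e / 2"] \<open>0 < e\<close> by auto
  have "bounded K" using K(2) assms(2,4) bounded_subset by blast
  then have cK: "compact K" using K(1) compact_eq_bounded_closed by blast
  define U where "U = V \<inter> \<Omega>"
  have U: "open U" "K \<subseteq> U" "A \<subseteq> U" using V K assms by (auto simp: U_def)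
  have mA: "measure lebesgue (A - K) < e / 2" "measure lebesgue (V - A) < e / 2"
    using K V \<open>0 < e\<close> by (auto simp: emeasure_eq_measure2 ennreal_less_iff)
  have ineq: "(\<integral>x. \<bar>indicator A x - \<phi> x\<bar> \<partial>lebesgue_on \<Omega>) \<le> e"
    if \<phi>: "\<phi> \<in> C1_compact \<Omega>" "\<And>x. 0 \<le> \<phi> x \<and> \<phi> x \<le> 1" "\<And>x. x \<in> K \<Longrightarrow> \<phi> x = 1" "\<And>x. x \<notin> U \<Longrightarrow> \<phi> x = 0" for \<phi>
  proof -
    have [measurable]: "\<phi> \<in> borel_measurable (lebesgue_on \<Omega>)"
      using C1_compact_integrable[OF \<phi>(1) \<Omega>] by auto
    have [measurable]: "A \<in> sets (lebesgue_on \<Omega>)"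
      using assms \<Omega> by (auto simp: sets_restrict_space_iff fmeasurableD)
    have UK: "U - K \<in> sets lebesgue" using U K by (auto simp: borel_closed borel_open)
    have [measurable]: "U - K \<in> sets (lebesgue_on \<Omega>)"
      using UK \<Omega> by (auto simp: sets_restrict_space_iff fmeasurableD U_def)
    have "(\<integral>x. \<bar>indicator A x - \<phi> x\<bar> \<partial>lebesgue_on \<Omega>) \<le> (\<integral>x. indicator (U - K) x \<partial>lebesgue_on \<Omega>)"
    proof (rule integral_mono)
      have "\<bar>indicator A x - \<phi> x\<bar> \<le> 1" for x
        using \<phi>(2)[of x] by (auto simp: indicator_def)
      then show "integrable (lebesgue_on \<Omega>) (\<lambda>x. \<bar>indicator A x - \<phi> x\<bar>)"
        by (intro integrable_const_bound[of _ 1]) auto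
      show "integrable (lebesgue_on \<Omega>) (indicator (U - K) :: _ \<Rightarrow> real)"
        by (rule integrable_const_bound[of _ 1]) auto
      fix x
      show "\<bar>indicator A x - \<phi> x\<bar> \<le> indicator (U - K) x"
        using \<phi>(2)[of x] \<phi>(3,4)[of x] K(2) U(3) by (auto simp: indicator_def)
    qed
    also have "\<dots> = measure lebesgue (U - K)"
      using UK \<Omega> by (simp add: measure_restrict_space fmeasurableD U_def Int_absorb2 Diff_subset
        le_infI2 subset_iff)
    also have "\<dots> \<le> measure lebesgue ((V - A) \<union> (A - K))"
      by (rule measure_mono_fmeasurable) (use UK V K in \<open>auto simp: U_def\<close>)
    also have "\<dots> \<le> measure lebesgue (V - A) + measure lebesgue (A - K)"
      by (rule measure_Un_le) (use V K in auto)
    finally show ?thesis using mA by linarith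
  qed
  \<comment> \<open>The distance to the empty set is 0 everywhere, so the cutoff built from
    \<open>infdist\<close> requires a nonempty \<open>K\<close>; for empty \<open>K\<close> the zero
    function does the job.\<close>
  show ?thesis
  proof (cases "K = {}")
    case True
    have "(\<lambda>x. 0) \<in> C1_compact \<Omega>"
    proof -
      have "grad (\<lambda>x. 0) = (\<lambda>x::real ^ 'n. 0)" using grad_eq[OF GDERIV_const[of "0::real"]] by blast
      then show ?thesis by (auto simp: C1_compact_def intro!: exI[of _ "{}"])
    qed
    then show ?thesis using ineq[of "\<lambda>_. 0"] True by (intro that[of "\<lambda>_. 0"]) auto
  next
    case False
    obtain r where r: "0 < r" "(\<Union>x\<in>K. cball x r) \<subseteq> U"
      using compact_subset_open_imp_cball_epsilon_subset[OF cK U(1,2)] by auto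
    have near: "x \<in> U" if "infdist x K \<le> r" for x
    proof -
      obtain y where "y \<in> K" "infdist x K = dist x y"
        using infdist_attains_inf[OF K(1) False] by metis
      then show ?thesis using that r by (force simp: dist_commute)
    qed
    \<comment> \<open>This equals 1 up to distance \<open>r / 4\<close> from \<open>K\<close> and 0
      from distance \<open>r / 2\<close> on. Mollifying at radius \<open>r / 4\<close> keeps the
      value 1 on \<open>K\<close> and stays within distance \<open>3 * r / 4\<close>, hence inside
      \<open>U\<close>.\<close>
    define \<psi> where "\<psi> x = min 1 (max 0 (2 - infdist x K * (4 / r)))" for x
    have cont: "continuous_on UNIV \<psi>"
      unfolding \<psi>_def by (intro continuous_intros)
    have \<psi>0: "\<psi> x = 0" if "x \<notin> {x. infdist x K \<le> r / 2}" for x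
    proof -
      have "2 \<le> infdist x K * (4 / r)" using that r(1) by (simp add: field_simps)
      then show ?thesis by (simp add: \<psi>_def)
    qed
    have S: "compact {x. infdist x K \<le> r / 2}"
      using cK False r by (intro compact_infdist_le) auto
    have tri: "infdist (x + z) K \<le> infdist x K + norm z" for x z :: "real ^ 'n"
      using infdist_triangle[of "x + z" K x] by (simp add: dist_norm)
    have C1: "mollify (r / 4) \<psi> \<in> C1_compact U"
    proof (rule mollify_C1_compact[OF cont _ S \<psi>0])
      fix x z :: "real ^ 'n" assume "x \<in> {x. infdist x K \<le> r / 2}" "norm z \<le> r / 4"
      then show "x + z \<in> U" using tri[of x z] r by (intro near) auto
    qed (use r in auto)
    then have C1': "mollify (r / 4) \<psi> \<in> C1_compact \<Omega>"
      by (auto simp: C1_compact_def U_def)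
    obtain a b where "{x. infdist x K \<le> r / 2} \<subseteq> cbox a b"
      using bounded_subset_cbox_symmetric[OF compact_imp_bounded[OF S]] by metis
    then have \<psi>ab: "\<psi> x = 0" if "x \<notin> cbox a b" for x using that \<psi>0 by blast
    note bnd = mollify_bounds[OF cont _ \<psi>ab, of "r / 4"]
    show ?thesis
    proof (rule that[OF C1'])
      show b01: "0 \<le> mollify (r / 4) \<psi> x \<and> mollify (r / 4) \<psi> x \<le> 1" for x
        by (rule bnd) (use r in \<open>auto simp: \<psi>_def\<close>)
      show "(\<integral>x. \<bar>indicator A x - mollify (r / 4) \<psi> x\<bar> \<partial>lebesgue_on \<Omega>) \<le> e"
      proof (rule ineq[OF C1' b01])
        fix x
        show "mollify (r / 4) \<psi> x = 1" if "x \<in> K"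
        proof -
          have "1 \<le> mollify (r / 4) \<psi> x \<and> mollify (r / 4) \<psi> x \<le> 1"
          proof (rule bnd)
            fix z :: "real ^ 'n" assume "norm z \<le> r / 4"
            then have "infdist (x - z) K \<le> r / 4"
              using tri[of x "- z"] that by simp
            then have "infdist (x - z) K * (4 / r) \<le> 1" using r by (simp add: field_simps)
            then show "1 \<le> \<psi> (x - z) \<and> \<psi> (x - z) \<le> 1" by (simp add: \<psi>_def)
          qed (use r in auto)
          then show ?thesis by auto
        qed
        show "mollify (r / 4) \<psi> x = 0" if "x \<notin> U"
          using C1 that by (auto simp: C1_compact_def)
      qed
    qed
  qed
qed

text \<open>The hypotheses are those of the limit case of \<open>integrable_induct\<close>; the
  factor 2 there makes \<open>3 * norm (f x)\<close> a dominating function for the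
  differences.\<close>

lemma tendsto_L1_dominated:
  fixes f :: "'a \<Rightarrow> real"
  assumes "\<And>i. integrable M (s i)" "integrable M f" "\<And>x. x \<in> space M \<Longrightarrow> (\<lambda>i. s i x) \<longlonglongrightarrow> f x"
    and bound: "\<And>i x. x \<in> space M \<Longrightarrow> norm (s i x) \<le> 2 * norm (f x)"
  shows "(\<lambda>i. \<integral>x. norm (s i x - f x) \<partial>M) \<longlonglongrightarrow> 0"
proof -
  have "(\<lambda>i. \<integral>x. norm (s i x - f x) \<partial>M) \<longlonglongrightarrow> (\<integral>x. norm (0::real) \<partial>M)"
  proof (rule integral_dominated_convergence)
    show "integrable M (\<lambda>x. 3 * norm (f x))" using assms by auto
    show "AE x in M. (\<lambda>i. norm (s i x - f x)) \<longlonglongrightarrow> norm (0::real)"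
      using assms(3) by (intro AE_I2 tendsto_norm) (simp add: LIM_zero_iff)
    show "AE x in M. norm (norm (s i x - f x)) \<le> 3 * norm (f x)" for i
    proof (rule AE_I2)
      fix x assume "x \<in> space M"
      from bound[OF this, of i] show "norm (norm (s i x - f x)) \<le> 3 * norm (f x)" by simp
    qed
  qed (use assms in auto)
  then show ?thesis by simp
qed

text \<open>The property is closed under the three cases of the induction: multiples of indicators
  are approximated by cutoffs, and sums and L1 limits share the error in halves.\<close>

lemma C1_compact_dense_L1:
  fixes \<Omega> :: "(real ^ 'n) set" and f :: "real ^ 'n \<Rightarrow> real"
  assumes "open \<Omega>" "bounded \<Omega>" "integrable (lebesgue_on \<Omega>) f"
  shows "\<forall>e>0. \<exists>\<phi>\<in>C1_compact \<Omega>. (\<integral>x. \<bar>f x - \<phi> x\<bar> \<partial>lebesgue_on \<Omega>) \<le> e"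
  using assms(3)
proof (induction rule: integrable_induct)
  case (base A c)
  show ?case
  proof (intro allI impI)
    fix e :: real assume e: "0 < e"
    have A: "A \<in> sets lebesgue" "A \<subseteq> \<Omega>"
      using base assms by (auto simp: sets_restrict_space_iff lmeasurable_open fmeasurableD)
    obtain \<phi> where \<phi>: "\<phi> \<in> C1_compact \<Omega>" "(\<integral>x. \<bar>indicator A x - \<phi> x\<bar> \<partial>lebesgue_on \<Omega>) \<le> e / (\<bar>c\<bar> + 1)"
      using C1_compact_approx_indicator[OF assms(1,2) A, of "e / (\<bar>c\<bar> + 1)"] e by auto
    have "(\<integral>x. \<bar>indicator A x *\<^sub>R c - c * \<phi> x\<bar> \<partial>lebesgue_on \<Omega>)
        = (\<integral>x. \<bar>c\<bar> * \<bar>indicator A x - \<phi> x\<bar> \<partial>lebesgue_on \<Omega>)"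
      by (simp flip: abs_mult add: algebra_simps)
    also have "\<dots> \<le> \<bar>c\<bar> * (e / (\<bar>c\<bar> + 1))"
      using mult_left_mono[OF \<phi>(2), of "\<bar>c\<bar>"] by simp
    also have "\<dots> \<le> e" using e by (simp add: field_simps)
    finally show "\<exists>\<phi>\<in>C1_compact \<Omega>. (\<integral>x. \<bar>indicator A x *\<^sub>R c - \<phi> x\<bar> \<partial>lebesgue_on \<Omega>) \<le> e"
      by (intro bexI[OF _ C1_compact_scale[OF \<phi>(1)]])
  qed
next
  case (add f g)
  show ?case
  proof (intro allI impI)
    fix e :: real assume e: "0 < e"
    obtain \<phi> \<psi> where *: "\<phi> \<in> C1_compact \<Omega>" "\<psi> \<in> C1_compact \<Omega>"
      "(\<integral>x. \<bar>f x - \<phi> x\<bar> \<partial>lebesgue_on \<Omega>) \<le> e / 2" "(\<integral>x. \<bar>g x - \<psi> x\<bar> \<partial>lebesgue_on \<Omega>) \<le> e / 2"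
      using add e by (meson half_gt_zero)
    have int: "integrable (lebesgue_on \<Omega>) (\<lambda>x. \<bar>f x - \<phi> x\<bar>)" "integrable (lebesgue_on \<Omega>) (\<lambda>x. \<bar>g x - \<psi> x\<bar>)"
      by (intro Bochner_Integration.integrable_abs Bochner_Integration.integrable_diff add
        C1_compact_integrable(1)[OF *(1)] C1_compact_integrable(1)[OF *(2)] lmeasurable_open assms)+
    have "(\<integral>x. \<bar>f x + g x - (\<phi> x + \<psi> x)\<bar> \<partial>lebesgue_on \<Omega>)
        \<le> (\<integral>x. \<bar>f x - \<phi> x\<bar> + \<bar>g x - \<psi> x\<bar> \<partial>lebesgue_on \<Omega>)"
    proof (rule integral_mono)
      show "integrable (lebesgue_on \<Omega>) (\<lambda>x. \<bar>f x + g x - (\<phi> x + \<psi> x)\<bar>)"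
        by (intro Bochner_Integration.integrable_abs Bochner_Integration.integrable_diff
          Bochner_Integration.integrable_add add C1_compact_integrable(1)[OF *(1)]
          C1_compact_integrable(1)[OF *(2)] lmeasurable_open assms)
    qed (use int in auto)
    also have "\<dots> \<le> e" using * int by simp
    finally show "\<exists>\<phi>\<in>C1_compact \<Omega>. (\<integral>x. \<bar>f x + g x - \<phi> x\<bar> \<partial>lebesgue_on \<Omega>) \<le> e"
      by (intro bexI[OF _ C1_compact_add[OF *(1,2)]])
  qed
next
  case (lim f s)
  show ?case
  proof (intro allI impI)
    fix e :: real assume e: "0 < e"
    have "(\<lambda>i. \<integral>x. norm (s i x - f x) \<partial>lebesgue_on \<Omega>) \<longlonglongrightarrow> 0"
      using lim by (intro tendsto_L1_dominated) auto
    then have "\<forall>\<^sub>F i in sequentially. (\<integral>x. norm (s i x - f x) \<partial>lebesgue_on \<Omega>) < e / 2"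
      using e by (intro order_tendstoD(2)) auto
    then obtain i where i: "(\<integral>x. norm (s i x - f x) \<partial>lebesgue_on \<Omega>) < e / 2"
      by (auto simp: eventually_sequentially)
    obtain \<phi> where \<phi>: "\<phi> \<in> C1_compact \<Omega>" "(\<integral>x. \<bar>s i x - \<phi> x\<bar> \<partial>lebesgue_on \<Omega>) \<le> e / 2"
      using lim(5) e by (meson half_gt_zero)
    have int: "integrable (lebesgue_on \<Omega>) \<phi>"
      using C1_compact_integrable(1) \<phi> assms lmeasurable_open by auto
    have "(\<integral>x. \<bar>f x - \<phi> x\<bar> \<partial>lebesgue_on \<Omega>)
        \<le> (\<integral>x. norm (s i x - f x) + \<bar>s i x - \<phi> x\<bar> \<partial>lebesgue_on \<Omega>)"
      by (rule integral_mono) (use int lim in auto)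
    also have "\<dots> \<le> e" using i \<phi> int lim by simp
    finally show "\<exists>\<phi>\<in>C1_compact \<Omega>. (\<integral>x. \<bar>f x - \<phi> x\<bar> \<partial>lebesgue_on \<Omega>) \<le> e"
      using \<phi>(1) by blast
  qed
qed

text \<open>The fundamental lemma of the calculus of variations. Since \<open>h\<close> may be
  unbounded, L1 approximation of an indicator is not enough; cutoffs bounded by 1 that converge
  almost everywhere along a subsequence allow dominated convergence, and orthogonality to all
  indicators forces \<open>h\<close> to vanish.\<close>

lemma AE_zero_if_orthogonal_C1_compact:
  fixes \<Omega> :: "(real ^ 'n) set" and h :: "real ^ 'n \<Rightarrow> real"
  assumes "open \<Omega>" "bounded \<Omega>" "integrable (lebesgue_on \<Omega>) h"
    and orth: "\<And>\<phi>. \<phi> \<in> C1_compact \<Omega> \<Longrightarrow> (\<integral>x. h x * \<phi> x \<partial>lebesgue_on \<Omega>) = 0"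
  shows "AE x in lebesgue_on \<Omega>. h x = 0"
proof -
  have \<Omega>: "\<Omega> \<in> lmeasurable" using assms by (simp add: lmeasurable_open)
  interpret finite_measure "lebesgue_on \<Omega>" using \<Omega> by (rule finite_measure_lebesgue_on)
  have [measurable]: "h \<in> borel_measurable (lebesgue_on \<Omega>)" using assms(3) by auto
  have "set_lebesgue_integral (lebesgue_on \<Omega>) A h = 0" if A[measurable]: "A \<in> sets (lebesgue_on \<Omega>)" for A
  proof -
    have A': "A \<in> sets lebesgue" "A \<subseteq> \<Omega>"
      using A \<Omega> by (auto simp: sets_restrict_space_iff fmeasurableD)
    have "\<exists>\<phi>. \<phi> \<in> C1_compact \<Omega> \<and> (\<forall>x. 0 \<le> \<phi> x \<and> \<phi> x \<le> 1) \<and>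
      (\<integral>x. \<bar>indicator A x - \<phi> x\<bar> \<partial>lebesgue_on \<Omega>) \<le> inverse (real (Suc n))" for n
      using C1_compact_approx_indicator[OF assms(1,2) A', of "inverse (real (Suc n))"]
      by (metis inverse_positive_iff_positive of_nat_0_less_iff zero_less_Suc)
    then obtain \<phi> where \<phi>: "\<And>n. \<phi> n \<in> C1_compact \<Omega>" "\<And>n x. 0 \<le> \<phi> n x \<and> \<phi> n x \<le> 1"
      "\<And>n. (\<integral>x. \<bar>indicator A x - \<phi> n x\<bar> \<partial>lebesgue_on \<Omega>) \<le> inverse (real (Suc n))" by metis
    have int[measurable]: "integrable (lebesgue_on \<Omega>) (\<phi> n)" for n
      using C1_compact_integrable(1)[OF \<phi>(1) \<Omega>] .
    have "(\<lambda>n. \<integral>x. norm (indicator A x - \<phi> n x) \<partial>lebesgue_on \<Omega>) \<longlonglongrightarrow> 0"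
      by (rule tendsto_sandwich[OF _ _ tendsto_const LIMSEQ_inverse_real_of_nat]) (use \<phi>(3) in auto)
    moreover have "integrable (lebesgue_on \<Omega>) (\<lambda>x. indicator A x - \<phi> n x)" for n
      by (intro Bochner_Integration.integrable_diff int integrable_const_bound[of _ 1]) auto
    ultimately obtain r :: "nat \<Rightarrow> nat" where
      r: "strict_mono r" "AE x in lebesgue_on \<Omega>. (\<lambda>n. indicator A x - \<phi> (r n) x) \<longlonglongrightarrow> 0"
      using tendsto_L1_AE_subseq[of "lebesgue_on \<Omega>" "\<lambda>n x. indicator A x - \<phi> n x"]
      by (elim meta_impE exE conjE) auto
    have "(\<lambda>n. \<integral>x. h x * \<phi> (r n) x \<partial>lebesgue_on \<Omega>) \<longlonglongrightarrow> (\<integral>x. h x * indicator A x \<partial>lebesgue_on \<Omega>)"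
    proof (rule integral_dominated_convergence)
      show "integrable (lebesgue_on \<Omega>) (\<lambda>x. \<bar>h x\<bar>)" using assms(3) by auto
      show "AE x in lebesgue_on \<Omega>. (\<lambda>n. h x * \<phi> (r n) x) \<longlonglongrightarrow> h x * indicator A x"
        using r(2)
      proof eventually_elim
        case (elim x)
        from tendsto_diff[OF tendsto_const[of "indicator A x"] this]
        have "(\<lambda>n. \<phi> (r n) x) \<longlonglongrightarrow> indicator A x" by simp
        then show ?case by (rule tendsto_mult_left)
      qed
      show "AE x in lebesgue_on \<Omega>. norm (h x * \<phi> (r n) x) \<le> \<bar>h x\<bar>" for n
        using \<phi>(2) by (intro AE_I2) (auto simp: abs_mult intro: mult_left_le)
    qed (use int in auto)
    then have "(\<integral>x. h x * indicator A x \<partial>lebesgue_on \<Omega>) = 0"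
      using orth[OF \<phi>(1)] by (simp add: LIMSEQ_const_iff)
    then show ?thesis by (simp add: set_lebesgue_integral_def mult.commute)
  qed
  then show ?thesis by (intro density_zero assms)
qed


section \<open>Duality of L1 and weak limits of bounded sequences\<close>

text \<open>Shifting the functional by \<open>C\<close> times the measure makes it positive on indicators, so that
  the representing function is a Radon--Nikodym density minus \<open>C\<close>.\<close>

lemma Riesz_L1_dual:
  fixes L :: "('a \<Rightarrow> real) \<Rightarrow> real"
  assumes "finite_measure M" "0 \<le> C"
    and add: "\<And>f g. integrable M f \<Longrightarrow> integrable M g \<Longrightarrow> L (\<lambda>x. f x + g x) = L f + L g"
    and scale: "\<And>f c. integrable M f \<Longrightarrow> L (\<lambda>x. c * f x) = c * L f"
    and bound: "\<And>f. integrable M f \<Longrightarrow> \<bar>L f\<bar> \<le> C * (\<integral>x. \<bar>f x\<bar> \<partial>M)"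
  obtains g where "g \<in> borel_measurable M" "\<And>x. \<bar>g x\<bar> \<le> C"
    "\<And>f. integrable M f \<Longrightarrow> L f = (\<integral>x. f x * g x \<partial>M)"
proof -
  interpret finite_measure M by fact
  have int_ind[simp]: "A \<in> sets M \<Longrightarrow> integrable M (indicator A :: 'a \<Rightarrow> real)" for A
    by (simp add: integrable_indicator_iff emeasure_eq_measure)
  have diff: "L (\<lambda>x. f x - g x) = L f - L g" if "integrable M f" "integrable M g" for f g
    using add[OF that(1), of "\<lambda>x. - 1 * g x"] scale[OF that(2), of "-1"] that by simp
  have L0: "L (\<lambda>x. 0) = 0" using bound[of "\<lambda>x. 0"] by simp
  have Lsum: "L (\<lambda>x. \<Sum>i\<in>I. f i x) = (\<Sum>i\<in>I. L (f i))" if "finite I" "\<And>i. i \<in> I \<Longrightarrow> integrable M (f i)" for I :: "nat set" and f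
    using that by (induction I rule: finite_induct) (simp_all add: L0 add)
  define \<nu> where "\<nu> A = L (indicator A) + C * measure M A" for A
  have Lind: "\<bar>L (indicator A)\<bar> \<le> C * measure M A" if "A \<in> sets M" for A
    using bound[OF int_ind[OF that]] that by simp
  have \<nu>_nonneg: "0 \<le> \<nu> A" and \<nu>_le: "\<nu> A \<le> 2 * C * measure M A" if "A \<in> sets M" for A
    using Lind[OF that] by (auto simp: \<nu>_def)
  have \<nu>_sums: "(\<lambda>i. \<nu> (A i)) sums \<nu> (\<Union>i. A i)"
    if A: "range A \<subseteq> sets M" "disjoint_family A" for A :: "nat \<Rightarrow> 'a set"
  proof -
    let ?U = "\<Union>i. A i"
    have As: "A i \<in> sets M" for i using A by auto
    have U: "?U \<in> sets M" using As by auto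
    have ms: "(\<lambda>i. measure M (A i)) sums measure M ?U"
      using A by (intro measure_UNION) (auto simp: emeasure_eq_measure)
    \<comment> \<open>The remainder of the series is \<open>L\<close> of the indicator of what is
      left of the union, and \<open>bound\<close> compares it with a measure that tends to
      0.\<close>
    have "(\<lambda>n. L (indicator ?U) - (\<Sum>i<n. L (indicator (A i)))) \<longlonglongrightarrow> 0"
    proof (rule Lim_null_comparison)
      show "(\<lambda>n. C * (measure M ?U - (\<Sum>i<n. measure M (A i)))) \<longlonglongrightarrow> 0"
        using ms by (auto intro!: tendsto_eq_intros simp: sums_def)
      have "\<bar>L (indicator ?U) - (\<Sum>i<n. L (indicator (A i)))\<bar> \<le> C * (measure M ?U - (\<Sum>i<n. measure M (A i)))" for n
      proof -
        let ?f = "\<lambda>x. indicator ?U x - (\<Sum>i<n. indicator (A i) x) :: real"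
        have int: "integrable M (\<lambda>x. \<Sum>i<n. indicator (A i) x :: real)" using As by auto
        have "(\<Sum>i<n. indicator (A i) x :: real) = indicator (\<Union>i<n. A i) x" for x
          using A(2) by (subst indicator_UN_disjoint) (auto intro: disjoint_family_on_mono)
        then have nn: "0 \<le> ?f x" for x by (auto simp: indicator_def)
        have "L (indicator ?U) - (\<Sum>i<n. L (indicator (A i))) = L ?f"
          using diff[OF int_ind[OF U] int] Lsum[of "{..<n}" "\<lambda>i. indicator (A i)"] As by simp
        also have "\<bar>\<dots>\<bar> \<le> C * (\<integral>x. \<bar>?f x\<bar> \<partial>M)"
          using int_ind[OF U] int by (intro bound) auto
        also have "(\<integral>x. \<bar>?f x\<bar> \<partial>M) = (\<integral>x. ?f x \<partial>M)"
          using nn by (intro Bochner_Integration.integral_cong) auto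
        also have "\<dots> = measure M ?U - (\<Sum>i<n. measure M (A i))"
          using int_ind[OF U] int As U by simp
        finally show ?thesis .
      qed
      then show "\<forall>\<^sub>F n in sequentially. norm (L (indicator ?U) - (\<Sum>i<n. L (indicator (A i))))
          \<le> C * (measure M ?U - (\<Sum>i<n. measure M (A i)))" by simp
    qed
    then have "(\<lambda>i. L (indicator (A i))) sums L (indicator ?U)"
      unfolding sums_def using tendsto_diff[OF tendsto_const[of "L (indicator ?U)"]] by fastforce
    then show ?thesis
      unfolding \<nu>_def using ms by (intro sums_add sums_mult)
  qed
  define N where "N = measure_of (space M) (sets M) (\<lambda>A. ennreal (\<nu> A))"
  have sets_N [measurable_cong]: "sets N = sets M" by (simp add: N_def)
  have em_N: "emeasure N A = ennreal (\<nu> A)" if "A \<in> sets M" for A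
    unfolding N_def
  proof (rule emeasure_measure_of_sigma)
    show "sigma_algebra (space M) (sets M)" ..
    show "positive (sets M) (\<lambda>A. ennreal (\<nu> A))"
      using \<nu>_le[of "{}"] by (simp add: positive_def ennreal_neg)
    show "countably_additive (sets M) (\<lambda>A. ennreal (\<nu> A))"
      unfolding countably_additive_def
    proof (intro allI impI)
      fix A :: "nat \<Rightarrow> 'a set" assume A: "range A \<subseteq> sets M" "disjoint_family A"
      show "(\<Sum>i. ennreal (\<nu> (A i))) = ennreal (\<nu> (\<Union> (range A)))"
        using A \<nu>_nonneg by (intro suminf_ennreal_eq \<nu>_sums) auto
    qed
  qed fact
  have "absolutely_continuous M N"
    unfolding absolutely_continuous_def
  proof
    fix A assume "A \<in> null_sets M"
    then have "A \<in> sets M" "measure M A = 0" by (auto simp: null_sets_def measure_def)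
    then show "A \<in> null_sets N"
      using em_N[of A] \<nu>_le[of A] by (auto simp: null_sets_def sets_N ennreal_neg)
  qed
  from Radon_Nikodym[OF this sets_N] obtain f where
    f[measurable]: "f \<in> borel_measurable M" and fN: "density M f = N" by blast
  have nn_f: "(\<integral>\<^sup>+x. f x * indicator A x \<partial>M) = ennreal (\<nu> A)" if "A \<in> sets M" for A
    using em_N[OF that] emeasure_density[OF f that] fN by simp
  have finf: "AE x in M. f x \<noteq> \<infinity>"
    using nn_f[of "space M"] by (intro nn_integral_PInf_AE) (auto cong: nn_integral_cong_simp)
  define g where "g x = enn2real (f x) - C" for x
  have fint: "integrable M (\<lambda>x. enn2real (f x))"
  proof (rule integrableI_nonneg)
    have "(\<integral>\<^sup>+x. ennreal (enn2real (f x)) \<partial>M) \<le> (\<integral>\<^sup>+x. f x * indicator (space M) x \<partial>M)"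
      by (intro nn_integral_mono) (auto simp: ennreal_enn2real_if)
    then show "(\<integral>\<^sup>+x. ennreal (enn2real (f x)) \<partial>M) < \<infinity>"
      using nn_f[of "space M"] by (auto simp: top.not_eq_extremum[symmetric] top_unique)
  qed auto
  then have gint: "integrable M g" unfolding g_def by auto
  have gA: "(\<integral>x. indicator A x * g x \<partial>M) = L (indicator A)" if A[measurable]: "A \<in> sets M" for A
  proof -
    have "(\<integral>\<^sup>+x. ennreal (enn2real (f x) * indicator A x) \<partial>M) = (\<integral>\<^sup>+x. f x * indicator A x \<partial>M)"
    proof (rule nn_integral_cong_AE)
      show "AE x in M. ennreal (enn2real (f x) * indicator A x) = f x * indicator A x"
        using finf by eventually_elim (auto simp: indicator_def less_top)
    qed
    then have "has_bochner_integral M (\<lambda>x. enn2real (f x) * indicator A x) (\<nu> A)"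
      using nn_f[OF A] \<nu>_nonneg[OF A] by (intro has_bochner_integral_nn_integral) auto
    moreover have "has_bochner_integral M (\<lambda>x. C * indicator A x) (C * measure M A)"
      by (auto simp: has_bochner_integral_iff)
    ultimately have "has_bochner_integral M (\<lambda>x. enn2real (f x) * indicator A x - C * indicator A x) (\<nu> A - C * measure M A)"
      by (rule has_bochner_integral_diff)
    then show ?thesis by (simp add: has_bochner_integral_iff g_def \<nu>_def algebra_simps)
  qed
  have gC: "AE x in M. g x \<in> {-C..C}"
  proof (rule averaging_theorem[OF gint])
    fix A assume A: "A \<in> sets M" "0 < measure M A"
    have "set_lebesgue_integral M A g = L (indicator A)"
      using gA[OF A(1)] by (simp add: set_lebesgue_integral_def)
    then show "(1 / measure M A) *\<^sub>R set_lebesgue_integral M A g \<in> {-C..C}"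
      using Lind[OF A(1)] A(2) by (auto simp: field_simps abs_le_iff)
  qed auto
  \<comment> \<open>The averages confine \<open>g\<close> to \<open>{-C..C}\<close> only almost
    everywhere; truncation makes the bound hold everywhere and leaves all integrals
    unchanged.\<close>
  define g' where "g' x = max (- C) (min C (g x))" for x
  have g'm[measurable]: "g' \<in> borel_measurable M" using gint unfolding g'_def by auto
  have g'C: "\<bar>g' x\<bar> \<le> C" for x using \<open>0 \<le> C\<close> by (auto simp: g'_def)
  have g'int: "integrable M (\<lambda>x. f x * g' x)" if "integrable M f" for f
    using that g'C \<open>0 \<le> C\<close>
    by (intro Bochner_Integration.integrable_bound[OF integrable_mult_left[OF that, of C]])
      (auto simp: abs_mult intro!: mult_left_mono)
  show ?thesis
  proof (rule that[OF g'm g'C])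
    fix f :: "'a \<Rightarrow> real" assume "integrable M f"
    then show "L f = (\<integral>x. f x * g' x \<partial>M)"
    proof (induction rule: integrable_induct)
      case (base A c)
      then have A[measurable]: "A \<in> sets M" by simp
      have "L (indicator A) = (\<integral>x. indicator A x * g' x \<partial>M)"
        unfolding gA[OF A, symmetric] using gint
        by (intro integral_cong_AE) (use gC in \<open>auto simp: g'_def\<close>)
      then show ?case using scale[OF int_ind[OF A], of c] by (simp add: mult.commute mult.left_commute)
    next
      case (add f h)
      then have "L (\<lambda>x. f x + h x) = (\<integral>x. f x * g' x \<partial>M) + (\<integral>x. h x * g' x \<partial>M)"
        using assms(3)[of f h] by simp
      also have "\<dots> = (\<integral>x. f x * g' x + h x * g' x \<partial>M)"
        using g'int add by (intro Bochner_Integration.integral_add[symmetric])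
      finally show ?case by (simp only: distrib_right)
    next
      case (lim f s)
      have "(\<lambda>i. \<integral>x. norm (s i x - f x) \<partial>M) \<longlonglongrightarrow> 0"
        using lim by (intro tendsto_L1_dominated) auto
      then have 1: "(\<lambda>i. C * (\<integral>x. \<bar>s i x - f x\<bar> \<partial>M)) \<longlonglongrightarrow> 0"
        by (auto intro!: tendsto_eq_intros)
      have "(\<lambda>i. L (s i) - L f) \<longlonglongrightarrow> 0"
      proof (rule Lim_null_comparison[OF _ 1])
        have "\<bar>L (s i) - L f\<bar> \<le> C * (\<integral>x. \<bar>s i x - f x\<bar> \<partial>M)" for i
          using bound[of "\<lambda>x. s i x - f x"] diff[of "s i" f] lim by auto
        then show "\<forall>\<^sub>F i in sequentially. norm (L (s i) - L f) \<le> C * (\<integral>x. \<bar>s i x - f x\<bar> \<partial>M)" by simp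
      qed
      moreover have "(\<lambda>i. (\<integral>x. s i x * g' x \<partial>M) - (\<integral>x. f x * g' x \<partial>M)) \<longlonglongrightarrow> 0"
      proof (rule Lim_null_comparison[OF _ 1])
        have "\<bar>(\<integral>x. s i x * g' x \<partial>M) - (\<integral>x. f x * g' x \<partial>M)\<bar> \<le> C * (\<integral>x. \<bar>s i x - f x\<bar> \<partial>M)" for i
        proof -
          have "(\<integral>x. s i x * g' x \<partial>M) - (\<integral>x. f x * g' x \<partial>M) = (\<integral>x. (s i x - f x) * g' x \<partial>M)"
            unfolding left_diff_distrib
            by (intro Bochner_Integration.integral_diff[symmetric] g'int lim)
          also have "\<bar>\<dots>\<bar> \<le> (\<integral>x. \<bar>(s i x - f x) * g' x\<bar> \<partial>M)"
            by (rule integral_abs_bound)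
          also have "\<dots> \<le> (\<integral>x. C * \<bar>s i x - f x\<bar> \<partial>M)"
          proof (rule integral_mono)
            show "integrable M (\<lambda>x. \<bar>(s i x - f x) * g' x\<bar>)"
              using g'int[of "\<lambda>x. s i x - f x"] lim by auto
            show "\<bar>(s i x - f x) * g' x\<bar> \<le> C * \<bar>s i x - f x\<bar>" for x
                  using mult_left_mono[OF g'C[of x], of "\<bar>s i x - f x\<bar>"] by (simp add: abs_mult mult.commute[of C])
          qed (use lim in auto)
          finally show ?thesis by simp
        qed
        then show "\<forall>\<^sub>F i in sequentially. norm ((\<integral>x. s i x * g' x \<partial>M) - (\<integral>x. f x * g' x \<partial>M)) \<le> C * (\<integral>x. \<bar>s i x - f x\<bar> \<partial>M)"
          by simp
      qed
      ultimately have "(\<lambda>i. (L (s i) - L f) - ((\<integral>x. s i x * g' x \<partial>M) - (\<integral>x. f x * g' x \<partial>M))) \<longlonglongrightarrow> 0 - 0"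
        by (rule tendsto_diff)
      \<comment> \<open>By the induction hypothesis \<open>L (s i)\<close> is the integral of
        \<open>s i\<close> against \<open>g'\<close>, so these terms cancel and a constant sequence
        tends to 0.\<close>
      then have "(\<lambda>i. (\<integral>x. f x * g' x \<partial>M) - L f) \<longlonglongrightarrow> 0"
        using lim(5) by simp
      then show ?case by (simp add: LIMSEQ_const_iff)
    qed
  qed
qed

text \<open>Convergence against the dense class of test functions together with the uniform bound
  \<open>C\<close> makes the pairings with any L1 function Cauchy. The limit functional again has
  norm at most \<open>C\<close>, hence a density. No subsequence is extracted, because convergence
  on test functions is an input.\<close>

lemma bounded_weak_limit:
  fixes \<Omega> :: "(real ^ 'n) set" and G :: "nat \<Rightarrow> real ^ 'n \<Rightarrow> real"
  assumes "open \<Omega>" "bounded \<Omega>" "0 \<le> C"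
    and G[measurable]: "\<And>j. G j \<in> borel_measurable (lebesgue_on \<Omega>)"
    and GC: "\<And>j. AE x in lebesgue_on \<Omega>. \<bar>G j x\<bar> \<le> C"
    and conv: "\<And>\<phi>. \<phi> \<in> C1_compact \<Omega> \<Longrightarrow> convergent (\<lambda>j. \<integral>x. \<phi> x * G j x \<partial>lebesgue_on \<Omega>)"
  obtains g where "g \<in> borel_measurable (lebesgue_on \<Omega>)" "\<And>x. \<bar>g x\<bar> \<le> C"
    "\<And>\<psi>. integrable (lebesgue_on \<Omega>) \<psi> \<Longrightarrow>
      (\<lambda>j. \<integral>x. \<psi> x * G j x \<partial>lebesgue_on \<Omega>) \<longlonglongrightarrow> (\<integral>x. \<psi> x * g x \<partial>lebesgue_on \<Omega>)"
proof -
  let ?M = "lebesgue_on \<Omega>"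
  have \<Omega>: "\<Omega> \<in> lmeasurable" using assms by (simp add: lmeasurable_open)
  interpret finite_measure ?M using \<Omega> by (rule finite_measure_lebesgue_on)
  have int: "integrable ?M (\<lambda>x. \<psi> x * G j x)" if "integrable ?M \<psi>" for \<psi> j
  proof (rule Bochner_Integration.integrable_bound[OF integrable_mult_left[OF that, of C]])
    show "AE x in ?M. norm (\<psi> x * G j x) \<le> norm (\<psi> x * C)"
      using GC[of j] by eventually_elim (use \<open>0 \<le> C\<close> in \<open>auto simp: abs_mult intro!: mult_left_mono\<close>)
  qed (use that in auto)
  have bnd: "\<bar>\<integral>x. \<psi> x * G j x \<partial>?M\<bar> \<le> C * (\<integral>x. \<bar>\<psi> x\<bar> \<partial>?M)" if "integrable ?M \<psi>" for \<psi> j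
  proof -
    have "\<bar>\<integral>x. \<psi> x * G j x \<partial>?M\<bar> \<le> (\<integral>x. \<bar>\<psi> x * G j x\<bar> \<partial>?M)" by (rule integral_abs_bound)
    also have "\<dots> \<le> (\<integral>x. C * \<bar>\<psi> x\<bar> \<partial>?M)"
    proof (rule integral_mono_AE)
      show "AE x in ?M. \<bar>\<psi> x * G j x\<bar> \<le> C * \<bar>\<psi> x\<bar>"
        using GC[of j] by eventually_elim (auto simp: abs_mult mult.commute[of C] intro!: mult_left_mono)
    qed (use that int in auto)
    finally show ?thesis by simp
  qed
  have conv': "convergent (\<lambda>j. \<integral>x. \<psi> x * G j x \<partial>?M)" if \<psi>: "integrable ?M \<psi>" for \<psi>
  proof -
    have "Cauchy (\<lambda>j. \<integral>x. \<psi> x * G j x \<partial>?M)"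
    proof (rule metric_CauchyI)
      fix e :: real assume e: "0 < e"
      obtain \<phi> where \<phi>: "\<phi> \<in> C1_compact \<Omega>" "(\<integral>x. \<bar>\<psi> x - \<phi> x\<bar> \<partial>?M) \<le> e / (4 * (C + 1))"
        using C1_compact_dense_L1[OF assms(1,2) \<psi>] e \<open>0 \<le> C\<close>
        by (metis add_nonneg_pos divide_pos_pos mult_pos_pos zero_less_numeral zero_less_one)
      have \<phi>i: "integrable ?M \<phi>" using C1_compact_integrable(1)[OF \<phi>(1) \<Omega>] .
      have near: "\<bar>(\<integral>x. \<psi> x * G j x \<partial>?M) - (\<integral>x. \<phi> x * G j x \<partial>?M)\<bar> \<le> e / 4" for j
      proof -
        have "(\<integral>x. \<psi> x * G j x \<partial>?M) - (\<integral>x. \<phi> x * G j x \<partial>?M) = (\<integral>x. (\<psi> x - \<phi> x) * G j x \<partial>?M)"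
          using int \<psi> \<phi>i by (simp add: algebra_simps)
        also have "\<bar>\<dots>\<bar> \<le> C * (\<integral>x. \<bar>\<psi> x - \<phi> x\<bar> \<partial>?M)"
          using \<psi> \<phi>i by (intro bnd) auto
        also have "\<dots> \<le> C * (e / (4 * (C + 1)))" using \<phi>(2) \<open>0 \<le> C\<close> by (rule mult_left_mono)
        also have "\<dots> \<le> e / 4" using e \<open>0 \<le> C\<close> by (simp add: field_simps)
        finally show ?thesis .
      qed
      have "Cauchy (\<lambda>j. \<integral>x. \<phi> x * G j x \<partial>?M)" using conv[OF \<phi>(1)] by (rule convergent_Cauchy)
      then obtain n0 where n0: "\<And>m n. n0 \<le> m \<Longrightarrow> n0 \<le> n \<Longrightarrow>
          dist (\<integral>x. \<phi> x * G m x \<partial>?M) (\<integral>x. \<phi> x * G n x \<partial>?M) < e / 4"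
        using e by (meson metric_CauchyD zero_less_divide_iff zero_less_numeral)
      show "\<exists>n0. \<forall>m\<ge>n0. \<forall>n\<ge>n0. dist (\<integral>x. \<psi> x * G m x \<partial>?M) (\<integral>x. \<psi> x * G n x \<partial>?M) < e"
      proof (intro exI allI impI)
        fix m n assume "n0 \<le> m" "n0 \<le> n"
        from n0[OF this] near[of m] near[of n] e
        show "dist (\<integral>x. \<psi> x * G m x \<partial>?M) (\<integral>x. \<psi> x * G n x \<partial>?M) < e"
          unfolding dist_real_def by linarith
      qed
    qed
    then show ?thesis by (rule real_Cauchy_convergent)
  qed
  define L where "L \<psi> = lim (\<lambda>j. \<integral>x. \<psi> x * G j x \<partial>?M)" for \<psi>
  have L: "(\<lambda>j. \<integral>x. \<psi> x * G j x \<partial>?M) \<longlonglongrightarrow> L \<psi>" if "integrable ?M \<psi>" for \<psi>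
    using conv'[OF that] unfolding L_def by (simp add: convergent_LIMSEQ_iff)
  obtain g where g: "g \<in> borel_measurable ?M" "\<And>x. \<bar>g x\<bar> \<le> C"
    "\<And>f. integrable ?M f \<Longrightarrow> L f = (\<integral>x. f x * g x \<partial>?M)"
  proof (rule Riesz_L1_dual[of ?M C L])
    fix f h :: "real ^ 'n \<Rightarrow> real" assume fh: "integrable ?M f" "integrable ?M h"
    have "(\<lambda>j. \<integral>x. (f x + h x) * G j x \<partial>?M) \<longlonglongrightarrow> L f + L h"
      using tendsto_add[OF L[OF fh(1)] L[OF fh(2)]] int fh by (simp add: distrib_right)
    then show "L (\<lambda>x. f x + h x) = L f + L h" using L[of "\<lambda>x. f x + h x"] fh by (auto intro: LIMSEQ_unique)
  next
    fix f :: "real ^ 'n \<Rightarrow> real" and c :: real assume f: "integrable ?M f"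
    have "(\<lambda>j. \<integral>x. (c * f x) * G j x \<partial>?M) \<longlonglongrightarrow> c * L f"
      using tendsto_mult_left[OF L[OF f], of c] by (simp add: mult.assoc)
    then show "L (\<lambda>x. c * f x) = c * L f" using L[of "\<lambda>x. c * f x"] f by (auto intro: LIMSEQ_unique)
  next
    fix f :: "real ^ 'n \<Rightarrow> real" assume f: "integrable ?M f"
    show "\<bar>L f\<bar> \<le> C * (\<integral>x. \<bar>f x\<bar> \<partial>?M)"
      by (rule LIMSEQ_le_const2[OF tendsto_rabs[OF L[OF f]]]) (use bnd[OF f] in auto)
  qed (use assms in \<open>auto intro: finite_measure_axioms\<close>)
  show ?thesis
  proof (rule that[OF g(1,2)])
    fix \<psi> :: "real ^ 'n \<Rightarrow> real" assume "integrable ?M \<psi>"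
    then show "(\<lambda>j. \<integral>x. \<psi> x * G j x \<partial>?M) \<longlonglongrightarrow> (\<integral>x. \<psi> x * g x \<partial>?M)"
      using L[of \<psi>] g(3)[of \<psi>] by simp
  qed
qed

section \<open>Simplicial meshes\<close>

lemma linear_real_inner:
  assumes "linear (f :: 'a::euclidean_space \<Rightarrow> real)"
  obtains a where "\<And>x. f x = a \<bullet> x"
  using that[of "adjoint f 1"] adjoint_works[OF assms, of _ 1] by (simp add: inner_commute)

text \<open>Moving one vertex to the origin turns affine into linear independence, and values on
  independent vectors extend to a linear form.\<close>

lemma affine_interpolation:
  fixes V :: "'a::euclidean_space set" and f :: "'a \<Rightarrow> real"
  assumes "\<not> affine_dependent V"
  obtains a b where "\<And>x. x \<in> V \<Longrightarrow> a \<bullet> x + b = f x"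
proof (cases "V = {}")
  case False
  then obtain v where v: "v \<in> V" by auto
  have "independent ((\<lambda>x. - v + x) ` (V - {v}))"
    using assms affine_dependent_iff_dependent2[OF v] by simp
  from linear_independent_extend[OF this, of "\<lambda>y. f (v + y) - f v"]
  obtain g where g: "linear g" "\<And>x. x \<in> V - {v} \<Longrightarrow> g (- v + x) = f x - f v" by auto
  obtain a where a: "\<And>x. g x = a \<bullet> x" using linear_real_inner[OF g(1)] by blast
  have "a \<bullet> x + (f v - a \<bullet> v) = f x" if "x \<in> V" for x
    using g(2)[of x] that by (cases "x = v") (auto simp: a inner_diff_right inner_add_right)
  then show ?thesis by (rule that)
qed (use that in auto)

lemma affine_eq_on_convex_hull:
  fixes a a' :: "'a::euclidean_space"
  assumes "\<And>x. x \<in> V \<Longrightarrow> a \<bullet> x + b = a' \<bullet> x + b'" "x \<in> convex hull V"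
  shows "a \<bullet> x + b = a' \<bullet> x + b'"
proof -
  have "convex hull V \<subseteq> {x. (a - a') \<bullet> x = b' - b}"
    by (rule hull_minimal, use assms(1) in \<open>(auto simp: inner_diff_left algebra_simps)[1]\<close>, rule convex_hyperplane)
  then show ?thesis using assms(2) by (auto simp: inner_diff_left algebra_simps)
qed

text \<open>The bound is affine in each of the two points, so a half-space argument passes to the
  hull first in \<open>y\<close> and then in \<open>z\<close>.\<close>

lemma inner_le_on_convex_hull:
  fixes c :: "'a::euclidean_space"
  assumes "\<And>p q. p \<in> V \<Longrightarrow> q \<in> V \<Longrightarrow> c \<bullet> (p - q) \<le> m"
    and "y \<in> convex hull V" "z \<in> convex hull V"
  shows "c \<bullet> (y - z) \<le> m"
proof -
  have 1: "c \<bullet> (y - q) \<le> m" if "q \<in> V" for q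
  proof -
    have "convex hull V \<subseteq> {y. c \<bullet> y \<le> m + c \<bullet> q}"
      by (rule hull_minimal, use assms(1) that in \<open>(auto simp: inner_diff_right algebra_simps)[1]\<close>, rule convex_halfspace_le)
    then show ?thesis using assms(2) by (auto simp: inner_diff_right algebra_simps)
  qed
  have "convex hull V \<subseteq> {z. - c \<bullet> z \<le> m - c \<bullet> y}"
    by (rule hull_minimal, use 1 in \<open>(auto simp: inner_diff_right algebra_simps)[1]\<close>, rule convex_halfspace_le)
  then show ?thesis using assms(3) by (auto simp: inner_diff_right algebra_simps)
qed

locale convex_domain =
  fixes \<Omega> :: "(real ^ 'n) set"
  assumes domain: "convex_polygonal_domain \<Omega>"
begin

lemma open_dom: "open \<Omega>" and dom_ne: "\<Omega> \<noteq> {}" and bounded_dom: "bounded \<Omega>" and convex_dom: "convex \<Omega>"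
  using domain by (auto simp: convex_polygonal_domain_def)

lemma lmeasurable_dom: "\<Omega> \<in> lmeasurable"
  using open_dom bounded_dom by (simp add: lmeasurable_open)

lemma lebesgue_dom: "\<Omega> \<in> sets lebesgue"
  using lmeasurable_dom by (rule fmeasurableD)

lemma compact_closure_dom: "compact (closure \<Omega>)"
  using bounded_dom by simp

lemma convex_closure_dom: "convex (closure \<Omega>)"
  using convex_dom by (rule convex_closure)

lemma interior_closure_dom: "interior (closure \<Omega>) = \<Omega>"
  using convex_interior_closure[OF convex_dom] open_dom by (simp add: interior_open)

lemma finite_measure_dom: "finite_measure (lebesgue_on \<Omega>)"
  using lmeasurable_dom by (rule finite_measure_lebesgue_on)

lemma dom_subset_closure: "x \<in> \<Omega> \<Longrightarrow> x \<in> closure \<Omega>"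
  using closure_subset by blast

lemma continuous_measurable_dom:
  "continuous_on \<Omega> f \<Longrightarrow> f \<in> borel_measurable (lebesgue_on \<Omega>)"
  using lebesgue_dom by (rule continuous_imp_measurable_on_sets_lebesgue[rotated])

lemma continuous_closure_measurable:
  "continuous_on (closure \<Omega>) f \<Longrightarrow> f \<in> borel_measurable (lebesgue_on \<Omega>)"
  by (rule continuous_measurable_dom) (rule continuous_on_subset[OF _ closure_subset])

end

locale convex_mesh = convex_domain \<Omega> for \<Omega> :: "(real ^ 'n) set" +
  fixes \<T> :: "(real ^ 'n) set set"
  assumes mesh: "simplicial_mesh \<Omega> \<T>"
begin

lemma finite_mesh: "finite \<T>" and disjoint_mesh: "disjoint \<T>"
  and cover: "(\<Union>\<sigma>\<in>\<T>. closure \<sigma>) = closure \<Omega>"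
  using mesh by (auto simp: simplicial_mesh_def)

context
  fixes \<sigma> assumes \<sigma>: "\<sigma> \<in> \<T>"
begin

text \<open>Full dimension makes the interior of the closed simplex nonempty, and a closed convex
  set with nonempty interior is the closure of that interior. So nothing is lost by storing open
  elements, and the extreme points of the closure are the vertices of the simplex.\<close>

lemma elem_simplex:
  shows "finite (mesh_vertices \<sigma>)" "\<not> affine_dependent (mesh_vertices \<sigma>)"
    "card (mesh_vertices \<sigma>) = CARD('n) + 1" "closure \<sigma> = convex hull mesh_vertices \<sigma>"
    "open \<sigma>" "convex \<sigma>" "\<sigma> \<noteq> {}"
proof -
  obtain C where C: "int CARD('n) simplex C" "\<sigma> = interior C"
    using mesh \<sigma> by (auto simp: simplicial_mesh_def)
  obtain V where V: "finite V" "\<not> affine_dependent V" "int (card V) = int CARD('n) + 1" "C = convex hull V"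
    using C(1) by (auto simp: simplex)
  have cC: "convex C" "closed C" using C(1) by (auto simp: convex_simplex closed_simplex)
  have "affine hull C = UNIV"
    using aff_dim_simplex[OF C(1)] aff_dim_eq_full[of C] by simp
  then have "interior C \<noteq> {}"
    using rel_interior_interior[of C] rel_interior_eq_empty[OF cC(1)] by auto
  then show "\<sigma> \<noteq> {}" "open \<sigma>" "convex \<sigma>" using C(2) cC by auto
  have cl: "closure \<sigma> = C"
    using convex_closure_interior[OF cC(1) \<open>interior C \<noteq> {}\<close>] cC C(2) by simp
  have "mesh_vertices \<sigma> = V"
    unfolding mesh_vertices_def cl V(4) using extreme_point_of_convex_hull_affine_independent[OF V(2)] by auto
  then show "finite (mesh_vertices \<sigma>)" "\<not> affine_dependent (mesh_vertices \<sigma>)"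
    "card (mesh_vertices \<sigma>) = CARD('n) + 1" "closure \<sigma> = convex hull mesh_vertices \<sigma>"
    using V cl by auto
qed

lemma elem_closure_subset: "closure \<sigma> \<subseteq> closure \<Omega>"
  using cover \<sigma> by auto

lemma elem_subset: "\<sigma> \<subseteq> \<Omega>"
  using interior_maximal[OF order_trans[OF closure_subset elem_closure_subset] elem_simplex(5)]
    interior_closure_dom by simp

lemma elem_bounded: "bounded \<sigma>"
  using elem_subset bounded_dom bounded_subset by blast

lemma elem_lmeasurable: "\<sigma> \<in> lmeasurable"
  using elem_bounded elem_simplex(5) by (simp add: lmeasurable_open)

lemma elem_measure_pos: "0 < measure lebesgue \<sigma>"
proof -
  have "\<not> negligible \<sigma>" using elem_simplex by (intro open_not_negligible) auto
  then show ?thesis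
    using elem_lmeasurable by (metis negligible_iff_measure zero_less_measure_iff)
qed

lemma vertices_subset: "mesh_vertices \<sigma> \<subseteq> closure \<sigma>"
  by (auto simp: mesh_vertices_def extreme_point_of_def)

lemma vertices_ne: "mesh_vertices \<sigma> \<noteq> {}"
  using elem_simplex(3) by force

lemma elem_dist: "x \<in> closure \<sigma> \<Longrightarrow> y \<in> closure \<sigma> \<Longrightarrow> norm (x - y) \<le> diameter \<sigma>"
  using diameter_bounded_bound[of "closure \<sigma>" x y] elem_bounded diameter_closure[OF elem_bounded]
  by (simp add: dist_norm bounded_closure)

end

text \<open>What the open elements miss lies on finitely many frontiers of convex sets, which are
  null.\<close>

lemma mesh_negligible: "negligible (\<Omega> - \<Union>\<T>)"
proof (rule negligible_subset)
  show "negligible (\<Union>\<sigma>\<in>\<T>. frontier \<sigma>)"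
    using finite_mesh by (auto intro!: negligible_Union negligible_convex_frontier elem_simplex)
  show "\<Omega> - \<Union>\<T> \<subseteq> (\<Union>\<sigma>\<in>\<T>. frontier \<sigma>)"
  proof
    fix x assume x: "x \<in> \<Omega> - \<Union>\<T>"
    then have "x \<in> (\<Union>\<sigma>\<in>\<T>. closure \<sigma>)" using cover closure_subset by blast
    then show "x \<in> (\<Union>\<sigma>\<in>\<T>. frontier \<sigma>)"
      using x elem_simplex(5) by (auto simp: frontier_def interior_open)
  qed
qed

lemma AE_mesh: "AE x in lebesgue_on \<Omega>. \<exists>\<sigma>\<in>\<T>. x \<in> \<sigma>"
proof -
  have "AE x in lebesgue. x \<notin> \<Omega> - \<Union>\<T>"
    using mesh_negligible negligible_iff_null_sets AE_not_in by blast
  then show ?thesis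
    using lebesgue_dom by (subst AE_restrict_space_iff) (auto elim!: AE_mp)
qed

text \<open>A preimage consists of whole elements and of a subset of the element boundaries. The
  values on the latter are arbitrary, but completeness makes every subset of a null set Lebesgue
  measurable.\<close>

lemma piecewise_const_measurable:
  fixes f :: "real ^ 'n \<Rightarrow> 'b::topological_space"
  assumes "\<And>\<sigma>. \<sigma> \<in> \<T> \<Longrightarrow> f constant_on \<sigma>"
  shows "f \<in> borel_measurable (lebesgue_on \<Omega>)"
proof (rule measurableI)
  fix A :: "'b set"
  have "negligible (f -` A \<inter> (\<Omega> - \<Union>\<T>))" by (rule negligible_subset[OF mesh_negligible]) auto
  moreover have "\<Union>{\<sigma>\<in>\<T>. \<sigma> \<subseteq> f -` A} \<in> sets lebesgue"
    using finite_mesh elem_lmeasurable by (intro sets.finite_Union) auto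
  ultimately have "\<Union>{\<sigma>\<in>\<T>. \<sigma> \<subseteq> f -` A} \<union> (f -` A \<inter> (\<Omega> - \<Union>\<T>)) \<in> sets lebesgue"
    using negligible_imp_sets by auto
  also have "\<Union>{\<sigma>\<in>\<T>. \<sigma> \<subseteq> f -` A} \<union> (f -` A \<inter> (\<Omega> - \<Union>\<T>)) = f -` A \<inter> \<Omega>"
  proof (intro equalityI subsetI)
    fix x assume x: "x \<in> f -` A \<inter> \<Omega>"
    show "x \<in> \<Union>{\<sigma>\<in>\<T>. \<sigma> \<subseteq> f -` A} \<union> (f -` A \<inter> (\<Omega> - \<Union>\<T>))"
    proof (cases "x \<in> \<Union>\<T>")
      case True
      then obtain \<sigma> where "\<sigma> \<in> \<T>" "x \<in> \<sigma>" by auto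
      then show ?thesis using assms[of \<sigma>] x by (auto simp: constant_on_def)
    qed (use x in auto)
  qed (use elem_subset in auto)
  finally show "f -` A \<inter> space (lebesgue_on \<Omega>) \<in> sets (lebesgue_on \<Omega>)"
    using lebesgue_dom by (simp add: sets_restrict_space_iff)
qed auto

lemma elem_eq: "\<sigma> \<in> \<T> \<Longrightarrow> \<sigma>' \<in> \<T> \<Longrightarrow> x \<in> \<sigma> \<Longrightarrow> x \<in> \<sigma>' \<Longrightarrow> \<sigma> = \<sigma>'"
  using disjoint_mesh by (auto simp: disjoint_def)

lemma sum_indicator_elem:
  fixes c :: "(real ^ 'n) set \<Rightarrow> 'b::real_vector"
  assumes "\<sigma> \<in> \<T>" "x \<in> \<sigma>"
  shows "(\<Sum>\<sigma>'\<in>\<T>. indicator \<sigma>' x *\<^sub>R c \<sigma>') = c \<sigma>"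
proof -
  have "indicator \<sigma>' x *\<^sub>R c \<sigma>' = (if \<sigma>' = \<sigma> then c \<sigma> else 0)" if "\<sigma>' \<in> \<T>" for \<sigma>'
  proof (cases "\<sigma>' = \<sigma>")
    case False
    then have "x \<notin> \<sigma>'" using elem_eq[OF assms(1) that assms(2)] by blast
    then show ?thesis using False by simp
  qed (use assms in simp)
  then have "(\<Sum>\<sigma>'\<in>\<T>. indicator \<sigma>' x *\<^sub>R c \<sigma>') = (\<Sum>\<sigma>'\<in>\<T>. if \<sigma>' = \<sigma> then c \<sigma> else 0)"
    by (intro sum.cong refl)
  then show ?thesis using finite_mesh assms by simp
qed

lemma piecewise_const_integral:
  fixes f :: "real ^ 'n \<Rightarrow> 'b::{banach,second_countable_topology}"
  assumes "\<And>\<sigma> x. \<sigma> \<in> \<T> \<Longrightarrow> x \<in> \<sigma> \<Longrightarrow> f x = c \<sigma>"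
  shows "has_bochner_integral (lebesgue_on \<Omega>) f (\<Sum>\<sigma>\<in>\<T>. measure lebesgue \<sigma> *\<^sub>R c \<sigma>)"
proof -
  let ?g = "\<lambda>x. \<Sum>\<sigma>\<in>\<T>. indicator \<sigma> x *\<^sub>R c \<sigma>"
  have "has_bochner_integral (lebesgue_on \<Omega>) (\<lambda>x. indicator \<sigma> x *\<^sub>R c \<sigma>) (measure lebesgue \<sigma> *\<^sub>R c \<sigma>)"
    if "\<sigma> \<in> \<T>" for \<sigma>
  proof -
    have "\<sigma> \<in> sets lebesgue" "\<sigma> \<in> lmeasurable" using elem_lmeasurable[OF that] by auto
    then have "has_bochner_integral (lebesgue_on \<Omega>) (indicator \<sigma> :: _ \<Rightarrow> real) (measure (lebesgue_on \<Omega>) \<sigma>)"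
      using elem_subset[OF that] lebesgue_dom
      by (intro has_bochner_integral_real_indicator)
        (auto simp: sets_restrict_space_iff emeasure_restrict_space fmeasurable_def)
    moreover have "measure (lebesgue_on \<Omega>) \<sigma> = measure lebesgue \<sigma>"
      using elem_subset[OF that] lebesgue_dom by (simp add: measure_restrict_space)
    ultimately show ?thesis by (intro has_bochner_integral_scaleR_left) auto
  qed
  then have g: "has_bochner_integral (lebesgue_on \<Omega>) ?g (\<Sum>\<sigma>\<in>\<T>. measure lebesgue \<sigma> *\<^sub>R c \<sigma>)"
    by (intro has_bochner_integral_sum)
  have "AE x in lebesgue_on \<Omega>. f x = ?g x"
    using AE_mesh
  proof eventually_elim
    case (elim x)
    then obtain \<sigma> where \<sigma>: "\<sigma> \<in> \<T>" "x \<in> \<sigma>" by auto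
    then show ?case using assms[OF \<sigma>] sum_indicator_elem[OF \<sigma>, of c] by simp
  qed
  moreover have "f \<in> borel_measurable (lebesgue_on \<Omega>)"
    by (rule piecewise_const_measurable) (use assms in \<open>auto simp: constant_on_def\<close>)
  moreover have "?g \<in> borel_measurable (lebesgue_on \<Omega>)" using g by (auto simp: has_bochner_integral_iff)
  ultimately show ?thesis using g has_bochner_integral_cong_AE by blast
qed

section \<open>Piecewise affine functions and nodal interpolation\<close>

lemma U_h_affine:
  assumes "u \<in> U_h \<Omega> \<T>" "\<sigma> \<in> \<T>"
  obtains a b where "\<And>x. x \<in> closure \<sigma> \<Longrightarrow> u x = a \<bullet> x + b" "\<And>x. x \<in> \<sigma> \<Longrightarrow> GDERIV u x :> a"
    "\<And>x. x \<in> \<sigma> \<Longrightarrow> grad u x = a"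
proof -
  obtain a b where ab: "\<And>x. x \<in> \<sigma> \<Longrightarrow> u x = a \<bullet> x + b"
    using assms by (auto simp: U_h_def)
  have cont: "continuous_on (closure \<sigma>) u"
    using assms elem_closure_subset by (auto simp: U_h_def intro: continuous_on_subset)
  have 1: "u x = a \<bullet> x + b" if "x \<in> closure \<sigma>" for x
  proof -
    have "u x - (a \<bullet> x + b) = 0"
      by (rule continuous_constant_on_closure[of \<sigma> "\<lambda>x. u x - (a \<bullet> x + b)"])
        (auto intro!: continuous_intros cont that simp: ab)
    then show ?thesis by simp
  qed
  have 2: "GDERIV u x :> a" if "x \<in> \<sigma>" for x
  proof -
    have "((\<lambda>x. a \<bullet> x + b) has_derivative (\<lambda>h. h \<bullet> a)) (at x)"
      by (auto intro!: derivative_eq_intros simp: inner_commute)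
    then show ?thesis unfolding gderiv_def
      by (rule has_derivative_transform_within_open[OF _ elem_simplex(5)[OF assms(2)] that])
        (use ab in auto)
  qed
  show ?thesis using that 1 2 grad_eq by blast
qed

lemma grad_piecewise_const:
  assumes "u \<in> U_h \<Omega> \<T>" "\<sigma> \<in> \<T>" shows "grad u constant_on \<sigma>"
  using U_h_affine[OF assms] by (auto simp: constant_on_def) metis

text \<open>Conformity glues the elementwise interpolants: two closed elements meet in a common
  face, the extreme points of this face are vertices of both, and affine functions that agree at
  these points agree on the face.\<close>

lemma nodal_interp_exists:
  "\<exists>u. u \<in> U_h \<Omega> \<T> \<and> (\<forall>\<sigma>\<in>\<T>. \<forall>x\<in>mesh_vertices \<sigma>. u x = v x)"
proof -
  have "\<forall>\<sigma>\<in>\<T>. \<exists>a b. \<forall>x\<in>mesh_vertices \<sigma>. a \<bullet> x + b = v x"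
    using affine_interpolation[OF elem_simplex(2)] by metis
  then obtain a b where ab: "\<And>\<sigma> x. \<sigma> \<in> \<T> \<Longrightarrow> x \<in> mesh_vertices \<sigma> \<Longrightarrow> a \<sigma> \<bullet> x + b \<sigma> = v x"
    by metis
  have consistent: "a \<sigma> \<bullet> x + b \<sigma> = a \<sigma>' \<bullet> x + b \<sigma>'"
    if "\<sigma> \<in> \<T>" "\<sigma>' \<in> \<T>" "x \<in> closure \<sigma>" "x \<in> closure \<sigma>'" for \<sigma> \<sigma>' x
  proof -
    let ?F = "closure \<sigma> \<inter> closure \<sigma>'"
    have F: "?F face_of closure \<sigma>" "?F face_of closure \<sigma>'"
      using mesh that unfolding simplicial_mesh_def triangulation_def by (auto simp: Int_commute)
    have "compact ?F" "convex ?F"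
      using that elem_bounded elem_simplex(6) by (intro compact_Int convex_Int convex_closure; simp)+
    from Krein_Milman_Minkowski[OF this] that
    have "x \<in> convex hull {x. x extreme_point_of ?F}" by auto
    then show ?thesis
    proof (rule affine_eq_on_convex_hull[rotated])
      fix x assume "x \<in> {x. x extreme_point_of ?F}"
      then have "x \<in> mesh_vertices \<sigma>" "x \<in> mesh_vertices \<sigma>'"
        using extreme_point_of_face[OF F(1)] extreme_point_of_face[OF F(2)] by (auto simp: mesh_vertices_def)
      then show "a \<sigma> \<bullet> x + b \<sigma> = a \<sigma>' \<bullet> x + b \<sigma>'" using ab that by simp
    qed
  qed
  define s where "s x = (SOME \<sigma>. \<sigma> \<in> \<T> \<and> x \<in> closure \<sigma>)" for x
  define u where "u x = a (s x) \<bullet> x + b (s x)" for x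
  have u: "u x = a \<sigma> \<bullet> x + b \<sigma>" if "\<sigma> \<in> \<T>" "x \<in> closure \<sigma>" for x \<sigma>
  proof -
    have "s x \<in> \<T> \<and> x \<in> closure (s x)"
      unfolding s_def by (rule someI) (use that in auto)
    then show ?thesis using consistent[of "s x" \<sigma> x] that by (simp add: u_def)
  qed
  have "continuous_on (\<Union>\<sigma>\<in>\<T>. closure \<sigma>) u"
  proof (rule continuous_on_closed_Union[OF finite_mesh])
    fix \<sigma> assume "\<sigma> \<in> \<T>"
    have "continuous_on (closure \<sigma>) (\<lambda>x. a \<sigma> \<bullet> x + b \<sigma>)" by (intro continuous_intros)
    then show "continuous_on (closure \<sigma>) u"
      using u[OF \<open>\<sigma> \<in> \<T>\<close>] by (simp cong: continuous_on_cong)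
  qed auto
  then have "u \<in> U_h \<Omega> \<T>"
    using u closure_subset unfolding U_h_def cover by blast
  moreover have "u x = v x" if "\<sigma> \<in> \<T>" "x \<in> mesh_vertices \<sigma>" for \<sigma> x
    using u[OF that(1), of x] ab[OF that] that(2) vertices_subset[OF that(1)] by auto
  ultimately show ?thesis by blast
qed

lemma nodal_interp:
  "nodal_interp \<Omega> \<T> v \<in> U_h \<Omega> \<T>"
  "\<sigma> \<in> \<T> \<Longrightarrow> x \<in> mesh_vertices \<sigma> \<Longrightarrow> nodal_interp \<Omega> \<T> v x = v x"
  using someI_ex[OF nodal_interp_exists[of v]] unfolding nodal_interp_def by auto

text \<open>The edge vectors control the gradient error only through the inscribed ball: a linear form
  that is small on all vertex differences is small on all differences of points of the element.\<close>

lemma nodal_interp_error: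
  assumes v: "C1_closure \<Omega> v g" and "0 < \<kappa>" "0 < e" and \<sigma>: "\<sigma> \<in> \<T>"
    and uc: "\<And>x y. x \<in> closure \<Omega> \<Longrightarrow> y \<in> closure \<Omega> \<Longrightarrow> norm (x - y) \<le> diameter \<sigma> \<Longrightarrow> norm (g x - g y) \<le> e"
    and ball: "ball x0 (\<kappa> * diameter \<sigma>) \<subseteq> \<sigma>"
    and u: "\<And>x. x \<in> closure \<sigma> \<Longrightarrow> u x = a \<bullet> x + b" "\<And>x. x \<in> mesh_vertices \<sigma> \<Longrightarrow> u x = v x"
    and x: "x \<in> closure \<sigma>"
  shows "norm (a - g x) \<le> 2 * e / \<kappa>" "\<bar>u x - v x\<bar> \<le> (2 / \<kappa> + 1) * e * diameter \<sigma>"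
proof -
  note S = elem_simplex[OF \<sigma>] elem_subset[OF \<sigma>]
  have clsub: "closure \<sigma> \<subseteq> closure \<Omega>" by (rule elem_closure_subset[OF \<sigma>])
  \<comment> \<open>Subtracting the linear form \<open>g x\<close> leaves a function whose gradient
    has norm at most \<open>e\<close> on the element, so that it is \<open>e\<close>-Lipschitz there
    and, by continuity, on the closure.\<close>
  define F where "F y = v y - g x \<bullet> y" for y
  have "e-lipschitz_on \<sigma> F"
  proof (rule lipschitz_onI)
    fix y z assume yz: "y \<in> \<sigma>" "z \<in> \<sigma>"
    have "norm (F y - F z) \<le> e * norm (y - z)"
    proof (rule differentiable_bound[OF S(6) _ _ yz])
      fix y assume y: "y \<in> \<sigma>"
      have "(v has_derivative (\<lambda>h. h \<bullet> g y)) (at y within \<sigma>)"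
        using v y S(8) by (auto simp: C1_closure_def gderiv_def intro: has_derivative_at_withinI)
      then show "(F has_derivative (\<lambda>h. h \<bullet> (g y - g x))) (at y within \<sigma>)"
        unfolding F_def by (auto intro!: derivative_eq_intros simp: inner_diff_right inner_commute)
      have "norm (g y - g x) \<le> e"
        using y x clsub closure_subset[of \<sigma>] elem_dist[OF \<sigma>, of y x] by (intro uc) auto
      then show "onorm (\<lambda>h. h \<bullet> (g y - g x)) \<le> e"
        by (intro onorm_bound) (use \<open>0 < e\<close> in \<open>auto intro!: order_trans[OF Cauchy_Schwarz_ineq2] mult_left_mono simp: mult.commute[of e]\<close>)
    qed
    then show "dist (F y) (F z) \<le> e * dist y z" by (simp add: dist_norm)
  qed (use \<open>0 < e\<close> in auto)
  moreover have "continuous_on (closure \<sigma>) F"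
    unfolding F_def using v clsub by (auto simp: C1_closure_def intro!: continuous_intros intro: continuous_on_subset)
  ultimately have "e-lipschitz_on (closure \<sigma>) F" by (rule lipschitz_on_closure)
  then have Fl: "\<bar>v y - v z - g x \<bullet> (y - z)\<bar> \<le> e * norm (y - z)" if "y \<in> closure \<sigma>" "z \<in> closure \<sigma>" for y z
    using lipschitz_onD[of e "closure \<sigma>" F y z] that
    by (simp add: F_def dist_norm inner_diff_right algebra_simps)
  have hull: "(a - g x) \<bullet> (y - z) \<le> e * diameter \<sigma>" if "y \<in> closure \<sigma>" "z \<in> closure \<sigma>" for y z
  proof (rule inner_le_on_convex_hull)
    fix p q assume pq: "p \<in> mesh_vertices \<sigma>" "q \<in> mesh_vertices \<sigma>"
    then have pq': "p \<in> closure \<sigma>" "q \<in> closure \<sigma>" using vertices_subset[OF \<sigma>] by auto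
    have "(a - g x) \<bullet> (p - q) = v p - v q - g x \<bullet> (p - q)"
      using u(1)[OF pq'(1)] u(1)[OF pq'(2)] u(2)[OF pq(1)] u(2)[OF pq(2)]
      by (simp add: inner_diff_left inner_diff_right)
    also have "\<dots> \<le> e * norm (p - q)" using Fl[OF pq'] by simp
    also have "\<dots> \<le> e * diameter \<sigma>" using elem_dist[OF \<sigma> pq'] \<open>0 < e\<close> by simp
    finally show "(a - g x) \<bullet> (p - q) \<le> e * diameter \<sigma>" .
  qed (use that S in auto)
  have dpos: "0 < diameter \<sigma>"
  proof -
    obtain y where y: "y \<in> \<sigma>" using S by auto
    obtain r where r: "0 < r" "cball y r \<subseteq> \<sigma>" using S(5) y open_contains_cball by blast
    obtain i :: 'n where True by simp
    have "y + r *\<^sub>R axis i 1 \<in> \<sigma>" using r by (intro subsetD[OF r(2)]) (simp add: dist_norm)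
    then show ?thesis
      using elem_dist[OF \<sigma>, of "y + r *\<^sub>R axis i 1" y] y closure_subset[of \<sigma>] r by (auto simp: subset_iff)
  qed
  show grad_err: "norm (a - g x) \<le> 2 * e / \<kappa>"
  proof (cases "a = g x")
    case False
    \<comment> \<open>The direction is that of the gradient error itself. Half the inscribed radius
      keeps \<open>y\<close> inside the open ball and is the origin of the factor 2 in the
      estimate.\<close>
    define y where "y = x0 + (\<kappa> * diameter \<sigma> / 2 / norm (a - g x)) *\<^sub>R (a - g x)"
    have "y \<in> ball x0 (\<kappa> * diameter \<sigma>)" "x0 \<in> ball x0 (\<kappa> * diameter \<sigma>)"
      using False dpos \<open>0 < \<kappa>\<close> by (auto simp: y_def dist_norm)
    then have "(a - g x) \<bullet> (y - x0) \<le> e * diameter \<sigma>"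
      using ball closure_subset[of \<sigma>] by (intro hull) blast+
    moreover have "(a - g x) \<bullet> (y - x0) = \<kappa> * diameter \<sigma> / 2 * norm (a - g x)"
      using False by (simp add: y_def dot_square_norm power2_eq_square)
    ultimately have "(\<kappa> * norm (a - g x)) * diameter \<sigma> \<le> (2 * e) * diameter \<sigma>" by (simp add: algebra_simps)
    then have "\<kappa> * norm (a - g x) \<le> 2 * e" using dpos by simp
    then show ?thesis using \<open>0 < \<kappa>\<close> by (simp add: field_simps)
  qed (use \<open>0 < \<kappa>\<close> \<open>0 < e\<close> in simp)
  \<comment> \<open>At a vertex the two functions coincide, so the error of the values is an
    increment from \<open>p\<close> to \<open>x\<close>.\<close>
  obtain p where p: "p \<in> mesh_vertices \<sigma>" using vertices_ne[OF \<sigma>] by auto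
  then have p': "p \<in> closure \<sigma>" using vertices_subset[OF \<sigma>] by auto
  have "\<bar>u x - v x\<bar> = \<bar>(a - g x) \<bullet> (x - p) - (v x - v p - g x \<bullet> (x - p))\<bar>"
    using u(1)[OF x] u(1)[OF p'] u(2)[OF p] by (simp add: inner_diff_left inner_diff_right)
  also have "\<dots> \<le> \<bar>(a - g x) \<bullet> (x - p)\<bar> + e * norm (x - p)"
    using Fl[OF x p'] by linarith
  also have "\<dots> \<le> norm (a - g x) * norm (x - p) + e * norm (x - p)"
    using Cauchy_Schwarz_ineq2[of "a - g x" "x - p"] by simp
  also have "\<dots> \<le> (2 * e / \<kappa> + e) * norm (x - p)"
    using mult_right_mono[OF grad_err, of "norm (x - p)"] by (simp add: algebra_simps)
  also have "\<dots> \<le> (2 * e / \<kappa> + e) * diameter \<sigma>"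
    using elem_dist[OF \<sigma> x p'] \<open>0 < e\<close> \<open>0 < \<kappa>\<close> by (intro mult_left_mono) auto
  also have "\<dots> = (2 / \<kappa> + 1) * e * diameter \<sigma>" by (simp add: algebra_simps)
  finally show "\<bar>u x - v x\<bar> \<le> (2 / \<kappa> + 1) * e * diameter \<sigma>" .
qed

text \<open>The closed elements cut the parameter interval into finitely many closed sets, on each
  of which \<open>u\<close> is affine with controlled slope, and Lipschitz bounds on a finite closed
  cover of an interval combine. The gradient is evaluated inside the elements that meet the segment,
  because the segment may run along element boundaries, where no gradient exists.\<close>

lemma U_h_segment_bound:
  assumes u: "u \<in> U_h \<Omega> \<T>" and xy: "x \<in> closure \<Omega>" "y \<in> closure \<Omega>" and "0 \<le> B"
    and B: "\<And>\<sigma> z. \<sigma> \<in> \<T> \<Longrightarrow> closure \<sigma> \<inter> closed_segment x y \<noteq> {} \<Longrightarrow> z \<in> \<sigma> \<Longrightarrow> norm (grad u z) \<le> B"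
  shows "\<bar>u x - u y\<bar> \<le> B * norm (x - y)"
proof -
  define p where "p t = x + t *\<^sub>R (y - x)" for t :: real
  have p_seg: "p t \<in> closed_segment x y" if "t \<in> {0..1}" for t
    using that by (auto simp: p_def in_segment algebra_simps intro!: exI[of _ t])
  have p_cl: "p t \<in> closure \<Omega>" if "t \<in> {0..1}" for t
    using closed_segment_subset[OF xy convex_closure_dom] p_seg[OF that] by auto
  have contp: "continuous_on UNIV p" unfolding p_def by (intro continuous_intros)
  have "(B * norm (y - x))-lipschitz_on {0..1} (\<lambda>t. u (p t))"
  proof (rule lipschitz_on_closed_Union[where I=\<T> and U="\<lambda>\<sigma>. {0..1} \<inter> p -` closure \<sigma>"])
    fix \<sigma> assume \<sigma>: "\<sigma> \<in> \<T>"
    show "closed ({0..1} \<inter> p -` closure \<sigma>)"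
      by (intro closed_Int closed_vimage contp) auto
    obtain a b where ab: "\<And>x. x \<in> closure \<sigma> \<Longrightarrow> u x = a \<bullet> x + b" "\<And>x. x \<in> \<sigma> \<Longrightarrow> grad u x = a"
      using U_h_affine[OF u \<sigma>] by metis
    obtain z where z: "z \<in> \<sigma>" using elem_simplex(7)[OF \<sigma>] by auto
    show "(B * norm (y - x))-lipschitz_on ({0..1} \<inter> p -` closure \<sigma>) (\<lambda>t. u (p t))"
    proof (rule lipschitz_onI)
      fix s t assume st: "s \<in> {0..1} \<inter> p -` closure \<sigma>" "t \<in> {0..1} \<inter> p -` closure \<sigma>"
      then have "closure \<sigma> \<inter> closed_segment x y \<noteq> {}" using p_seg[of s] by auto
      then have aB: "norm a \<le> B" using B[OF \<sigma> _ z] ab(2)[OF z] by simp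
      have "u (p s) - u (p t) = (s - t) * (a \<bullet> (y - x))"
        using st by (simp add: ab p_def inner_diff_right inner_add_right algebra_simps)
      then have "dist (u (p s)) (u (p t)) = \<bar>s - t\<bar> * \<bar>a \<bullet> (y - x)\<bar>"
        by (simp add: dist_norm abs_mult)
      also have "\<dots> \<le> \<bar>s - t\<bar> * (B * norm (y - x))"
        using order_trans[OF Cauchy_Schwarz_ineq2[of a "y - x"] mult_right_mono[OF aB norm_ge_zero]]
        by (rule mult_left_mono) simp
      finally show "dist (u (p s)) (u (p t)) \<le> B * norm (y - x) * dist s t"
        by (simp add: dist_norm mult.commute)
    qed (use \<open>0 \<le> B\<close> in auto)
  next
    show "{0..1} \<subseteq> (\<Union>\<sigma>\<in>\<T>. {0..1} \<inter> p -` closure \<sigma>)"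
      using p_cl cover by auto blast
  qed (use finite_mesh \<open>0 \<le> B\<close> in auto)
  from lipschitz_onD[OF this, of 0 1] show ?thesis
    by (simp add: p_def dist_norm norm_minus_commute)
qed

lemma U_h_grad_bounded:
  assumes "u \<in> U_h \<Omega> \<T>"
  obtains B where "0 \<le> B" "\<And>\<sigma> x. \<sigma> \<in> \<T> \<Longrightarrow> x \<in> \<sigma> \<Longrightarrow> norm (grad u x) \<le> B"
proof -
  have "\<forall>\<sigma>\<in>\<T>. \<exists>B. \<forall>x\<in>\<sigma>. norm (grad u x) \<le> B"
    using U_h_affine[OF assms] by (metis order_refl)
  then obtain B where B: "\<And>\<sigma> x. \<sigma> \<in> \<T> \<Longrightarrow> x \<in> \<sigma> \<Longrightarrow> norm (grad u x) \<le> B \<sigma>" by metis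
  have "norm (grad u x) \<le> (\<Sum>\<sigma>\<in>\<T>. \<bar>B \<sigma>\<bar>)" if "\<sigma> \<in> \<T>" "x \<in> \<sigma>" for \<sigma> x
    using B[OF that] member_le_sum[of \<sigma> \<T> "\<lambda>\<sigma>. \<bar>B \<sigma>\<bar>"] finite_mesh that by fastforce
  then show ?thesis by (intro that[of "\<Sum>\<sigma>\<in>\<T>. \<bar>B \<sigma>\<bar>"] sum_nonneg) auto
qed

text \<open>A boundary point lies in the face of its element that is cut out by a supporting hyperplane
  of \<open>\<Omega>\<close>, and the vertices of this face are boundary points as well.\<close>

lemma U_h_zero_on_frontier:
  assumes u: "u \<in> U_h \<Omega> \<T>" and x: "x \<in> frontier \<Omega>"
    and v: "\<And>\<sigma> p. \<sigma> \<in> \<T> \<Longrightarrow> p \<in> mesh_vertices \<sigma> \<Longrightarrow> p \<notin> \<Omega> \<Longrightarrow> u p = 0"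
  shows "u x = 0"
proof -
  have ri: "rel_interior (closure \<Omega>) = \<Omega>"
    using interior_closure_dom dom_ne rel_interior_nonempty_interior[of "closure \<Omega>"] by simp
  have xcl: "x \<in> closure \<Omega>" "x \<notin> \<Omega>" using x open_dom by (auto simp: frontier_def interior_open)
  obtain \<sigma> where \<sigma>: "\<sigma> \<in> \<T>" "x \<in> closure \<sigma>" using cover xcl by blast
  obtain c where c: "\<And>y. y \<in> closure \<Omega> \<Longrightarrow> c \<bullet> x \<le> c \<bullet> y" "\<And>y. y \<in> \<Omega> \<Longrightarrow> c \<bullet> x < c \<bullet> y"
    using supporting_hyperplane_rel_boundary[OF convex_closure_dom xcl(1)] xcl(2) unfolding ri by metis
  let ?F = "closure \<sigma> \<inter> {y. c \<bullet> y = c \<bullet> x}"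
  have F: "?F face_of closure \<sigma>"
    using c(1) elem_closure_subset[OF \<sigma>(1)] elem_simplex(6)[OF \<sigma>(1)]
    by (intro face_of_Int_supporting_hyperplane_ge convex_closure) auto
  have "compact ?F" "convex ?F"
    using elem_bounded[OF \<sigma>(1)] elem_simplex(6)[OF \<sigma>(1)]
    by (auto intro!: compact_Int_closed closed_hyperplane convex_Int convex_closure convex_hyperplane)
  from Krein_Milman_Minkowski[OF this] \<sigma>
  have hull: "x \<in> convex hull {y. y extreme_point_of ?F}" by auto
  obtain a b where ab: "\<And>x. x \<in> closure \<sigma> \<Longrightarrow> u x = a \<bullet> x + b" using U_h_affine[OF u \<sigma>(1)] by metis
  have "a \<bullet> x + b = 0 \<bullet> x + 0"
  proof (rule affine_eq_on_convex_hull[OF _ hull])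
    fix p assume "p \<in> {y. y extreme_point_of ?F}"
    then have p: "p \<in> mesh_vertices \<sigma>" "p \<in> ?F"
      using extreme_point_of_face[OF F] by (auto simp: mesh_vertices_def)
    then have "p \<notin> \<Omega>" using c(2)[of p] by auto
    then show "a \<bullet> p + b = 0 \<bullet> p + 0" using v[OF \<sigma>(1) p(1)] ab[of p] p(2) by auto
  qed
  then show ?thesis using ab \<sigma> by simp
qed

section \<open>Element means and mass lumping\<close>

lemma elem_mean_eq:
  assumes "\<sigma> \<in> \<T>" "x \<in> \<sigma>"
  shows "elem_mean \<T> v x = (\<integral>y. v y \<partial>lebesgue_on \<sigma>) / measure lebesgue \<sigma>"
  using sum_indicator_elem[OF assms, of "\<lambda>\<sigma>. (\<integral>y. v y \<partial>lebesgue_on \<sigma>) / measure lebesgue \<sigma>"]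
  by (simp add: elem_mean_def)

lemma elem_mean_near:
  assumes \<sigma>: "\<sigma> \<in> \<T>" "x \<in> \<sigma>" and v: "continuous_on (closure \<Omega>) v"
    and near: "\<And>y. y \<in> \<sigma> \<Longrightarrow> \<bar>v y - c\<bar> \<le> e"
  shows "\<bar>elem_mean \<T> v x - c\<bar> \<le> e"
proof -
  let ?M = "lebesgue_on \<sigma>"
  interpret finite_measure ?M using elem_lmeasurable[OF \<sigma>(1)] by (rule finite_measure_lebesgue_on)
  have m: "measure ?M \<sigma> = measure lebesgue \<sigma>"
    using elem_lmeasurable[OF \<sigma>(1)] by (simp add: measure_restrict_space fmeasurableD)
  have vm: "v \<in> borel_measurable ?M"
    using elem_lmeasurable[OF \<sigma>(1)] elem_closure_subset[OF \<sigma>(1)] closure_subset[of \<sigma>]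
    by (intro continuous_imp_measurable_on_sets_lebesgue continuous_on_subset[OF v]) (auto simp: fmeasurableD)
  have bnd: "c - e \<le> v y \<and> v y \<le> c + e" if "y \<in> \<sigma>" for y using near[OF that] by linarith
  have int: "integrable ?M v"
    by (rule integrable_const_bound[of _ "\<bar>c\<bar> + e"]) (use bnd vm in \<open>force intro!: AE_I2\<close>)+
  have "(\<integral>y. c - e \<partial>?M) \<le> (\<integral>y. v y \<partial>?M)" "(\<integral>y. v y \<partial>?M) \<le> (\<integral>y. c + e \<partial>?M)"
    by (rule integral_mono; use int bnd in simp)+
  then have "(c - e) * measure lebesgue \<sigma> \<le> (\<integral>y. v y \<partial>?M)" "(\<integral>y. v y \<partial>?M) \<le> (c + e) * measure lebesgue \<sigma>"
    using m by (simp_all add: mult.commute)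
  then have "c - e \<le> elem_mean \<T> v x" "elem_mean \<T> v x \<le> c + e"
    unfolding elem_mean_eq[OF \<sigma>] using elem_measure_pos[OF \<sigma>(1)] by (simp_all add: field_simps)
  then show ?thesis by linarith
qed

text \<open>The lumped product is the integral of the function \<open>F\<close> that is constant on
  each element with the mean of the vertex products as its value; the weight
  \<open>1 / (d + 1)\<close> matches the number of vertices. Closeness at vertices therefore becomes
  closeness of integrands.\<close>

lemma lumped_near:
  assumes f: "\<And>\<sigma> p x. \<sigma> \<in> \<T> \<Longrightarrow> p \<in> mesh_vertices \<sigma> \<Longrightarrow> x \<in> \<sigma> \<Longrightarrow> \<bar>\<eta> p * \<zeta> p - g x\<bar> \<le> e"
    and g: "integrable (lebesgue_on \<Omega>) g" and "0 \<le> e"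
  shows "\<bar>lumped_inner \<T> \<eta> \<zeta> - (\<integral>x. g x \<partial>lebesgue_on \<Omega>)\<bar> \<le> e * measure lebesgue \<Omega>"
proof -
  interpret finite_measure "lebesgue_on \<Omega>" by (rule finite_measure_dom)
  define m where "m \<sigma> = (\<Sum>x\<in>mesh_vertices \<sigma>. \<eta> x * \<zeta> x) / (real CARD('n) + 1)" for \<sigma>
  define F where "F x = (\<Sum>\<sigma>\<in>\<T>. indicator \<sigma> x * m \<sigma>)" for x
  have F: "F x = m \<sigma>" if "\<sigma> \<in> \<T>" "x \<in> \<sigma>" for x \<sigma>
    using sum_indicator_elem[OF that, of m] by (simp add: F_def)
  have hb: "has_bochner_integral (lebesgue_on \<Omega>) F (lumped_inner \<T> \<eta> \<zeta>)"
    using piecewise_const_integral[of F m] F by (simp add: lumped_inner_def m_def)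
  then have Fi: "integrable (lebesgue_on \<Omega>) F" "(\<integral>x. F x \<partial>lebesgue_on \<Omega>) = lumped_inner \<T> \<eta> \<zeta>"
    by (auto simp: has_bochner_integral_iff)
  have near: "AE x in lebesgue_on \<Omega>. \<bar>F x - g x\<bar> \<le> e"
    using AE_mesh
  proof eventually_elim
    case (elim x)
    then obtain \<sigma> where \<sigma>: "\<sigma> \<in> \<T>" "x \<in> \<sigma>" by auto
    have "F x - g x = (\<Sum>p\<in>mesh_vertices \<sigma>. (\<eta> p * \<zeta> p - g x)) / (real CARD('n) + 1)"
      using elem_simplex(3)[OF \<sigma>(1)] F[OF \<sigma>] by (simp add: m_def sum_subtractf field_simps)
    also have "\<bar>\<dots>\<bar> \<le> (\<Sum>p\<in>mesh_vertices \<sigma>. e) / (real CARD('n) + 1)"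
      unfolding abs_divide using f[OF \<sigma>(1) _ \<sigma>(2)]
      by (auto intro!: divide_right_mono order_trans[OF sum_abs] sum_mono simp del: sum_constant)
    also have "\<dots> = e" using elem_simplex(3)[OF \<sigma>(1)] by (simp add: field_simps)
    finally show ?case .
  qed
  have "\<bar>lumped_inner \<T> \<eta> \<zeta> - (\<integral>x. g x \<partial>lebesgue_on \<Omega>)\<bar> = \<bar>\<integral>x. F x - g x \<partial>lebesgue_on \<Omega>\<bar>"
    using Fi g by simp
  also have "\<dots> \<le> (\<integral>x. \<bar>F x - g x\<bar> \<partial>lebesgue_on \<Omega>)" by (rule integral_abs_bound)
  also have "\<dots> \<le> (\<integral>x. e \<partial>lebesgue_on \<Omega>)"
    by (rule integral_mono_AE) (use near Fi g in auto)
  also have "\<dots> = e * measure lebesgue \<Omega>"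
    using lebesgue_dom by (simp add: measure_restrict_space)
  finally show ?thesis .
qed

end

section \<open>Weak gradients of Lipschitz functions\<close>

text \<open>Stated along a null sequence, the form in which dominated convergence can use
  it.\<close>

lemma GDERIV_directional:
  assumes "GDERIV u x :> D" "h \<longlonglongrightarrow> 0" "\<And>k. h k \<noteq> (0::real)"
  shows "(\<lambda>k. (u (x + h k *\<^sub>R e) - u x) / h k) \<longlonglongrightarrow> e \<bullet> D"
proof -
  have "((\<lambda>t. x + t *\<^sub>R e) has_derivative (\<lambda>t. t *\<^sub>R e)) (at 0)"
    by (auto intro!: derivative_eq_intros)
  moreover have "(u has_derivative (\<lambda>h. h \<bullet> D)) (at (x + 0 *\<^sub>R e))"
    using assms(1) by (simp add: gderiv_def)
  ultimately have "((\<lambda>t. u (x + t *\<^sub>R e)) has_derivative (\<lambda>t. (t *\<^sub>R e) \<bullet> D)) (at 0)"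
    by (rule has_derivative_compose)
  then have "((\<lambda>t. u (x + t *\<^sub>R e)) has_field_derivative e \<bullet> D) (at 0)"
    by (simp add: has_field_derivative_def mult_commute_abs)
  then have "(\<lambda>t. (u (x + t *\<^sub>R e) - u x) / t) \<midarrow>0\<rightarrow> e \<bullet> D"
    by (simp add: DERIV_def)
  moreover have "filterlim h (at 0) sequentially"
    using assms by (simp add: filterlim_at)
  ultimately show ?thesis by (rule filterlim_compose)
qed

text \<open>Both factors are Borel, so the integrals live on \<open>lborel\<close>, where
  translation invariance is an equality of image measures.\<close>

lemma integral_lebesgue_on_translate:
  fixes F :: "'a::euclidean_space \<Rightarrow> real"
  assumes "F \<in> borel_measurable borel" "\<phi> \<in> borel_measurable borel"
  shows "(\<integral>x. F x * \<phi> (x + v) \<partial>lebesgue) = (\<integral>x. F (x - v) * \<phi> x \<partial>lebesgue)"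
proof -
  note [measurable] = assms
  have "(\<integral>x. F (x - v) * \<phi> x \<partial>lebesgue) = (\<integral>x. F (x - v) * \<phi> x \<partial>lborel)"
    by (rule integral_completion) simp
  also have "\<dots> = (\<integral>x. F (x - v) * \<phi> x \<partial>distr lborel borel ((+) v))"
    by (simp add: lborel_distr_plus)
  also have "\<dots> = (\<integral>x. F x * \<phi> (x + v) \<partial>lborel)"
    by (subst integral_distr) (auto simp: add.commute)
  also have "\<dots> = (\<integral>x. F x * \<phi> (x + v) \<partial>lebesgue)"
    by (rule integral_completion[symmetric]) simp
  finally show ?thesis by simp
qed

text \<open>A translation moves the difference quotient from the test function to \<open>u\<close>; dominated
  convergence on both sides then replaces Fubini and integration by parts on lines.\<close>

lemma lipschitz_has_weak_grad:
  fixes \<Omega> :: "(real ^ 'n) set"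
  assumes \<Omega>: "open \<Omega>" "bounded \<Omega>" and lip: "L-lipschitz_on \<Omega> u"
    and bdd: "\<And>x. x \<in> \<Omega> \<Longrightarrow> \<bar>u x\<bar> \<le> U"
    and g: "AE x in lebesgue_on \<Omega>. GDERIV u x :> g x" "g \<in> borel_measurable (lebesgue_on \<Omega>)"
    and gB: "AE x in lebesgue_on \<Omega>. norm (g x) \<le> B"
  shows "has_weak_grad \<Omega> u g"
  unfolding has_weak_grad_def
proof
  fix \<phi> assume \<phi>: "\<phi> \<in> C1_compact \<Omega>"
  let ?M = "lebesgue_on \<Omega>"
  have \<Omega>m: "\<Omega> \<in> lmeasurable" using \<Omega> by (simp add: lmeasurable_open)
  then have \<Omega>s: "\<Omega> \<in> sets lebesgue" by (rule fmeasurableD)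
  interpret finite_measure ?M using \<Omega>m by (rule finite_measure_lebesgue_on)
  obtain S where S: "compact S" "S \<subseteq> \<Omega>" "\<And>x. x \<notin> S \<Longrightarrow> \<phi> x = 0" "\<And>x. GDERIV \<phi> x :> grad \<phi> x"
    "continuous_on UNIV \<phi>" "continuous_on UNIV (grad \<phi>)" "\<And>x. x \<notin> S \<Longrightarrow> grad \<phi> x = 0"
    using C1_compactE[OF \<phi>] by metis
  obtain P D where P: "\<And>x. \<bar>\<phi> x\<bar> \<le> P" "\<And>x. norm (grad \<phi> x) \<le> D"
    using C1_compact_integrable(3,4)[OF \<phi> \<Omega>m] by auto
  have D0: "0 \<le> D" using P(2)[of 0] norm_ge_zero order_trans by blast
  have L0: "0 \<le> L" using lip by (rule lipschitz_on_nonneg)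
  have u_cont: "continuous_on \<Omega> u" using lip by (rule lipschitz_on_continuous_on)
  have [measurable]: "u \<in> borel_measurable ?M"
    using u_cont \<Omega>s by (rule continuous_imp_measurable_on_sets_lebesgue)
  have [measurable]: "\<phi> \<in> borel_measurable ?M" "grad \<phi> \<in> borel_measurable ?M"
    using C1_compact_integrable[OF \<phi> \<Omega>m] by auto
  note [measurable] = g(2)
  obtain r where r: "0 < r" "(\<Union>x\<in>S. cball x r) \<subseteq> \<Omega>"
    using compact_subset_open_imp_cball_epsilon_subset[OF S(1) \<Omega>(1) S(2)] by auto
  \<comment> \<open>The zero extension makes \<open>u\<close> available after a shift. Its jump at
    the boundary does no harm: shifts have length at most \<open>r\<close>, and points of the
    support \<open>S\<close> stay in \<open>\<Omega>\<close> under them.\<close>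
  define F where "F x = indicator \<Omega> x *\<^sub>R u x" for x
  have F[measurable]: "F \<in> borel_measurable borel"
    unfolding F_def using \<Omega>(1) u_cont by (intro borel_measurable_continuous_on_indicator) auto
  have \<phi>b[measurable]: "\<phi> \<in> borel_measurable borel" using S(5) by (rule borel_measurable_continuous_onI)
  have \<phi>lip: "\<bar>\<phi> x - \<phi> y\<bar> \<le> D * norm (x - y)" for x y
  proof -
    have "norm (\<phi> x - \<phi> y) \<le> D * norm (x - y)"
    proof (rule differentiable_bound[of UNIV \<phi> "\<lambda>x h. h \<bullet> grad \<phi> x"])
      show "(\<phi> has_derivative (\<lambda>h. h \<bullet> grad \<phi> x)) (at x within UNIV)" for x
        using S(4)[of x] by (simp add: gderiv_def)
      show "onorm (\<lambda>h. h \<bullet> grad \<phi> x) \<le> D" for x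
      proof (rule onorm_bound)
        fix h
        have "norm (h \<bullet> grad \<phi> x) \<le> norm h * norm (grad \<phi> x)" using Cauchy_Schwarz_ineq2 by auto
        also have "\<dots> \<le> norm h * D" by (rule mult_left_mono) (use P in auto)
        finally show "norm (h \<bullet> grad \<phi> x) \<le> D * norm h" by (simp add: mult.commute)
      qed (rule D0)
    qed auto
    then show ?thesis by simp
  qed
  have comp: "(\<integral>x. u x * (axis i 1 \<bullet> grad \<phi> x) \<partial>?M) = - (\<integral>x. \<phi> x * (axis i 1 \<bullet> g x) \<partial>?M)" for i
  proof -
    let ?e = "axis i 1 :: real ^ 'n"
    define h where "h k = r / real (Suc k)" for k
    have h: "h k \<noteq> 0" "0 < h k" "h k \<le> r" for k
      using r(1) by (auto simp: h_def field_simps)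
    have h0: "h \<longlonglongrightarrow> 0" unfolding h_def
      using tendsto_mult_right_zero[OF LIMSEQ_inverse_real_of_nat, of r] by (simp add: divide_inverse)
    have eq: "(\<integral>x. u x * ((\<phi> (x + h k *\<^sub>R ?e) - \<phi> x) / h k) \<partial>?M)
        = (\<integral>x. \<phi> x * ((F (x - h k *\<^sub>R ?e) - F x) / h k) \<partial>?M)" for k
    proof -
      let ?v = "h k *\<^sub>R ?e"
      have \<phi>v[measurable]: "(\<lambda>x. \<phi> (x + ?v)) \<in> borel_measurable ?M" "(\<lambda>x. F (x - ?v)) \<in> borel_measurable ?M"
        "F \<in> borel_measurable ?M"
        using F \<phi>b by (auto intro!: measurable_restrict_space1 measurable_completion)
      have Fv: "\<bar>F x\<bar> \<le> \<bar>U\<bar>" for x using bdd[of x] by (auto simp: F_def indicator_def)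
      have i1: "integrable ?M (\<lambda>x. u x * \<phi> (x + ?v))"
        by (rule integrable_const_bound[of _ "\<bar>U\<bar> * P"])
          (use bdd P in \<open>auto intro!: AE_I2 mult_mono order_trans[OF bdd] simp: abs_mult\<close>)
      have i2: "integrable ?M (\<lambda>x. u x * \<phi> x)"
        by (rule integrable_const_bound[of _ "\<bar>U\<bar> * P"])
          (use bdd P in \<open>auto intro!: AE_I2 mult_mono order_trans[OF bdd] simp: abs_mult\<close>)
      have i3: "integrable ?M (\<lambda>x. F (x - ?v) * \<phi> x)"
        by (rule integrable_const_bound[of _ "\<bar>U\<bar> * P"])
          (use Fv P in \<open>auto intro!: AE_I2 mult_mono simp: abs_mult\<close>)
      have "(\<integral>x. u x * \<phi> (x + ?v) \<partial>?M) = (\<integral>x. F x * \<phi> (x + ?v) \<partial>lebesgue)"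
        using \<Omega>s by (subst integral_restrict_space) (auto simp: F_def mult.assoc)
      also have "\<dots> = (\<integral>x. F (x - ?v) * \<phi> x \<partial>lebesgue)"
        by (rule integral_lebesgue_on_translate) fact+
      also have "\<dots> = (\<integral>x. indicator \<Omega> x *\<^sub>R (F (x - ?v) * \<phi> x) \<partial>lebesgue)"
        using S(2,3) by (intro Bochner_Integration.integral_cong) (auto simp: indicator_def)
      also have "\<dots> = (\<integral>x. F (x - ?v) * \<phi> x \<partial>?M)"
        using \<Omega>s by (subst integral_restrict_space) auto
      finally have e1: "(\<integral>x. u x * \<phi> (x + ?v) \<partial>?M) = (\<integral>x. F (x - ?v) * \<phi> x \<partial>?M)" .
      have e2: "(\<integral>x. u x * \<phi> x \<partial>?M) = (\<integral>x. F x * \<phi> x \<partial>?M)"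
        using \<Omega>s by (intro Bochner_Integration.integral_cong) (auto simp: F_def)
      have i4: "integrable ?M (\<lambda>x. F x * \<phi> x)"
        by (rule integrable_const_bound[of _ "\<bar>U\<bar> * P"])
          (use Fv P in \<open>auto intro!: AE_I2 mult_mono simp: abs_mult\<close>)
      have "(\<integral>x. u x * ((\<phi> (x + ?v) - \<phi> x) / h k) \<partial>?M)
          = (\<integral>x. (u x * \<phi> (x + ?v) - u x * \<phi> x) / h k \<partial>?M)"
        by (simp add: right_diff_distrib)
      also have "\<dots> = ((\<integral>x. F (x - ?v) * \<phi> x \<partial>?M) - (\<integral>x. F x * \<phi> x \<partial>?M)) / h k"
        using i1 i2 e1 e2 by (simp add: Bochner_Integration.integral_diff)
      also have "\<dots> = (\<integral>x. (F (x - ?v) * \<phi> x - F x * \<phi> x) / h k \<partial>?M)"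
        using i3 i4 by simp
      finally show ?thesis by (simp add: algebra_simps diff_divide_distrib)
    qed
    have lim1: "(\<lambda>k. \<integral>x. u x * ((\<phi> (x + h k *\<^sub>R ?e) - \<phi> x) / h k) \<partial>?M)
        \<longlonglongrightarrow> (\<integral>x. u x * (?e \<bullet> grad \<phi> x) \<partial>?M)"
    proof (rule integral_dominated_convergence)
      show "(\<lambda>x. u x * (?e \<bullet> grad \<phi> x)) \<in> borel_measurable ?M" by measurable
      show "(\<lambda>x. u x * ((\<phi> (x + h k *\<^sub>R ?e) - \<phi> x) / h k)) \<in> borel_measurable ?M" for k
      proof -
        have [measurable]: "(\<lambda>x. \<phi> (x + h k *\<^sub>R ?e)) \<in> borel_measurable ?M"
          using \<phi>b by (auto intro!: measurable_restrict_space1 measurable_completion)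
        show ?thesis by measurable
      qed
      show "integrable ?M (\<lambda>x. \<bar>U\<bar> * D)" by simp
      show "AE x in ?M. (\<lambda>k. u x * ((\<phi> (x + h k *\<^sub>R ?e) - \<phi> x) / h k)) \<longlonglongrightarrow> u x * (?e \<bullet> grad \<phi> x)"
        by (intro AE_I2 tendsto_mult_left GDERIV_directional S(4) h0 h)
      show "AE x in ?M. norm (u x * ((\<phi> (x + h k *\<^sub>R ?e) - \<phi> x) / h k)) \<le> \<bar>U\<bar> * D" for k
      proof (rule AE_I2)
        fix x assume "x \<in> space ?M"
        then have "\<bar>u x\<bar> \<le> \<bar>U\<bar>" using bdd[of x] by auto
        moreover have "\<bar>(\<phi> (x + h k *\<^sub>R ?e) - \<phi> x) / h k\<bar> \<le> D"
          using \<phi>lip[of "x + h k *\<^sub>R ?e" x] h[of k] by (simp add: field_simps)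
        ultimately show "norm (u x * ((\<phi> (x + h k *\<^sub>R ?e) - \<phi> x) / h k)) \<le> \<bar>U\<bar> * D"
          unfolding real_norm_def abs_mult by (intro mult_mono) auto
      qed
    qed
    have lim2: "(\<lambda>k. \<integral>x. \<phi> x * ((F (x - h k *\<^sub>R ?e) - F x) / h k) \<partial>?M)
        \<longlonglongrightarrow> (\<integral>x. \<phi> x * (- (?e \<bullet> g x)) \<partial>?M)"
    proof (rule integral_dominated_convergence)
      show "(\<lambda>x. \<phi> x * (- (?e \<bullet> g x))) \<in> borel_measurable ?M" by measurable
      show "(\<lambda>x. \<phi> x * ((F (x - h k *\<^sub>R ?e) - F x) / h k)) \<in> borel_measurable ?M" for k
      proof -
        have [measurable]: "(\<lambda>x. F (x - h k *\<^sub>R ?e)) \<in> borel_measurable ?M" "F \<in> borel_measurable ?M"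
          using F by (auto intro!: measurable_restrict_space1 measurable_completion)
        show ?thesis by measurable
      qed
      show "integrable ?M (\<lambda>x. P * L)" by simp
      have diff: "F (x - h k *\<^sub>R ?e) - F x = u (x - h k *\<^sub>R ?e) - u x" and inO: "x - h k *\<^sub>R ?e \<in> \<Omega>" "x \<in> \<Omega>"
        if "x \<in> S" for x k
      proof -
        have "x - h k *\<^sub>R ?e \<in> cball x r" using h[of k] by (simp add: dist_norm)
        then show *: "x - h k *\<^sub>R ?e \<in> \<Omega>" "x \<in> \<Omega>" using r(2) that S(2) by blast+
        then show "F (x - h k *\<^sub>R ?e) - F x = u (x - h k *\<^sub>R ?e) - u x" by (simp add: F_def)
      qed
      show "AE x in ?M. (\<lambda>k. \<phi> x * ((F (x - h k *\<^sub>R ?e) - F x) / h k)) \<longlonglongrightarrow> \<phi> x * (- (?e \<bullet> g x))"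
        using g(1)
      proof eventually_elim
        case (elim x)
        show ?case
        proof (cases "x \<in> S")
          case True
          have "(\<lambda>k. (u (x + h k *\<^sub>R (- ?e)) - u x) / h k) \<longlonglongrightarrow> (- ?e) \<bullet> g x"
            by (rule GDERIV_directional[OF elim h0 h(1)])
          then show ?thesis using diff[OF True] by (intro tendsto_mult_left) simp
        qed (simp add: S(3))
      qed
      show "AE x in ?M. norm (\<phi> x * ((F (x - h k *\<^sub>R ?e) - F x) / h k)) \<le> P * L" for k
      proof (rule AE_I2)
        fix x
        show "norm (\<phi> x * ((F (x - h k *\<^sub>R ?e) - F x) / h k)) \<le> P * L"
        proof (cases "x \<in> S")
          case True
          have "\<bar>(F (x - h k *\<^sub>R ?e) - F x) / h k\<bar> \<le> L"
            using lipschitz_onD[OF lip inO(1)[OF True, of k] inO(2)[OF True]] h[of k] diff[OF True, of k]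
            by (simp add: dist_norm field_simps)
          then show ?thesis
            unfolding real_norm_def abs_mult using P(1)[of x] by (intro mult_mono) auto
        next
          case False
          have "0 \<le> P" using P(1)[of x] by linarith
          then show ?thesis using False S(3) L0 by simp
        qed
      qed
    qed
    show ?thesis using LIMSEQ_unique[OF lim1 lim2[folded eq]] by simp
  qed
  have int1: "integrable ?M (\<lambda>x. u x *\<^sub>R grad \<phi> x)"
    by (rule integrable_const_bound[of _ "\<bar>U\<bar> * D"])
      (use bdd P in \<open>auto intro!: AE_I2 mult_mono order_trans[OF bdd]\<close>)
  have int2: "integrable ?M (\<lambda>x. \<phi> x *\<^sub>R g x)"
  proof (rule integrable_const_bound[of _ "P * \<bar>B\<bar>"])
    show "AE x in ?M. norm (\<phi> x *\<^sub>R g x) \<le> P * \<bar>B\<bar>"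
      using gB by eventually_elim (use P in \<open>auto intro!: mult_mono order_trans[OF abs_ge_zero P(1)]\<close>)
  qed measurable
  show "(\<integral>x. u x *\<^sub>R grad \<phi> x \<partial>?M) = - (\<integral>x. \<phi> x *\<^sub>R g x \<partial>?M)"
  proof (subst vec_eq_iff, intro allI)
    fix i
    have "(\<integral>x. u x *\<^sub>R grad \<phi> x \<partial>?M) $ i = (\<integral>x. (u x *\<^sub>R grad \<phi> x) $ i \<partial>?M)"
      using integral_bounded_linear[OF bounded_linear_vec_nth[of i] int1] by simp
    moreover have "(\<integral>x. \<phi> x *\<^sub>R g x \<partial>?M) $ i = (\<integral>x. (\<phi> x *\<^sub>R g x) $ i \<partial>?M)"
      using integral_bounded_linear[OF bounded_linear_vec_nth[of i] int2] by simp
    ultimately show "(\<integral>x. u x *\<^sub>R grad \<phi> x \<partial>?M) $ i = (- (\<integral>x. \<phi> x *\<^sub>R g x \<partial>?M)) $ i"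
      using comp[of i] by (simp add: inner_axis')
  qed
qed

section \<open>Convergence along mesh sequences\<close>

lemma Linf_spaceI:
  assumes "u \<in> borel_measurable (lebesgue_on \<Omega>)" "AE x in lebesgue_on \<Omega>. norm (u x) \<le> C"
  shows "u \<in> Linf_space \<Omega>"
proof -
  have "esssup (lebesgue_on \<Omega>) (\<lambda>x. ereal (norm (u x))) \<le> ereal C"
    using assms by (intro esssup_I) auto
  then show ?thesis using assms by (auto simp: Linf_space_def Linf_norm_def less_eq_ereal_def)
qed

lemma Linf_spaceE:
  assumes "u \<in> Linf_space \<Omega>"
  obtains C where "u \<in> borel_measurable (lebesgue_on \<Omega>)" "AE x in lebesgue_on \<Omega>. norm (u x) \<le> C" "0 \<le> C"
proof -
  have m: "u \<in> borel_measurable (lebesgue_on \<Omega>)" and lt: "esssup (lebesgue_on \<Omega>) (\<lambda>x. ereal (norm (u x))) < \<infinity>"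
    using assms by (auto simp: Linf_space_def Linf_norm_def)
  obtain C where C: "esssup (lebesgue_on \<Omega>) (\<lambda>x. ereal (norm (u x))) \<le> ereal C"
  proof (cases "esssup (lebesgue_on \<Omega>) (\<lambda>x. ereal (norm (u x)))")
    case (real r) then show ?thesis using that[of r] by simp
  next
    case PInf then show ?thesis using lt by simp
  next
    \<comment> \<open>This case arises if \<open>\<Omega>\<close> is a null set.\<close>
    case MInf then show ?thesis using that[of 0] by simp
  qed
  have "AE x in lebesgue_on \<Omega>. norm (u x) \<le> \<bar>C\<bar>"
    using esssup_AE[of "\<lambda>x. ereal (norm (u x))" "lebesgue_on \<Omega>"]
  proof eventually_elim
    case (elim x)
    then have "ereal (norm (u x)) \<le> ereal C" using C by (rule order_trans)
    then show ?case by simp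
  qed
  then show ?thesis using that m by auto
qed

text \<open>Uniqueness up to null sets, from the fundamental lemma applied to each component. It
  makes the choice in \<open>weak_grad\<close> immaterial.\<close>

lemma weak_grad_AE_eq:
  fixes \<Omega> :: "(real ^ 'n) set"
  assumes \<Omega>: "open \<Omega>" "bounded \<Omega>" and g: "g \<in> Linf_space \<Omega>" "has_weak_grad \<Omega> u g"
  shows "weak_grad \<Omega> u \<in> Linf_space \<Omega>" "AE x in lebesgue_on \<Omega>. weak_grad \<Omega> u x = g x"
proof -
  let ?M = "lebesgue_on \<Omega>" and ?g = "weak_grad \<Omega> u"
  have \<Omega>m: "\<Omega> \<in> lmeasurable" using \<Omega> by (simp add: lmeasurable_open)
  interpret finite_measure ?M using \<Omega>m by (rule finite_measure_lebesgue_on)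
  have g': "?g \<in> Linf_space \<Omega>" "has_weak_grad \<Omega> u ?g"
    unfolding weak_grad_def using someI_ex[of "\<lambda>g. g \<in> Linf_space \<Omega> \<and> has_weak_grad \<Omega> u g"] g by auto
  show "?g \<in> Linf_space \<Omega>" by fact
  have gi: "integrable ?M g" and gi': "integrable ?M ?g"
    using Linf_spaceE[OF g(1)] Linf_spaceE[OF g'(1)] by (metis integrable_const_bound)+
  have int: "integrable ?M (\<lambda>x. \<phi> x *\<^sub>R f x)" if a: "\<phi> \<in> C1_compact \<Omega>" and b: "integrable ?M f" for \<phi> and f :: "_ \<Rightarrow> real ^ 'n"
  proof -
    obtain P where P: "\<And>x. \<bar>\<phi> x\<bar> \<le> P" using C1_compact_integrable(3)[OF a \<Omega>m] by auto
    have [measurable]: "\<phi> \<in> borel_measurable ?M" "f \<in> borel_measurable ?M"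
      using C1_compact_integrable(2)[OF a \<Omega>m] b by auto
    show ?thesis
    proof (rule Bochner_Integration.integrable_bound[of _ "\<lambda>x. P * norm (f x)"])
      show "AE x in ?M. norm (\<phi> x *\<^sub>R f x) \<le> norm (P * norm (f x))"
        using P by (intro AE_I2) (auto simp: abs_mult intro!: mult_right_mono order_trans[OF P])
    qed (use b in auto)
  qed
  have "AE x in ?M. (?g x - g x) $ i = 0" for i
  proof (rule AE_zero_if_orthogonal_C1_compact[OF \<Omega>])
    have "integrable ?M (\<lambda>x. ?g x - g x)" using gi gi' by simp
    from integrable_bounded_linear[OF bounded_linear_vec_nth[of i] this]
    show "integrable ?M (\<lambda>x. (?g x - g x) $ i)" .
    fix \<phi> assume \<phi>: "\<phi> \<in> C1_compact \<Omega>"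
    have "(\<integral>x. \<phi> x *\<^sub>R (?g x - g x) \<partial>?M) = 0"
      using g(2) g'(2) \<phi> int[OF \<phi> gi] int[OF \<phi> gi']
      by (auto simp: has_weak_grad_def scaleR_diff_right)
    moreover have "(\<integral>x. (\<phi> x *\<^sub>R (?g x - g x)) $ i \<partial>?M) = (\<integral>x. \<phi> x *\<^sub>R (?g x - g x) \<partial>?M) $ i"
      using gi gi' by (intro integral_bounded_linear[OF bounded_linear_vec_nth[of i]] int[OF \<phi>]) auto
    ultimately show "(\<integral>x. (?g x - g x) $ i * \<phi> x \<partial>?M) = 0" by (simp add: mult.commute)
  qed
  then have "AE x in ?M. \<forall>i. (?g x - g x) $ i = 0" by (simp add: AE_all_countable)
  then show "AE x in ?M. ?g x = g x" by eventually_elim (simp add: vec_eq_iff)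
qed

lemma measurable_vec:
  fixes f :: "'a \<Rightarrow> real ^ 'n"
  assumes "\<And>i. (\<lambda>x. f x $ i) \<in> borel_measurable M"
  shows "f \<in> borel_measurable M"
  using assms by (subst borel_measurable_euclidean_space) (auto simp: Basis_vec_def inner_axis)

lemma C1_compact_C1_closure:
  assumes "\<phi> \<in> C1_compact \<Omega>" shows "C1_closure \<Omega> \<phi> (grad \<phi>)"
  using C1_compactE[OF assms] unfolding C1_closure_def by (metis continuous_on_subset subset_UNIV)

lemma L2_innerI: "L2_inner \<Omega> u v = (\<integral>x. u x * v x \<partial>lebesgue_on \<Omega>)" for u v :: "real ^ 'n \<Rightarrow> real"
  by (simp add: L2_inner_def)

context convex_domain
begin

lemma continuous_bounded:
  fixes u :: "real ^ 'n \<Rightarrow> 'b::real_normed_vector"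
  assumes "continuous_on (closure \<Omega>) u"
  obtains C where "0 \<le> C" "\<And>x. x \<in> closure \<Omega> \<Longrightarrow> norm (u x) \<le> C"
proof -
  have "bounded (u ` closure \<Omega>)"
    using compact_closure_dom assms by (intro compact_imp_bounded compact_continuous_image)
  then obtain C where C: "\<And>x. x \<in> closure \<Omega> \<Longrightarrow> norm (u x) \<le> C" unfolding bounded_iff by auto
  then show ?thesis using that[of "max C 0"] by (simp add: le_max_iff_disj)
qed

lemma integrable_mult_continuous:
  fixes \<psi> u :: "real ^ 'n \<Rightarrow> real"
  assumes "integrable (lebesgue_on \<Omega>) \<psi>" "continuous_on (closure \<Omega>) u"
  shows "integrable (lebesgue_on \<Omega>) (\<lambda>x. \<psi> x * u x)"
proof -
  obtain C where C: "0 \<le> C" "\<And>x. x \<in> closure \<Omega> \<Longrightarrow> norm (u x) \<le> C" using continuous_bounded[OF assms(2)] by blast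
  have [measurable]: "u \<in> borel_measurable (lebesgue_on \<Omega>)" "\<psi> \<in> borel_measurable (lebesgue_on \<Omega>)"
    using assms continuous_closure_measurable by auto
  show ?thesis
  proof (rule Bochner_Integration.integrable_bound[of _ "\<lambda>x. C * \<psi> x"])
    show "AE x in lebesgue_on \<Omega>. norm (\<psi> x * u x) \<le> norm (C * \<psi> x)"
      using C dom_subset_closure by (intro AE_I2) (auto simp: abs_mult mult.commute[of C] intro!: mult_left_mono)
  qed (use assms in auto)
qed

lemma continuous_integrable:
  fixes u :: "real ^ 'n \<Rightarrow> real"
  assumes "continuous_on (closure \<Omega>) u"
  shows "integrable (lebesgue_on \<Omega>) u"
proof -
  interpret finite_measure "lebesgue_on \<Omega>" by (rule finite_measure_dom)
  show ?thesis using integrable_mult_continuous[of "\<lambda>_. 1" u] assms by simp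
qed

text \<open>The factors \<open>\<psi> j\<close> are only bounded in L1 and need not converge;
  uniform smallness of \<open>u j - v\<close> outweighs them. The fluxes \<open>Q\<close> are
  handled in this way.\<close>

lemma tendsto_integral_uniform:
  fixes \<psi> u :: "nat \<Rightarrow> real ^ 'n \<Rightarrow> real"
  assumes \<psi>: "\<And>j. integrable (lebesgue_on \<Omega>) (\<psi> j)" "\<And>j. (\<integral>x. \<bar>\<psi> j x\<bar> \<partial>lebesgue_on \<Omega>) \<le> C"
    and u: "\<And>j. integrable (lebesgue_on \<Omega>) (\<lambda>x. \<psi> j x * u j x)" "continuous_on (closure \<Omega>) v"
    and lim: "\<And>e. 0 < e \<Longrightarrow> \<forall>\<^sub>F j in sequentially. AE x in lebesgue_on \<Omega>. \<bar>u j x - v x\<bar> \<le> e"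
  shows "(\<lambda>j. (\<integral>x. \<psi> j x * u j x \<partial>lebesgue_on \<Omega>) - (\<integral>x. \<psi> j x * v x \<partial>lebesgue_on \<Omega>)) \<longlonglongrightarrow> 0"
proof (rule tendstoI)
  let ?M = "lebesgue_on \<Omega>"
  fix e :: real assume e: "0 < e"
  have C0: "0 \<le> C" by (rule order_trans[OF _ \<psi>(2)[of 0]]) simp
  have "0 < e / (C + 1)" using e C0 by simp
  from lim[OF this]
  show "\<forall>\<^sub>F j in sequentially. dist ((\<integral>x. \<psi> j x * u j x \<partial>?M) - (\<integral>x. \<psi> j x * v x \<partial>?M)) 0 < e"
  proof eventually_elim
    case (elim j)
    have i: "integrable ?M (\<lambda>x. \<psi> j x * u j x)" "integrable ?M (\<lambda>x. \<psi> j x * v x)"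
      using \<psi> u integrable_mult_continuous by auto
    have "(\<integral>x. \<psi> j x * u j x \<partial>?M) - (\<integral>x. \<psi> j x * v x \<partial>?M) = (\<integral>x. \<psi> j x * u j x - \<psi> j x * v x \<partial>?M)"
      using i by simp
    also have "\<bar>\<dots>\<bar> \<le> (\<integral>x. \<bar>\<psi> j x * u j x - \<psi> j x * v x\<bar> \<partial>?M)" by (rule integral_abs_bound)
    also have "\<dots> \<le> (\<integral>x. e / (C + 1) * \<bar>\<psi> j x\<bar> \<partial>?M)"
    proof (rule integral_mono_AE)
      show "AE x in ?M. \<bar>\<psi> j x * u j x - \<psi> j x * v x\<bar> \<le> e / (C + 1) * \<bar>\<psi> j x\<bar>"
        using elim
      proof eventually_elim
        case (elim x)
        have "\<bar>\<psi> j x * u j x - \<psi> j x * v x\<bar> = \<bar>\<psi> j x\<bar> * \<bar>u j x - v x\<bar>"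
          by (simp flip: abs_mult add: algebra_simps)
        also have "\<dots> \<le> \<bar>\<psi> j x\<bar> * (e / (C + 1))" using elim by (rule mult_left_mono) simp
        finally show ?case by (simp add: mult.commute)
      qed
    qed (use i \<psi> in auto)
    also have "\<dots> = e / (C + 1) * (\<integral>x. \<bar>\<psi> j x\<bar> \<partial>?M)" by simp
    also have "\<dots> \<le> e / (C + 1) * C" using \<psi>(2) C0 e by (intro mult_left_mono) auto
    also have "\<dots> < e" using e C0 by (simp add: field_simps)
    finally show ?case by (simp add: dist_norm)
  qed
qed

lemma tendsto_integral_uniform_limit:
  fixes \<psi> :: "real ^ 'n \<Rightarrow> real" and u :: "nat \<Rightarrow> real ^ 'n \<Rightarrow> real"
  assumes \<psi>: "integrable (lebesgue_on \<Omega>) \<psi>" and u: "\<And>j. continuous_on (closure \<Omega>) (u j)"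
    and v: "continuous_on (closure \<Omega>) v" and lim: "uniform_limit (closure \<Omega>) u v sequentially"
  shows "(\<lambda>j. \<integral>x. \<psi> x * u j x \<partial>lebesgue_on \<Omega>) \<longlonglongrightarrow> (\<integral>x. \<psi> x * v x \<partial>lebesgue_on \<Omega>)"
proof -
  have "\<forall>\<^sub>F j in sequentially. AE x in lebesgue_on \<Omega>. \<bar>u j x - v x\<bar> \<le> e" if "0 < e" for e
    using uniform_limitD[OF lim that]
  proof eventually_elim
    case (elim j)
    then show ?case using dom_subset_closure by (intro AE_I2) (force simp: dist_real_def)
  qed
  from tendsto_integral_uniform[OF \<psi> order_refl integrable_mult_continuous[OF \<psi> u] v this]
  show ?thesis by (rule LIM_zero_cancel)
qed

end

context convex_mesh
begin

lemma U_h_continuous: "u \<in> U_h \<Omega> \<T> \<Longrightarrow> continuous_on (closure \<Omega>) u"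
  by (simp add: U_h_def)

lemma U_h_lipschitz:
  assumes u: "u \<in> U_h \<Omega> \<T>" and B: "0 \<le> B" "\<And>\<sigma> x. \<sigma> \<in> \<T> \<Longrightarrow> x \<in> \<sigma> \<Longrightarrow> norm (grad u x) \<le> B"
  shows "B-lipschitz_on (closure \<Omega>) u"
  by (rule lipschitz_onI) (use U_h_segment_bound[OF u] B in \<open>auto simp: dist_norm\<close>)

lemma U_h_grad_Linf:
  assumes u: "u \<in> U_h \<Omega> \<T>"
  shows "grad u \<in> borel_measurable (lebesgue_on \<Omega>)" "grad u \<in> Linf_space \<Omega>"
    "u \<in> Linf_space \<Omega>" "has_weak_grad \<Omega> u (grad u)"
proof -
  obtain B where B: "0 \<le> B" "\<And>\<sigma> x. \<sigma> \<in> \<T> \<Longrightarrow> x \<in> \<sigma> \<Longrightarrow> norm (grad u x) \<le> B"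
    using U_h_grad_bounded[OF u] by blast
  show m: "grad u \<in> borel_measurable (lebesgue_on \<Omega>)"
    using grad_piecewise_const[OF u] by (rule piecewise_const_measurable)
  have AEB: "AE x in lebesgue_on \<Omega>. norm (grad u x) \<le> B" using AE_mesh by eventually_elim (use B in auto)
  then show "grad u \<in> Linf_space \<Omega>" using m by (intro Linf_spaceI)
  obtain C where C: "\<And>x. x \<in> closure \<Omega> \<Longrightarrow> norm (u x) \<le> C" using continuous_bounded[OF U_h_continuous[OF u]] by blast
  then show "u \<in> Linf_space \<Omega>"
    using continuous_closure_measurable[OF U_h_continuous[OF u]] dom_subset_closure by (intro Linf_spaceI[of _ _ C]) auto
  have AEG: "AE x in lebesgue_on \<Omega>. GDERIV u x :> grad u x"
    using AE_mesh
  proof eventually_elim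
    case (elim x)
    then obtain \<sigma> where "\<sigma> \<in> \<T>" "x \<in> \<sigma>" by auto
    then show ?case using U_h_affine[OF u] by metis
  qed
  have lip: "B-lipschitz_on \<Omega> u"
    using lipschitz_on_subset[OF U_h_lipschitz[OF u B] closure_subset] .
  show "has_weak_grad \<Omega> u (grad u)"
    by (rule lipschitz_has_weak_grad[OF open_dom bounded_dom lip _ AEG m AEB, of C])
      (use C dom_subset_closure in auto)
qed

lemma nodal_interp_C1_compact:
  assumes "\<phi> \<in> C1_compact \<Omega>"
  shows "nodal_interp \<Omega> \<T> \<phi> \<in> U_h0 \<Omega> \<T>"
proof -
  note u = nodal_interp(1)[of \<phi>]
  have z: "\<phi> x = 0" if "x \<notin> \<Omega>" for x using C1_compactE[OF assms] that by (metis subsetD)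
  have "nodal_interp \<Omega> \<T> \<phi> x = 0" if "x \<in> frontier \<Omega>" for x
    by (rule U_h_zero_on_frontier[OF u that]) (use nodal_interp(2) z in auto)
  then show ?thesis
    using u U_h_grad_Linf[OF u] U_h_continuous[OF u] by (auto simp: U_h0_def W1inf_0_def W1inf_def)
qed

end

text \<open>The bounds \<open>d j\<close> only dominate the diameters, and \<open>\<kappa>\<close>
  is common to all meshes; a subsequence is again an instance.\<close>

locale mesh_sequence = convex_domain \<Omega> for \<Omega> :: "(real ^ 'n) set" +
  fixes \<T> :: "nat \<Rightarrow> (real ^ 'n) set set" and d :: "nat \<Rightarrow> real" and \<kappa> :: real
  assumes meshes: "\<And>j. simplicial_mesh \<Omega> (\<T> j)"
    and diam: "\<And>j \<sigma>. \<sigma> \<in> \<T> j \<Longrightarrow> diameter \<sigma> \<le> d j" and d_lim: "d \<longlonglongrightarrow> 0"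
    and \<kappa>: "0 < \<kappa>" "\<And>j \<sigma>. \<sigma> \<in> \<T> j \<Longrightarrow> \<exists>x. ball x (\<kappa> * diameter \<sigma>) \<subseteq> \<sigma>"
begin

lemma mesh_at: "convex_mesh \<Omega> (\<T> j)"
  using meshes by unfold_locales

lemma elem_closure: "\<sigma> \<in> \<T> j \<Longrightarrow> x \<in> \<sigma> \<Longrightarrow> x \<in> closure \<sigma>" "\<sigma> \<in> \<T> j \<Longrightarrow> x \<in> closure \<sigma> \<Longrightarrow> x \<in> closure \<Omega>"
  using closure_subset convex_mesh.elem_closure_subset[OF mesh_at] by blast+

text \<open>Uniform continuity on the compact closure, measured in element diameters so that it can
  be applied to two points of one closed element.\<close>

lemma uniform_oscillation:
  fixes g :: "real ^ 'n \<Rightarrow> 'b::real_normed_vector"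
  assumes "continuous_on (closure \<Omega>) g" "0 < e"
  shows "\<forall>\<^sub>F j in sequentially. \<forall>\<sigma>\<in>\<T> j. \<forall>x\<in>closure \<Omega>. \<forall>y\<in>closure \<Omega>.
    norm (x - y) \<le> diameter \<sigma> \<longrightarrow> norm (g x - g y) \<le> e"
proof -
  have "uniformly_continuous_on (closure \<Omega>) g"
    using compact_uniformly_continuous[OF assms(1) compact_closure_dom] .
  then obtain \<delta> where \<delta>: "0 < \<delta>" "\<And>x y. x \<in> closure \<Omega> \<Longrightarrow> y \<in> closure \<Omega> \<Longrightarrow> dist y x < \<delta> \<Longrightarrow> dist (g y) (g x) < e"
    using assms(2) unfolding uniformly_continuous_on_def by metis
  have "\<forall>\<^sub>F j in sequentially. d j < \<delta>" using d_lim \<delta>(1) by (rule order_tendstoD(2))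
  then show ?thesis
  proof eventually_elim
    case (elim j)
    show ?case
    proof (intro ballI impI)
      fix \<sigma> x y assume *: "\<sigma> \<in> \<T> j" "x \<in> closure \<Omega>" "y \<in> closure \<Omega>" "norm (x - y) \<le> diameter \<sigma>"
      then have "dist x y < \<delta>" using diam[OF *(1)] elim by (simp add: dist_norm)
      then show "norm (g x - g y) \<le> e" using \<delta>(2)[OF *(3,2)] by (simp add: dist_norm)
    qed
  qed
qed

text \<open>Both errors are governed by the oscillation of \<open>g\<close> over one element, and
  shape regularity keeps the constants \<open>2 / \<kappa>\<close> and
  \<open>2 / \<kappa> + 1\<close> independent of the mesh.\<close>

lemma nodal_interp_conv:
  assumes v: "C1_closure \<Omega> v g"
  shows "uniform_limit (closure \<Omega>) (\<lambda>j. nodal_interp \<Omega> (\<T> j) v) v sequentially"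
    and "\<And>e. 0 < e \<Longrightarrow> \<forall>\<^sub>F j in sequentially. \<forall>\<sigma>\<in>\<T> j. \<forall>x\<in>\<sigma>. norm (grad (nodal_interp \<Omega> (\<T> j) v) x - g x) \<le> e"
proof -
  have gc: "continuous_on (closure \<Omega>) g" using v by (simp add: C1_closure_def)
  have key: "\<forall>\<^sub>F j in sequentially. \<forall>\<sigma>\<in>\<T> j. \<forall>x\<in>closure \<sigma>.
      \<bar>nodal_interp \<Omega> (\<T> j) v x - v x\<bar> \<le> (2 / \<kappa> + 1) * e * d j \<and>
      (x \<in> \<sigma> \<longrightarrow> norm (grad (nodal_interp \<Omega> (\<T> j) v) x - g x) \<le> 2 * e / \<kappa>)" if e: "0 < e" for e
    using uniform_oscillation[OF gc e]
  proof eventually_elim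
    case (elim j)
    interpret convex_mesh \<Omega> "\<T> j" by (rule mesh_at)
    show ?case
    proof (intro ballI)
      fix \<sigma> x assume \<sigma>: "\<sigma> \<in> \<T> j" and x: "x \<in> closure \<sigma>"
      obtain x0 where x0: "ball x0 (\<kappa> * diameter \<sigma>) \<subseteq> \<sigma>" using \<kappa>(2)[OF \<sigma>] by auto
      obtain a b where ab: "\<And>x. x \<in> closure \<sigma> \<Longrightarrow> nodal_interp \<Omega> (\<T> j) v x = a \<bullet> x + b"
        "\<And>x. x \<in> \<sigma> \<Longrightarrow> grad (nodal_interp \<Omega> (\<T> j) v) x = a"
        using U_h_affine[OF nodal_interp(1) \<sigma>] by metis
      note err = nodal_interp_error[OF v \<kappa>(1) e \<sigma> _ x0 ab(1) nodal_interp(2)[OF \<sigma>] x]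
      have osc: "norm (g x - g y) \<le> e"
        if "x \<in> closure \<Omega>" "y \<in> closure \<Omega>" "norm (x - y) \<le> diameter \<sigma>" for x y
        using elim \<sigma> that by blast
      have "(2 / \<kappa> + 1) * e * diameter \<sigma> \<le> (2 / \<kappa> + 1) * e * d j"
        using diam[OF \<sigma>] e \<kappa>(1) by (intro mult_left_mono) auto
      then show "\<bar>nodal_interp \<Omega> (\<T> j) v x - v x\<bar> \<le> (2 / \<kappa> + 1) * e * d j \<and>
        (x \<in> \<sigma> \<longrightarrow> norm (grad (nodal_interp \<Omega> (\<T> j) v) x - g x) \<le> 2 * e / \<kappa>)"
        using err[OF osc] ab(2) by auto
    qed
  qed
  show "\<forall>\<^sub>F j in sequentially. \<forall>\<sigma>\<in>\<T> j. \<forall>x\<in>\<sigma>. norm (grad (nodal_interp \<Omega> (\<T> j) v) x - g x) \<le> e" if "0 < e" for e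
  proof -
    \<comment> \<open>With this oscillation the gradient error
      \<open>2 * (e * \<kappa> / 2) / \<kappa>\<close> is \<open>e\<close>.\<close>
    have "0 < e * \<kappa> / 2" using that \<kappa>(1) by simp
    from key[OF this] show ?thesis
      by eventually_elim (use \<kappa>(1) closure_subset in force)
  qed
  show "uniform_limit (closure \<Omega>) (\<lambda>j. nodal_interp \<Omega> (\<T> j) v) v sequentially"
  proof (rule uniform_limitI)
    fix e :: real assume e: "0 < e"
    \<comment> \<open>For the values an oscillation of 1 is small enough, since the factor
      \<open>d j\<close> already tends to 0.\<close>
    have "(\<lambda>j. (2 / \<kappa> + 1) * 1 * d j) \<longlonglongrightarrow> (2 / \<kappa> + 1) * 1 * 0"
      by (intro tendsto_mult_left d_lim)
    then have "\<forall>\<^sub>F j in sequentially. (2 / \<kappa> + 1) * 1 * d j < e"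
      using e by (intro order_tendstoD(2)) auto
    with key[OF zero_less_one]
    show "\<forall>\<^sub>F j in sequentially. \<forall>x\<in>closure \<Omega>. dist (nodal_interp \<Omega> (\<T> j) v x) (v x) < e"
    proof eventually_elim
      case (elim j)
      interpret convex_mesh \<Omega> "\<T> j" by (rule mesh_at)
      show ?case
      proof
        fix x assume "x \<in> closure \<Omega>"
        then obtain \<sigma> where "\<sigma> \<in> \<T> j" "x \<in> closure \<sigma>" using cover by blast
        then have "\<bar>nodal_interp \<Omega> (\<T> j) v x - v x\<bar> \<le> (2 / \<kappa> + 1) * 1 * d j" using elim(1) by blast
        then show "dist (nodal_interp \<Omega> (\<T> j) v x) (v x) < e" using elim(2) by (simp add: dist_real_def)
      qed
    qed
  qed
qed

lemma elem_mean_conv: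
  fixes u :: "nat \<Rightarrow> real ^ 'n \<Rightarrow> real"
  assumes u: "\<And>j. continuous_on (closure \<Omega>) (u j)" "continuous_on (closure \<Omega>) v"
    and lim: "uniform_limit (closure \<Omega>) u v sequentially" and e: "0 < e"
  shows "\<forall>\<^sub>F j in sequentially. \<forall>\<sigma>\<in>\<T> j. \<forall>x\<in>\<sigma>. \<bar>elem_mean (\<T> j) (u j) x - v x\<bar> \<le> e"
proof -
  have "0 < e / 2" using e by simp
  from uniform_limitD[OF lim this] uniform_oscillation[OF u(2) this]
  show ?thesis
  proof eventually_elim
    case (elim j)
    interpret convex_mesh \<Omega> "\<T> j" by (rule mesh_at)
    show ?case
    proof (intro ballI elem_mean_near u)
      fix \<sigma> x y assume *: "\<sigma> \<in> \<T> j" "x \<in> \<sigma>" "y \<in> \<sigma>"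
      then have cl: "x \<in> closure \<sigma>" "y \<in> closure \<sigma>" "x \<in> closure \<Omega>" "y \<in> closure \<Omega>" using elem_closure by blast+
      have "dist (u j y) (v y) < e / 2" using elim(1) cl by blast
      moreover have "norm (v y - v x) \<le> e / 2" using elim(2) * cl elem_dist[OF *(1) cl(2,1)] by blast
      ultimately show "\<bar>u j y - v x\<bar> \<le> e" unfolding dist_real_def real_norm_def by linarith
    qed
  qed
qed

text \<open>Mass lumping is consistent under uniform convergence: within an element a vertex product
  differs from \<open>v * w\<close> by the uniform error plus one oscillation of the continuous
  limit.\<close>

lemma lumped_conv:
  fixes a b :: "nat \<Rightarrow> real ^ 'n \<Rightarrow> real"
  assumes v: "continuous_on (closure \<Omega>) v" "continuous_on (closure \<Omega>) w"
    and lim: "uniform_limit (closure \<Omega>) a v sequentially" "uniform_limit (closure \<Omega>) b w sequentially"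
  shows "(\<lambda>j. lumped_inner (\<T> j) (a j) (b j)) \<longlonglongrightarrow> L2_inner \<Omega> v w"
proof (rule tendstoI)
  fix e :: real assume e: "0 < e"
  have vw: "continuous_on (closure \<Omega>) (\<lambda>x. v x * w x)" by (intro continuous_intros v)
  have "bounded (v ` closure \<Omega>)" "bounded (w ` closure \<Omega>)"
    using v compact_closure_dom by (auto intro!: compact_imp_bounded compact_continuous_image)
  then have ul: "uniform_limit (closure \<Omega>) (\<lambda>j x. a j x * b j x) (\<lambda>x. v x * w x) sequentially"
    using lim by (intro uniform_lim_mult)
  define c where "c = e / (2 * (measure lebesgue \<Omega> + 1))"
  have m0: "0 \<le> measure lebesgue \<Omega>" by simp
  have c: "0 < c" using e m0 by (auto simp: c_def intro!: divide_pos_pos mult_pos_pos add_nonneg_pos)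
  then have c2: "0 < c / 2" by simp
  from uniform_limitD[OF ul c2] uniform_oscillation[OF vw c2]
  show "\<forall>\<^sub>F j in sequentially. dist (lumped_inner (\<T> j) (a j) (b j)) (L2_inner \<Omega> v w) < e"
  proof eventually_elim
    case (elim j)
    interpret convex_mesh \<Omega> "\<T> j" by (rule mesh_at)
    have "\<bar>lumped_inner (\<T> j) (a j) (b j) - (\<integral>x. v x * w x \<partial>lebesgue_on \<Omega>)\<bar> \<le> c * measure lebesgue \<Omega>"
    proof (rule lumped_near)
      fix \<sigma> p x assume *: "\<sigma> \<in> \<T> j" "p \<in> mesh_vertices \<sigma>" "x \<in> \<sigma>"
      then have cl: "x \<in> closure \<sigma>" "p \<in> closure \<sigma>" using elem_closure vertices_subset by blast+
      then have cl': "x \<in> closure \<Omega>" "p \<in> closure \<Omega>" using elem_closure *(1) by blast+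
      have "dist (a j p * b j p) (v p * w p) < c / 2" using elim(1) cl' by blast
      moreover have "norm (v p * w p - v x * w x) \<le> c / 2" using elim(2) * cl' elem_dist[OF *(1) cl(2,1)] by blast
      ultimately show "\<bar>a j p * b j p - v x * w x\<bar> \<le> c" unfolding dist_real_def real_norm_def by linarith
    qed (use c continuous_integrable[OF vw] in auto)
    also have "c * measure lebesgue \<Omega> < e"
    proof -
      have "c * (measure lebesgue \<Omega> + 1) = e / 2"
      proof -
        have "a \<noteq> 0 \<Longrightarrow> e / (2 * a) * a = e / 2" for a by simp
        from this[of "measure lebesgue \<Omega> + 1"] show ?thesis using m0 unfolding c_def by linarith
      qed
      then show ?thesis using c e by (simp add: distrib_left)
    qed
    finally show ?case by (simp add: dist_real_def L2_inner_def)
  qed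
qed

text \<open>This form of the bound \<open>|\<nabla>w| \<le> M\<close> survives uniform convergence and needs no pointwise
  gradient of the limit \<open>w\<close>.\<close>

lemma segment_bound_limit:
  fixes u :: "nat \<Rightarrow> real ^ 'n \<Rightarrow> real"
  assumes u: "\<And>j. u j \<in> U_h \<Omega> (\<T> j)" and lim: "uniform_limit (closure \<Omega>) u w sequentially"
    and M: "continuous_on (closure \<Omega>) M"
    and grad_le: "\<And>e. 0 < e \<Longrightarrow> \<forall>\<^sub>F j in sequentially. \<forall>\<sigma>\<in>\<T> j. \<forall>x\<in>\<sigma>. norm (grad (u j) x) \<le> M x + e"
    and xy: "x \<in> closure \<Omega>" "y \<in> closure \<Omega>" and B: "0 \<le> B" "\<And>z. z \<in> closed_segment x y \<Longrightarrow> M z \<le> B"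
  shows "\<bar>w x - w y\<bar> \<le> B * norm (x - y)"
proof -
  have step: "\<bar>w x - w y\<bar> \<le> (B + e) * norm (x - y)" if e: "0 < e" for e
  proof -
    have e2: "0 < e / 2" using e by simp
    have seg: "closed_segment x y \<subseteq> closure \<Omega>" using xy convex_closure_dom by (rule closed_segment_subset)
    have "\<forall>\<^sub>F j in sequentially. \<bar>u j x - u j y\<bar> \<le> (B + e) * norm (x - y)"
      using grad_le[OF e2] uniform_oscillation[OF M e2]
    proof eventually_elim
      case (elim j)
      interpret convex_mesh \<Omega> "\<T> j" by (rule mesh_at)
      show ?case
      proof (rule U_h_segment_bound[OF u xy])
        \<comment> \<open>Such an element contains a point \<open>p\<close> of the segment within
          one diameter of \<open>z\<close>, so \<open>M z\<close> exceeds \<open>B\<close> by at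
          most \<open>e / 2\<close>; the other half of \<open>e\<close> is the slack in
          \<open>grad_le\<close>.\<close>
        fix \<sigma> z assume *: "\<sigma> \<in> \<T> j" "closure \<sigma> \<inter> closed_segment x y \<noteq> {}" "z \<in> \<sigma>"
        then obtain p where p: "p \<in> closure \<sigma>" "p \<in> closed_segment x y" by auto
        have z: "z \<in> closure \<sigma>" using * elem_closure by blast
        have "norm (grad (u j) z) \<le> M z + e / 2" using elim(1) * by blast
        moreover have "norm (M z - M p) \<le> e / 2"
          using elim(2) *(1) elem_dist[OF *(1) z p(1)] elem_closure(2)[OF *(1)] z p by blast
        moreover have "M p \<le> B" using B(2) p by blast
        ultimately show "norm (grad (u j) z) \<le> B + e" unfolding real_norm_def by linarith
      qed (use B e in auto)
    qed
    moreover have "(\<lambda>j. \<bar>u j x - u j y\<bar>) \<longlonglongrightarrow> \<bar>w x - w y\<bar>"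
      using tendsto_uniform_limitI[OF lim] xy by (intro tendsto_intros) auto
    ultimately show ?thesis by (intro tendsto_upperbound) auto
  qed
  have "\<bar>w x - w y\<bar> \<le> B * norm (x - y) + e" if e: "0 < e" for e
  proof -
    have n: "0 < norm (x - y) + 1" by (simp add: add_nonneg_pos)
    have "\<bar>w x - w y\<bar> \<le> (B + e / (norm (x - y) + 1)) * norm (x - y)" using e n by (intro step) simp
    also have "\<dots> = B * norm (x - y) + e * (norm (x - y) / (norm (x - y) + 1))" by (simp add: algebra_simps)
    also have "\<dots> \<le> B * norm (x - y) + e * 1" using e n by (intro add_left_mono mult_left_mono) auto
    finally show ?thesis by simp
  qed
  then show ?thesis by (rule field_le_epsilon)
qed

text \<open>Integration by parts moves the gradient to the test function, and uniform convergence of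
  \<open>u\<close> determines the limit. Hence the whole sequence of gradients converges
  weakly-star, and uniqueness identifies the limit with \<open>weak_grad \<Omega> w\<close>.\<close>

lemma grad_weak_star:
  fixes u :: "nat \<Rightarrow> real ^ 'n \<Rightarrow> real"
  assumes u: "\<And>j. u j \<in> U_h \<Omega> (\<T> j)" and lim: "uniform_limit (closure \<Omega>) u w sequentially"
    and w: "continuous_on (closure \<Omega>) w"
    and C: "0 \<le> C" "\<And>j \<sigma> x. \<sigma> \<in> \<T> j \<Longrightarrow> x \<in> \<sigma> \<Longrightarrow> norm (grad (u j) x) \<le> C"
  shows "w \<in> W1inf \<Omega>" "weak_star_Linf \<Omega> (\<lambda>j. grad (u j)) (weak_grad \<Omega> w)"
proof -
  let ?M = "lebesgue_on \<Omega>"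
  interpret finite_measure ?M by (rule finite_measure_dom)
  have uc: "continuous_on (closure \<Omega>) (u j)" for j using convex_mesh.U_h_continuous[OF mesh_at u] .
  have um[measurable]: "grad (u j) \<in> borel_measurable ?M" for j
    using convex_mesh.U_h_grad_Linf(1)[OF mesh_at u] .
  have uL: "grad (u j) \<in> Linf_space \<Omega>" and uw: "has_weak_grad \<Omega> (u j) (grad (u j))" for j
    using convex_mesh.U_h_grad_Linf[OF mesh_at u] by auto
  have AEC: "AE x in ?M. norm (grad (u j) x) \<le> C" for j
    using convex_mesh.AE_mesh[OF mesh_at, of j] by eventually_elim (use C in auto)
  have AEi: "AE x in ?M. \<bar>grad (u j) x $ i\<bar> \<le> C" for i j
    using AEC[of j] by eventually_elim (use component_le_norm_cart order_trans in blast)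
  have comp_m[measurable]: "(\<lambda>x. grad (u j) x $ i) \<in> borel_measurable ?M" for i j
    using um[of j] by (rule measurable_compose) (auto intro!: borel_measurable_continuous_onI continuous_intros)
  have conv: "(\<lambda>j. \<integral>x. \<phi> x * grad (u j) x $ i \<partial>?M) \<longlonglongrightarrow> - (\<integral>x. grad \<phi> x $ i * w x \<partial>?M)"
    if \<phi>: "\<phi> \<in> C1_compact \<Omega>" for \<phi> i
  proof -
    obtain P where P: "\<And>x. \<bar>\<phi> x\<bar> \<le> P" using C1_compact_integrable(3)[OF \<phi> lmeasurable_dom] by auto
    note \<phi>m[measurable] = C1_compact_integrable(2)[OF \<phi> lmeasurable_dom]
    have g\<phi>c: "continuous_on S (grad \<phi>)" for S
      using \<phi> by (auto simp: C1_compact_def intro: continuous_on_subset)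
    have g\<phi>i: "integrable ?M (\<lambda>x. grad \<phi> x $ i)"
      by (rule continuous_integrable) (intro continuous_intros g\<phi>c)
    have i1: "integrable ?M (\<lambda>x. \<phi> x *\<^sub>R grad (u j) x)" for j
    proof (rule integrable_const_bound[of _ "P * C"])
      show "AE x in ?M. norm (\<phi> x *\<^sub>R grad (u j) x) \<le> P * C"
        using AEC[of j] by eventually_elim (use P in \<open>auto intro!: mult_mono order_trans[OF abs_ge_zero P]\<close>)
    qed measurable
    have i2: "integrable ?M (\<lambda>x. u j x *\<^sub>R grad \<phi> x)" for j
    proof -
      obtain B where B: "\<And>x. x \<in> closure \<Omega> \<Longrightarrow> norm (u j x *\<^sub>R grad \<phi> x) \<le> B"
        using continuous_bounded[OF continuous_on_scaleR[OF uc g\<phi>c]] by blast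
      show ?thesis
        by (rule integrable_const_bound[of _ B])
          (use B dom_subset_closure in \<open>auto intro!: AE_I2 continuous_closure_measurable continuous_on_scaleR uc g\<phi>c\<close>)
    qed
    have "(\<integral>x. \<phi> x * grad (u j) x $ i \<partial>?M) = - (\<integral>x. grad \<phi> x $ i * u j x \<partial>?M)" for j
    proof -
      have "(\<integral>x. u j x *\<^sub>R grad \<phi> x \<partial>?M) $ i = - (\<integral>x. \<phi> x *\<^sub>R grad (u j) x \<partial>?M) $ i"
        using uw[of j] \<phi> by (auto simp: has_weak_grad_def)
      then show ?thesis
        using integral_bounded_linear[OF bounded_linear_vec_nth[of i] i1, of j]
          integral_bounded_linear[OF bounded_linear_vec_nth[of i] i2, of j]
        by (simp add: mult.commute)
    qed
    then show ?thesis
      using tendsto_minus[OF tendsto_integral_uniform_limit[OF g\<phi>i uc w lim]] by simp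
  qed
  have "\<exists>g. g \<in> borel_measurable ?M \<and> (\<forall>x. \<bar>g x\<bar> \<le> C) \<and> (\<forall>\<psi>. integrable ?M \<psi> \<longrightarrow>
      (\<lambda>j. \<integral>x. \<psi> x * grad (u j) x $ i \<partial>?M) \<longlonglongrightarrow> (\<integral>x. \<psi> x * g x \<partial>?M))" for i
  proof -
    have "convergent (\<lambda>j. \<integral>x. \<phi> x * grad (u j) x $ i \<partial>?M)" if "\<phi> \<in> C1_compact \<Omega>" for \<phi>
      using conv[OF that] by (rule convergentI)
    note * = bounded_weak_limit[of \<Omega> C "\<lambda>j x. grad (u j) x $ i", OF open_dom bounded_dom C(1) comp_m AEi this]
    show ?thesis
    proof (rule *)
      fix g assume "g \<in> borel_measurable ?M" "\<And>x. \<bar>g x\<bar> \<le> C" "\<And>\<psi>. integrable ?M \<psi> \<Longrightarrow>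
        (\<lambda>j. \<integral>x. \<psi> x * grad (u j) x $ i \<partial>?M) \<longlonglongrightarrow> (\<integral>x. \<psi> x * g x \<partial>?M)"
      then show "\<exists>g. g \<in> borel_measurable ?M \<and> (\<forall>x. \<bar>g x\<bar> \<le> C) \<and> (\<forall>\<psi>. integrable ?M \<psi> \<longrightarrow>
        (\<lambda>j. \<integral>x. \<psi> x * grad (u j) x $ i \<partial>?M) \<longlonglongrightarrow> (\<integral>x. \<psi> x * g x \<partial>?M))"
        by (intro exI[of _ g] conjI allI impI)
    qed
  qed
  then have "\<exists>G. \<forall>i. G i \<in> borel_measurable ?M \<and> (\<forall>x. \<bar>G i x\<bar> \<le> C) \<and> (\<forall>\<psi>. integrable ?M \<psi> \<longrightarrow>
      (\<lambda>j. \<integral>x. \<psi> x * grad (u j) x $ i \<partial>?M) \<longlonglongrightarrow> (\<integral>x. \<psi> x * G i x \<partial>?M))"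
    by (intro choice allI)
  then obtain G where G: "\<And>i. G i \<in> borel_measurable ?M" "\<And>i x. \<bar>G i x\<bar> \<le> C"
    "\<And>i \<psi>. integrable ?M \<psi> \<Longrightarrow> (\<lambda>j. \<integral>x. \<psi> x * grad (u j) x $ i \<partial>?M) \<longlonglongrightarrow> (\<integral>x. \<psi> x * G i x \<partial>?M)"
    by auto
  define g where "g x = (\<chi> i. G i x)" for x
  have gm: "g \<in> borel_measurable ?M" using G(1) by (intro measurable_vec) (simp add: g_def)
  \<comment> \<open>The limit was obtained component by component, which costs the dimension as a
    factor; membership in \<open>Linf_space\<close> tolerates it.\<close>
  have gn: "norm (g x) \<le> real CARD('n) * C" for x
    using norm_le_l1_cart[of "g x"] sum_bounded_above[of UNIV "\<lambda>i. \<bar>g x $ i\<bar>" C] G(2)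
    by (simp add: g_def)
  have gL: "g \<in> Linf_space \<Omega>" using gm gn by (intro Linf_spaceI) auto
  have gw: "has_weak_grad \<Omega> w g"
    unfolding has_weak_grad_def
  proof
    fix \<phi> assume \<phi>: "\<phi> \<in> C1_compact \<Omega>"
    obtain P where P: "\<And>x. \<bar>\<phi> x\<bar> \<le> P" using C1_compact_integrable(3)[OF \<phi> lmeasurable_dom] by auto
    note \<phi>m[measurable] = C1_compact_integrable(2)[OF \<phi> lmeasurable_dom]
    have g\<phi>c: "continuous_on S (grad \<phi>)" for S
      using \<phi> by (auto simp: C1_compact_def intro: continuous_on_subset)
    note gm[measurable]
    have i1: "integrable ?M (\<lambda>x. \<phi> x *\<^sub>R g x)"
      by (rule integrable_const_bound[of _ "P * (real CARD('n) * C)"])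
       (use P gn in \<open>auto intro!: AE_I2 mult_mono order_trans[OF abs_ge_zero P]\<close>)
    have i2: "integrable ?M (\<lambda>x. w x *\<^sub>R grad \<phi> x)"
    proof -
      obtain B where B: "\<And>x. x \<in> closure \<Omega> \<Longrightarrow> norm (w x *\<^sub>R grad \<phi> x) \<le> B"
        using continuous_bounded[OF continuous_on_scaleR[OF w g\<phi>c]] by blast
      show ?thesis
        by (rule integrable_const_bound[of _ B])
          (use B dom_subset_closure in \<open>auto intro!: AE_I2 continuous_closure_measurable continuous_on_scaleR w g\<phi>c\<close>)
    qed
    have "(\<integral>x. w x *\<^sub>R grad \<phi> x \<partial>?M) $ i = - (\<integral>x. \<phi> x *\<^sub>R g x \<partial>?M) $ i" for i
    proof -
      have "(\<integral>x. \<phi> x * G i x \<partial>?M) = - (\<integral>x. grad \<phi> x $ i * w x \<partial>?M)"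
        using G(3)[OF C1_compact_integrable(1)[OF \<phi> lmeasurable_dom]] conv[OF \<phi>] by (rule LIMSEQ_unique)
      then show ?thesis
        using integral_bounded_linear[OF bounded_linear_vec_nth[of i] i1]
          integral_bounded_linear[OF bounded_linear_vec_nth[of i] i2]
        by (simp add: mult.commute g_def)
    qed
    then show "(\<integral>x. w x *\<^sub>R grad \<phi> x \<partial>?M) = - (\<integral>x. \<phi> x *\<^sub>R g x \<partial>?M)"
      by (simp add: vec_eq_iff)
  qed
  obtain Cw where "\<And>x. x \<in> closure \<Omega> \<Longrightarrow> norm (w x) \<le> Cw" using continuous_bounded[OF w] by blast
  then have "w \<in> Linf_space \<Omega>"
    using continuous_closure_measurable[OF w] dom_subset_closure by (intro Linf_spaceI[of _ _ Cw]) auto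
  then show "w \<in> W1inf \<Omega>" using gL gw by (auto simp: W1inf_def)
  note wg = weak_grad_AE_eq[OF open_dom bounded_dom gL gw]
  have "(\<lambda>j. L2_inner \<Omega> (grad (u j)) \<psi>) \<longlonglongrightarrow> L2_inner \<Omega> (weak_grad \<Omega> w) \<psi>" if "\<psi> \<in> L1_space \<Omega>" for \<psi>
  proof -
    have \<psi>: "integrable ?M \<psi>" using that by (simp add: L1_space_def)
    then have \<psi>i: "integrable ?M (\<lambda>x. \<psi> x $ i)" for i by (rule integrable_bounded_linear[OF bounded_linear_vec_nth])
    have pi: "integrable ?M (\<lambda>x. \<psi> x $ i * f x)" if "AE x in ?M. \<bar>f x\<bar> \<le> C" "f \<in> borel_measurable ?M" for f :: "_ \<Rightarrow> real" and i
    proof (rule Bochner_Integration.integrable_bound[of _ "\<lambda>x. C * \<psi> x $ i"])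
      show "AE x in ?M. norm (\<psi> x $ i * f x) \<le> norm (C * \<psi> x $ i)"
        using that(1) by eventually_elim (use C(1) in \<open>auto simp: abs_mult mult.commute[of C] intro!: mult_left_mono\<close>)
    qed (use \<psi>i that in auto)
    have "L2_inner \<Omega> (grad (u j)) \<psi> = (\<Sum>i\<in>UNIV. \<integral>x. \<psi> x $ i * grad (u j) x $ i \<partial>?M)" for j
      unfolding L2_inner_def inner_vec_def using pi[OF AEi comp_m]
      by (subst Bochner_Integration.integral_sum[symmetric]) (auto simp: mult.commute)
    moreover have "L2_inner \<Omega> (weak_grad \<Omega> w) \<psi> = (\<Sum>i\<in>UNIV. \<integral>x. \<psi> x $ i * G i x \<partial>?M)"
    proof -
      have [measurable]: "weak_grad \<Omega> w \<in> borel_measurable ?M" "\<psi> \<in> borel_measurable ?M"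
        using wg(1) \<psi> by (auto simp: Linf_space_def)
      have "L2_inner \<Omega> (weak_grad \<Omega> w) \<psi> = L2_inner \<Omega> g \<psi>"
        unfolding L2_inner_def using gm
        by (intro integral_cong_AE) (use wg(2) in auto)
      also have "\<dots> = (\<Sum>i\<in>UNIV. \<integral>x. \<psi> x $ i * G i x \<partial>?M)"
        unfolding L2_inner_def inner_vec_def g_def using pi[of "G _"] G(1,2)
        by (subst Bochner_Integration.integral_sum[symmetric]) (auto simp: mult.commute)
      finally show ?thesis .
    qed
    ultimately show ?thesis using G(3)[OF \<psi>i] by (simp add: tendsto_sum)
  qed
  then show "weak_star_Linf \<Omega> (\<lambda>j. grad (u j)) (weak_grad \<Omega> w)"
    using uL wg(1) by (simp add: weak_star_Linf_def)
qed

end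

section \<open>Smooth approximation and total variation\<close>

text \<open>The difference quotients in the direction of \<open>D\<close> itself tend to
  \<open>D \<bullet> D\<close> and are at most \<open>B * norm D\<close>.\<close>

lemma norm_gradient_le_local_Lipschitz:
  assumes D: "GDERIV m x :> D" and "0 < \<rho>" "0 \<le> B"
    and le: "\<And>y. norm (y - x) < \<rho> \<Longrightarrow> \<bar>m y - m x\<bar> \<le> B * norm (y - x)"
  shows "norm D \<le> B"
proof -
  define h where "h k = inverse (real (Suc k))" for k
  have h: "h \<longlonglongrightarrow> 0" "\<And>k. h k \<noteq> 0" "\<And>k. 0 < h k"
    unfolding h_def by (rule LIMSEQ_inverse_real_of_nat, simp_all)
  have lim: "(\<lambda>k. (m (x + h k *\<^sub>R D) - m x) / h k) \<longlonglongrightarrow> D \<bullet> D"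
    by (rule GDERIV_directional[OF D h(1,2)])
  have "(\<lambda>k. h k * norm D) \<longlonglongrightarrow> 0 * norm D" by (intro tendsto_mult_right h)
  then have "\<forall>\<^sub>F k in sequentially. h k * norm D < \<rho>" using \<open>0 < \<rho>\<close> by (intro order_tendstoD(2)) auto
  then have "\<forall>\<^sub>F k in sequentially. (m (x + h k *\<^sub>R D) - m x) / h k \<le> B * norm D"
  proof eventually_elim
    case (elim k)
    have "norm (x + h k *\<^sub>R D - x) = h k * norm D" using h(3)[of k] by simp
    then show ?case using le[of "x + h k *\<^sub>R D"] elim h(3)[of k] by (simp add: field_simps)
  qed
  then have "D \<bullet> D \<le> B * norm D" using tendsto_upperbound[OF lim] by simp
  then have "norm D * norm D \<le> B * norm D" by (simp add: dot_square_norm power2_eq_square)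
  then show ?thesis using \<open>0 \<le> B\<close> by (cases "D = 0") auto
qed

context convex_domain
begin

lemma frontier_closure_dom: "frontier (closure \<Omega>) = frontier \<Omega>"
  by (simp add: frontier_def interior_closure_dom interior_open[OF open_dom])

text \<open>A segment that leaves the closure crosses the frontier, where \<open>w\<close> vanishes,
  so its part up to the crossing accounts for the whole increment. \<open>N\<close> stands for an
  extension of \<open>M\<close>, which gives the bound a meaning on the outer part of the
  segment.\<close>

lemma zero_extension_segment_bound:
  assumes zero: "\<And>x. x \<in> frontier \<Omega> \<Longrightarrow> w x = (0::real)"
    and loc: "\<And>x y B. x \<in> closure \<Omega> \<Longrightarrow> y \<in> closure \<Omega> \<Longrightarrow> 0 \<le> B \<Longrightarrow>
      (\<And>z. z \<in> closed_segment x y \<Longrightarrow> M z \<le> B) \<Longrightarrow> \<bar>w x - w y\<bar> \<le> B * norm (x - y)"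
    and N: "\<And>x. x \<in> closure \<Omega> \<Longrightarrow> N x = M x"
    and B: "0 \<le> B" "\<And>z. z \<in> closed_segment x y \<Longrightarrow> N z \<le> B"
  defines "w' \<equiv> \<lambda>x. if x \<in> closure \<Omega> then w x else 0"
  shows "\<bar>w' x - w' y\<bar> \<le> B * norm (x - y)"
proof -
  have both: "\<bar>w x - w y\<bar> \<le> B * norm (x - y)"
    if "x \<in> closure \<Omega>" "y \<in> closure \<Omega>" "\<And>z. z \<in> closed_segment x y \<Longrightarrow> N z \<le> B" for x y
  proof (rule loc[OF that(1,2) B(1)])
    fix z assume z: "z \<in> closed_segment x y"
    then have "z \<in> closure \<Omega>" using closed_segment_subset[OF that(1,2) convex_closure_dom] by blast
    then show "M z \<le> B" using that(3)[OF z] N by simp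
  qed
  have one: "\<bar>w x\<bar> \<le> B * norm (x - y)"
    if xy: "x \<in> closure \<Omega>" "y \<notin> closure \<Omega>" "\<And>z. z \<in> closed_segment x y \<Longrightarrow> N z \<le> B" for x y
  proof -
    have "closed_segment x y \<inter> frontier (closure \<Omega>) \<noteq> {}"
      using xy by (intro connected_Int_frontier) auto
    then obtain z where z: "z \<in> closed_segment x y" "z \<in> frontier \<Omega>" using frontier_closure_dom by auto
    have sub: "closed_segment x z \<subseteq> closed_segment x y"
      using z(1) by (simp add: subset_closed_segment)
    have "z \<in> closure \<Omega>" using z(2) by (simp add: frontier_def)
    then have "\<bar>w x - w z\<bar> \<le> B * norm (x - z)" using xy sub by (intro both) auto
    also have "\<dots> \<le> B * norm (x - y)"
      using segment_bound(1)[OF z(1)] B(1) by (intro mult_left_mono) (auto simp: norm_minus_commute)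
    finally show ?thesis using zero[OF z(2)] by simp
  qed
  show ?thesis
    using both[of x y] one[of x y] one[of y x] B by (auto simp: w'_def closed_segment_commute norm_minus_commute)
qed

text \<open>Shrinking the graph towards an interior point by the factor \<open>1 / s\<close> moves
  the support into \<open>\<Omega>\<close> and leaves room for mollification. It multiplies
  increments by \<open>s\<close>, at most \<open>1 + e\<close>, and evaluates \<open>M\<close> at
  points displaced by less than a modulus of continuity, at a cost of at most
  \<open>e\<close>.\<close>

lemma C1_compact_approx:
  fixes w M :: "real ^ 'n \<Rightarrow> real"
  assumes zero: "\<And>x. x \<in> frontier \<Omega> \<Longrightarrow> w x = 0"
    and M: "continuous_on (closure \<Omega>) M" "\<And>x. x \<in> closure \<Omega> \<Longrightarrow> 0 \<le> M x"
    and loc: "\<And>x y B. x \<in> closure \<Omega> \<Longrightarrow> y \<in> closure \<Omega> \<Longrightarrow> 0 \<le> B \<Longrightarrow>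
      (\<And>z. z \<in> closed_segment x y \<Longrightarrow> M z \<le> B) \<Longrightarrow> \<bar>w x - w y\<bar> \<le> B * norm (x - y)"
    and e: "0 < e"
  obtains \<phi> where "\<phi> \<in> C1_compact \<Omega>" "\<And>x. x \<in> closure \<Omega> \<Longrightarrow> \<bar>\<phi> x - w x\<bar> \<le> e"
    "\<And>x. x \<in> closure \<Omega> \<Longrightarrow> norm (grad \<phi> x) \<le> (1 + e) * (M x + e)"
proof -
  let ?K = "closure \<Omega>"
  have Kne: "?K \<noteq> {}" using dom_ne by simp
  \<comment> \<open>The projection onto a closed convex set is 1-Lipschitz, so \<open>N\<close>
    inherits the modulus of continuity of \<open>M\<close>.\<close>
  define N where "N x = M (closest_point ?K x)" for x
  have cp: "closest_point ?K x \<in> ?K" for x using Kne by (intro closest_point_in_set) auto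
  have NM: "N x = M x" if "x \<in> ?K" for x using that by (simp add: N_def closest_point_self)
  have N0: "0 \<le> N x" for x using M(2) cp by (simp add: N_def)
  have "uniformly_continuous_on ?K M"
    using compact_uniformly_continuous[OF M(1) compact_closure_dom] .
  then obtain \<delta>0 where \<delta>0: "0 < \<delta>0" "\<And>x y. x \<in> ?K \<Longrightarrow> y \<in> ?K \<Longrightarrow> dist y x < \<delta>0 \<Longrightarrow> dist (M y) (M x) < e"
    using e unfolding uniformly_continuous_on_def by metis
  have Nuc: "N y \<le> N x + e" if "norm (y - x) < \<delta>0" for x y
  proof -
    have "dist (closest_point ?K y) (closest_point ?K x) \<le> dist y x"
      using Kne convex_closure_dom by (intro closest_point_lipschitz) auto
    then have "dist (N y) (N x) < e" unfolding N_def using that by (intro \<delta>0(2) cp) (simp add: dist_norm)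
    then show ?thesis by (simp add: dist_real_def)
  qed
  have "bounded (M ` ?K)" using compact_closure_dom M(1) by (intro compact_imp_bounded compact_continuous_image)
  then obtain B0 where B0: "\<And>x. x \<in> ?K \<Longrightarrow> \<bar>M x\<bar> \<le> B0" unfolding bounded_iff by auto
  have B0N: "N x \<le> B0" for x using B0[OF cp[of x]] by (simp add: N_def)
  have B00: "0 \<le> B0" using N0[of 0] B0N[of 0] by linarith
  define w' where "w' x = (if x \<in> ?K then w x else 0)" for x
  have w'seg: "\<bar>w' x - w' y\<bar> \<le> B * norm (x - y)"
    if "0 \<le> B" "\<And>z. z \<in> closed_segment x y \<Longrightarrow> N z \<le> B" for x y B
    using zero_extension_segment_bound[OF zero loc NM that] unfolding w'_def .
  have w'lip: "\<bar>w' x - w' y\<bar> \<le> B0 * norm (x - y)" for x y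
    using B0N B00 by (intro w'seg)
  have w'cont: "continuous_on UNIV w'"
    using w'lip B00 by (intro lipschitz_on_continuous_on[of B0] lipschitz_onI) (auto simp: dist_norm)
  obtain x0 where x0: "x0 \<in> \<Omega>" using dom_ne by auto
  obtain R where R: "0 < R" "\<And>x. x \<in> ?K \<Longrightarrow> norm (x - x0) \<le> R"
  proof -
    have "bounded ((\<lambda>x. x - x0) ` ?K)"
      using compact_closure_dom by (intro compact_imp_bounded compact_continuous_image continuous_intros)
    then obtain b where "\<And>x. x \<in> ?K \<Longrightarrow> norm (x - x0) \<le> b" unfolding bounded_iff by auto
    then show ?thesis using that[of "max b 1"] by (simp add: le_max_iff_disj)
  qed
  \<comment> \<open>The shrinking and the mollification each displace a point by at most
    \<open>\<epsilon>'\<close>; with Lipschitz constant \<open>B0\<close> both together change the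
    value by at most \<open>e\<close>. Adding 1 covers \<open>B0 = 0\<close>.\<close>
  define \<epsilon>' where "\<epsilon>' = e / (2 * (B0 + 1))"
  have \<epsilon>': "0 < \<epsilon>'" using e B00 by (simp add: \<epsilon>'_def)
  \<comment> \<open>\<open>\<eta> * R\<close> is the largest displacement of the closure under the
    dilation \<open>p\<close>. The entries of the minimum bound the gradient factor by
    \<open>1 + e\<close>, keep \<open>s\<close> below 2, and limit the displacement for the
    variation of \<open>N\<close> and for the values of \<open>w\<close>.\<close>
  define \<eta> where "\<eta> = min (min e 1) (min (\<delta>0 / (4 * R)) (\<epsilon>' / R))"
  have \<eta>: "0 < \<eta>" "\<eta> \<le> e" "\<eta> \<le> 1" "\<eta> * R \<le> \<delta>0 / 4" "\<eta> * R \<le> \<epsilon>'"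
  proof -
    show "0 < \<eta>" "\<eta> \<le> e" "\<eta> \<le> 1" using e \<delta>0(1) R(1) \<epsilon>' by (auto simp: \<eta>_def)
    have "\<eta> \<le> \<delta>0 / (4 * R)" "\<eta> \<le> \<epsilon>' / R" by (auto simp: \<eta>_def)
    then show "\<eta> * R \<le> \<delta>0 / 4" "\<eta> * R \<le> \<epsilon>'" using R(1) by (auto simp: field_simps)
  qed
  define s where "s = 1 + \<eta>"
  have s: "1 < s" "s \<le> 2" "s \<le> 1 + e" using \<eta> by (auto simp: s_def)
  define p where "p x = x0 + s *\<^sub>R (x - x0)" for x
  have p_inv: "x0 + (1 / s) *\<^sub>R (p x - x0) = x" for x using s(1) by (simp add: p_def)
  define u where "u x = w' (p x)" for x
  have u_cont: "continuous_on UNIV u"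
    unfolding u_def p_def by (intro continuous_on_compose2[OF w'cont] continuous_intros) auto
  define S where "S = (\<lambda>y. x0 + (1 / s) *\<^sub>R (y - x0)) ` ?K"
  have S: "compact S" unfolding S_def
    by (intro compact_continuous_image continuous_intros compact_closure_dom)
  have u0: "u x = 0" if "x \<notin> S" for x
  proof -
    have "p x \<notin> ?K" using that p_inv[of x] by (force simp: S_def)
    then show ?thesis by (simp add: u_def w'_def)
  qed
  have "S \<subseteq> \<Omega>"
  proof
    fix x assume "x \<in> S"
    then obtain y where y: "y \<in> ?K" "x = x0 + (1 / s) *\<^sub>R (y - x0)" by (auto simp: S_def)
    have "y - (1 - 1 / s) *\<^sub>R (y - x0) \<in> interior \<Omega>"
      using s x0 open_dom y by (intro mem_interior_closure_convex_shrink convex_dom) (auto simp: interior_open)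
    moreover have "y - (1 - 1 / s) *\<^sub>R (y - x0) = x" by (simp add: y(2) algebra_simps)
    ultimately show "x \<in> \<Omega>" using open_dom by (simp add: interior_open)
  qed
  then obtain r where r: "0 < r" "(\<Union>x\<in>S. cball x r) \<subseteq> \<Omega>"
    using compact_subset_open_imp_cball_epsilon_subset[OF S open_dom] by auto
  \<comment> \<open>The radius \<open>r\<close> keeps the support in \<open>\<Omega>\<close>. With
    \<open>s \<le> 2\<close> a total displacement is at most
    \<open>\<delta>0 / 4 + 2 * (\<delta>0 / 8 + \<delta>0 / 8)\<close>, which is below
    \<open>\<delta>0\<close>.\<close>
  define \<delta> where "\<delta> = min r (min (\<delta>0 / 8) (\<epsilon>' / 2))"
  have \<delta>: "0 < \<delta>" "\<delta> \<le> r" "\<delta> \<le> \<delta>0 / 8" "\<delta> \<le> \<epsilon>' / 2" using r \<delta>0 \<epsilon>' by (auto simp: \<delta>_def)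
  obtain a b where ab: "S \<subseteq> cbox a b"
    using bounded_subset_cbox_symmetric[OF compact_imp_bounded[OF S]] by metis
  then have u_ab: "u x = 0" if "x \<notin> cbox a b" for x using that u0 by blast
  define m where "m = mollify \<delta> u"
  have mC: "m \<in> C1_compact \<Omega>" unfolding m_def
  proof (rule mollify_C1_compact[OF u_cont \<delta>(1) S u0])
    fix x z :: "real ^ 'n" assume "x \<in> S" "norm z \<le> \<delta>"
    then have "x + z \<in> cball x r" using \<delta> by (simp add: dist_norm)
    then show "x + z \<in> \<Omega>" using r(2) \<open>x \<in> S\<close> by blast
  qed
  \<comment> \<open>The displacement estimate that both the values and the gradient use:
    \<open>p\<close> moves \<open>x\<close> by at most \<open>\<eta> * R\<close> and magnifies every
    further offset by \<open>s\<close>.\<close>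
  have px: "norm (p (\<xi> - z) - x) \<le> \<eta> * R + s * (norm (\<xi> - x) + norm z)" if "x \<in> ?K" for x \<xi> z
  proof -
    have "p (\<xi> - z) - x = \<eta> *\<^sub>R (x - x0) + s *\<^sub>R ((\<xi> - x) - z)" by (simp add: p_def s_def algebra_simps)
    also have "norm \<dots> \<le> norm (\<eta> *\<^sub>R (x - x0)) + norm (s *\<^sub>R ((\<xi> - x) - z))" by (rule norm_triangle_ineq)
    also have "\<dots> \<le> \<eta> * R + s * (norm (\<xi> - x) + norm z)"
      using R(2)[OF that] \<eta>(1) s(1) norm_triangle_ineq4[of "\<xi> - x" z] by (intro add_mono) auto
    finally show ?thesis .
  qed
  have val: "\<bar>m x - w x\<bar> \<le> e" if x: "x \<in> ?K" for x
  proof -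
    have "w x - e \<le> m x \<and> m x \<le> w x + e"
      unfolding m_def
    proof (rule mollify_bounds[OF u_cont \<delta>(1) u_ab])
      fix z :: "real ^ 'n" assume z: "norm z \<le> \<delta>"
      have "\<bar>u (x - z) - w x\<bar> \<le> B0 * norm (p (x - z) - x)"
        using w'lip[of "p (x - z)" x] x by (simp add: u_def w'_def)
      also have "\<dots> \<le> B0 * (2 * \<epsilon>')"
      proof (intro mult_left_mono B00)
        have "s * norm z \<le> 2 * (\<epsilon>' / 2)" using z \<delta> s by (intro mult_mono) auto
        then show "norm (p (x - z) - x) \<le> 2 * \<epsilon>'" using px[OF x, of x z] \<eta>(5) by simp
      qed
      also have "\<dots> \<le> (B0 + 1) * (2 * \<epsilon>')" using \<epsilon>' by simp
      also have "\<dots> = e"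
      proof -
        have "a \<noteq> 0 \<Longrightarrow> a * (2 * (e / (2 * a))) = e" for a by simp
        from this[of "B0 + 1"] show ?thesis using B00 unfolding \<epsilon>'_def by linarith
      qed
      finally show "w x - e \<le> u (x - z) \<and> u (x - z) \<le> w x + e" by linarith
    qed
    then show ?thesis by linarith
  qed
  have grd: "norm (grad m x) \<le> (1 + e) * (M x + e)" if x: "x \<in> ?K" for x
  proof -
    let ?B = "s * (N x + e)"
    have B: "0 \<le> N x + e" using N0[of x] e by simp
    have D: "GDERIV m x :> grad m x" using C1_compactE[OF mC] by metis
    have "norm (grad m x) \<le> ?B"
    proof (rule norm_gradient_le_local_Lipschitz[OF D, of "\<delta>0 / 8"])
      fix y assume y: "norm (y - x) < \<delta>0 / 8"
      have diff: "\<bar>u (x - z) - u (y - z)\<bar> \<le> ?B * norm (y - x)" if z: "norm z \<le> \<delta>" for z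
      proof -
        have "\<bar>w' (p (x - z)) - w' (p (y - z))\<bar> \<le> (N x + e) * norm (p (x - z) - p (y - z))"
        proof (rule w'seg[OF B])
          fix \<zeta> assume "\<zeta> \<in> closed_segment (p (x - z)) (p (y - z))"
          then obtain l where l: "0 \<le> l" "l \<le> 1" "\<zeta> = (1 - l) *\<^sub>R p (x - z) + l *\<^sub>R p (y - z)"
            by (auto simp: in_segment)
          \<comment> \<open>\<open>p\<close> is affine, so a point between two images is the image
            of a point between the arguments.\<close>
          have \<zeta>: "\<zeta> = p ((x + l *\<^sub>R (y - x)) - z)" unfolding l(3) p_def by (simp add: algebra_simps)
          have "s * (norm (x + l *\<^sub>R (y - x) - x) + norm z) \<le> 2 * (\<delta>0 / 8 + \<delta>0 / 8)"
          proof (intro mult_mono add_mono)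
            have "l * norm (y - x) \<le> 1 * norm (y - x)" using l by (intro mult_right_mono) auto
            then show "norm (x + l *\<^sub>R (y - x) - x) \<le> \<delta>0 / 8" using y l by simp
          qed (use s z \<delta> in auto)
          then have "norm (\<zeta> - x) < \<delta>0"
            using order_trans[OF px[OF x, of "x + l *\<^sub>R (y - x)" z] add_mono[OF \<eta>(4)]] \<delta>0(1)
            unfolding \<zeta> by fastforce
          then show "N \<zeta> \<le> N x + e" by (rule Nuc)
        qed
        also have "norm (p (x - z) - p (y - z)) = s * norm (y - x)"
        proof -
          have "p (x - z) - p (y - z) = s *\<^sub>R (x - y)" by (simp add: p_def algebra_simps)
          then show ?thesis using s by (simp add: norm_minus_commute)
        qed
        finally show ?thesis by (simp add: u_def mult.commute mult.left_commute)
      qed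
      have "m x \<le> m y + ?B * norm (y - x)" "m y \<le> m x + ?B * norm (y - x)"
        unfolding m_def by (rule mollify_average[OF u_cont \<delta>(1) _ u_ab]; use diff in \<open>force simp: abs_le_iff\<close>)+
      then show "\<bar>m y - m x\<bar> \<le> ?B * norm (y - x)" by linarith
    qed (use \<delta>0 B s in auto)
    also have "\<dots> \<le> (1 + e) * (M x + e)" using s B NM[OF x] by (intro mult_mono) auto
    finally show ?thesis .
  qed
  show ?thesis by (rule that[OF mC val grd])
qed

end

section \<open>Radon measures as functionals and their total variation\<close>

lemma radon_measure_bound:
  fixes \<mu> :: "(real ^ 'n \<Rightarrow> real) \<Rightarrow> real"
  assumes "\<mu> \<in> radon_measures K"
  obtains C where "0 \<le> C" "\<And>\<eta> b. continuous_on K \<eta> \<Longrightarrow> K \<noteq> {} \<Longrightarrow> (\<And>x. x \<in> K \<Longrightarrow> \<bar>\<eta> x\<bar> \<le> b) \<Longrightarrow> \<bar>\<mu> \<eta>\<bar> \<le> C * b"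
proof -
  obtain C where C: "\<And>\<eta>. continuous_on K \<eta> \<Longrightarrow> \<bar>\<mu> \<eta>\<bar> \<le> C * (SUP x\<in>K. \<bar>\<eta> x\<bar>)"
    using assms by (auto simp: radon_measures_def)
  show ?thesis
  proof (rule that[of "\<bar>C\<bar>"])
    fix \<eta> :: "real ^ 'n \<Rightarrow> real" and b assume *: "continuous_on K \<eta>" "K \<noteq> {}" "\<And>x. x \<in> K \<Longrightarrow> \<bar>\<eta> x\<bar> \<le> b"
    have sup: "(SUP x\<in>K. \<bar>\<eta> x\<bar>) \<le> b" using * by (intro cSUP_least)
    obtain x where x: "x \<in> K" using * by auto
    have "0 \<le> \<bar>\<eta> x\<bar>" by simp
    also have "\<bar>\<eta> x\<bar> \<le> (SUP x\<in>K. \<bar>\<eta> x\<bar>)"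
      using * x by (intro cSUP_upper bdd_aboveI2) auto
    finally have "0 \<le> (SUP x\<in>K. \<bar>\<eta> x\<bar>)" .
    then have "C * (SUP x\<in>K. \<bar>\<eta> x\<bar>) \<le> \<bar>C\<bar> * b" using sup by (intro mult_mono) auto
    then show "\<bar>\<mu> \<eta>\<bar> \<le> \<bar>C\<bar> * b" using C[OF *(1)] by linarith
  qed auto
qed

lemma radon_measure_linear:
  assumes "\<mu> \<in> radon_measures K" "continuous_on K \<eta>"
  shows "continuous_on K \<zeta> \<Longrightarrow> \<mu> (\<lambda>x. \<eta> x + \<zeta> x) = \<mu> \<eta> + \<mu> \<zeta>" "\<mu> (\<lambda>x. c * \<eta> x) = c * \<mu> \<eta>"
    "continuous_on K \<zeta> \<Longrightarrow> \<mu> (\<lambda>x. \<eta> x - \<zeta> x) = \<mu> \<eta> - \<mu> \<zeta>"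
proof -
  show add: "continuous_on K \<zeta> \<Longrightarrow> \<mu> (\<lambda>x. \<eta> x + \<zeta> x) = \<mu> \<eta> + \<mu> \<zeta>" for \<zeta>
    using assms by (auto simp: radon_measures_def)
  have scale: "\<mu> (\<lambda>x. c * \<eta> x) = c * \<mu> \<eta>" if "continuous_on K \<eta>" for c \<eta>
    using assms(1) that by (auto simp: radon_measures_def)
  then show "\<mu> (\<lambda>x. c * \<eta> x) = c * \<mu> \<eta>" using assms(2) .
  show "\<mu> (\<lambda>x. \<eta> x - \<zeta> x) = \<mu> \<eta> - \<mu> \<zeta>" if "continuous_on K \<zeta>"
  proof -
    have "continuous_on K (\<lambda>x. - 1 * \<zeta> x)" using that by (intro continuous_intros)
    from add[OF this] scale[OF that, of "-1"] show ?thesis by simp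
  qed
qed

lemma pairing_bound:
  fixes v :: "('n::finite) vmeasure"
  assumes "v \<in> vector_radon_measures K" "K \<noteq> {}"
  obtains C where "0 \<le> C" "\<And>\<phi> b. continuous_on K \<phi> \<Longrightarrow> (\<And>x. x \<in> K \<Longrightarrow> norm (\<phi> x) \<le> b) \<Longrightarrow> \<bar>pairing v \<phi>\<bar> \<le> C * b"
proof -
  have "\<exists>C. 0 \<le> C \<and> (\<forall>\<eta> b. continuous_on K \<eta> \<longrightarrow> (\<forall>x\<in>K. \<bar>\<eta> x\<bar> \<le> b) \<longrightarrow> \<bar>(v $ i) \<eta>\<bar> \<le> C * b)" for i
  proof -
    have "v $ i \<in> radon_measures K" using assms(1) by (simp add: vector_radon_measures_def)
    then obtain C where "0 \<le> C" "\<And>\<eta> b. continuous_on K \<eta> \<Longrightarrow> K \<noteq> {} \<Longrightarrow>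
        (\<And>x. x \<in> K \<Longrightarrow> \<bar>\<eta> x\<bar> \<le> b) \<Longrightarrow> \<bar>(v $ i) \<eta>\<bar> \<le> C * b"
      using radon_measure_bound by blast
    then show ?thesis using assms(2) by (intro exI[of _ C]) simp
  qed
  then have "\<exists>C. \<forall>i. 0 \<le> C i \<and> (\<forall>\<eta> b. continuous_on K \<eta> \<longrightarrow> (\<forall>x\<in>K. \<bar>\<eta> x\<bar> \<le> b) \<longrightarrow> \<bar>(v $ i) \<eta>\<bar> \<le> C i * b)"
    by (intro choice allI)
  then obtain C where C: "\<And>i. 0 \<le> C i"
    "\<And>i \<eta> b. continuous_on K \<eta> \<Longrightarrow> (\<And>x. x \<in> K \<Longrightarrow> \<bar>\<eta> x\<bar> \<le> b) \<Longrightarrow> \<bar>(v $ i) \<eta>\<bar> \<le> C i * b"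
    by blast
  show ?thesis
  proof (rule that[of "\<Sum>i\<in>UNIV. C i"])
    show "0 \<le> (\<Sum>i\<in>UNIV. C i)" using C(1) by (intro sum_nonneg)
    fix \<phi> :: "real ^ 'n \<Rightarrow> real ^ 'n" and b assume *: "continuous_on K \<phi>" "\<And>x. x \<in> K \<Longrightarrow> norm (\<phi> x) \<le> b"
    have "\<bar>pairing v \<phi>\<bar> \<le> (\<Sum>i\<in>UNIV. \<bar>(v $ i) (\<lambda>x. \<phi> x $ i)\<bar>)" unfolding pairing_def by (rule sum_abs)
    also have "\<dots> \<le> (\<Sum>i\<in>UNIV. C i * b)"
      using * by (intro sum_mono C(2) continuous_intros) (auto intro: order_trans[OF component_le_norm_cart])
    finally show "\<bar>pairing v \<phi>\<bar> \<le> (\<Sum>i\<in>UNIV. C i) * b" by (simp add: sum_distrib_right)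
  qed
qed

lemma pairing_scale:
  assumes "v \<in> vector_radon_measures K" "continuous_on K \<phi>"
  shows "pairing v (\<lambda>x. c *\<^sub>R \<phi> x) = c * pairing v \<phi>"
proof -
  have "(v $ i) (\<lambda>x. c * \<phi> x $ i) = c * (v $ i) (\<lambda>x. \<phi> x $ i)" for i
    using assms by (intro radon_measure_linear[of _ K]) (auto simp: vector_radon_measures_def intro!: continuous_intros)
  then show ?thesis by (simp add: pairing_def sum_distrib_left)
qed

text \<open>For a nonnegative weight the second supremum ranges over fields that vanish on
  \<open>K\<close>; these have pairing 0, because the functionals are bounded by suprema over
  \<open>K\<close>.\<close>

lemma total_variation_nonneg_eq:
  assumes v: "v \<in> vector_radon_measures K" and K: "K \<noteq> {}" and M: "\<And>x. x \<in> K \<Longrightarrow> 0 \<le> M x"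
  shows "total_variation K v M = Sup {pairing v \<phi> |\<phi>. continuous_on K \<phi> \<and> (\<forall>x\<in>K. norm (\<phi> x) \<le> M x)}"
proof -
  have *: "{pairing v \<phi> |\<phi>. continuous_on K \<phi> \<and> (\<forall>x\<in>K. norm (\<phi> x) \<le> max (- M x) 0)} = {0}"
  proof -
    obtain C where C: "\<And>\<phi> b. continuous_on K \<phi> \<Longrightarrow> (\<And>x. x \<in> K \<Longrightarrow> norm (\<phi> x) \<le> b) \<Longrightarrow> \<bar>pairing v \<phi>\<bar> \<le> C * b"
      using pairing_bound[OF v K] by metis
    have z: "pairing v \<phi> = 0" if "continuous_on K \<phi>" "\<forall>x\<in>K. norm (\<phi> x) \<le> max (- M x) 0" for \<phi>
      using C[OF that(1), of 0] that(2) M by (auto simp: max_def split: if_splits)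
    have "0 \<in> {pairing v \<phi> |\<phi>. continuous_on K \<phi> \<and> (\<forall>x\<in>K. norm (\<phi> x) \<le> max (- M x) 0)}"
      using z[of "\<lambda>_. 0"] by (force intro!: exI[of _ "\<lambda>_. 0"])
    then have "{0} \<subseteq> {pairing v \<phi> |\<phi>. continuous_on K \<phi> \<and> (\<forall>x\<in>K. norm (\<phi> x) \<le> max (- M x) 0)}"
      by blast
    moreover have "{pairing v \<phi> |\<phi>. continuous_on K \<phi> \<and> (\<forall>x\<in>K. norm (\<phi> x) \<le> max (- M x) 0)} \<subseteq> {0}"
      using z by auto
    ultimately show ?thesis by (rule antisym[rotated])
  qed
  have "max (M x) 0 = M x" if "x \<in> K" for x using M[OF that] by simp
  then show ?thesis unfolding total_variation_def Let_def * by (simp cong: conj_cong)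
qed

lemma pairing_le_total_variation:
  assumes v: "v \<in> vector_radon_measures K" and K: "K \<noteq> {}" "compact K"
    and M: "\<And>x. x \<in> K \<Longrightarrow> 0 \<le> M x" "continuous_on K M"
    and \<phi>: "continuous_on K \<phi>" "\<And>x. x \<in> K \<Longrightarrow> norm (\<phi> x) \<le> M x"
  shows "pairing v \<phi> \<le> total_variation K v M"
proof -
  have eq: "total_variation K v M = Sup {pairing v \<phi> |\<phi>. continuous_on K \<phi> \<and> (\<forall>x\<in>K. norm (\<phi> x) \<le> M x)}"
    by (rule total_variation_nonneg_eq[OF v K(1)]) (rule M(1))
  show ?thesis
    unfolding eq
proof (rule cSup_upper)
  obtain C where C: "0 \<le> C" "\<And>\<phi> b. continuous_on K \<phi> \<Longrightarrow> (\<And>x. x \<in> K \<Longrightarrow> norm (\<phi> x) \<le> b) \<Longrightarrow> \<bar>pairing v \<phi>\<bar> \<le> C * b"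
    using pairing_bound[OF v K(1)] by metis
  have "bounded (M ` K)" using K M by (intro compact_imp_bounded compact_continuous_image)
  then obtain b where b: "\<And>x. x \<in> K \<Longrightarrow> \<bar>M x\<bar> \<le> b" unfolding bounded_iff by auto
  show "bdd_above {pairing v \<phi> |\<phi>. continuous_on K \<phi> \<and> (\<forall>x\<in>K. norm (\<phi> x) \<le> M x)}"
  proof (rule bdd_aboveI)
    fix y assume "y \<in> {pairing v \<phi> |\<phi>. continuous_on K \<phi> \<and> (\<forall>x\<in>K. norm (\<phi> x) \<le> M x)}"
    then obtain \<phi> where "y = pairing v \<phi>" "continuous_on K \<phi>" "\<And>x. x \<in> K \<Longrightarrow> norm (\<phi> x) \<le> M x" by auto
    then show "y \<le> C * b" using C(2)[of \<phi> b] b by (force intro: order_trans)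
  qed
  show "pairing v \<phi> \<in> {pairing v \<phi> |\<phi>. continuous_on K \<phi> \<and> (\<forall>x\<in>K. norm (\<phi> x) \<le> M x)}"
    using \<phi> by auto
qed
qed

lemma total_variation_le:
  assumes v: "v \<in> vector_radon_measures K" and K: "K \<noteq> {}"
    and M: "\<And>x. x \<in> K \<Longrightarrow> 0 \<le> M x"
    and le: "\<And>\<phi>. continuous_on K \<phi> \<Longrightarrow> (\<And>x. x \<in> K \<Longrightarrow> norm (\<phi> x) \<le> M x) \<Longrightarrow> pairing v \<phi> \<le> c"
  shows "total_variation K v M \<le> c"
proof -
  have eq: "total_variation K v M = Sup {pairing v \<phi> |\<phi>. continuous_on K \<phi> \<and> (\<forall>x\<in>K. norm (\<phi> x) \<le> M x)}"
    by (rule total_variation_nonneg_eq[OF v K]) (rule M)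
  show ?thesis
    unfolding eq
proof (rule cSup_least)
  have "pairing v (\<lambda>_. 0) \<in> {pairing v \<phi> |\<phi>. continuous_on K \<phi> \<and> (\<forall>x\<in>K. norm (\<phi> x) \<le> M x)}"
    using M by (auto intro!: exI[of _ "\<lambda>_. 0"])
  then show "{pairing v \<phi> |\<phi>. continuous_on K \<phi> \<and> (\<forall>x\<in>K. norm (\<phi> x) \<le> M x)} \<noteq> {}" by blast
qed (use le in auto)
qed

text \<open>Extraction one index at a time. The assumption \<open>sub\<close> guarantees that a
  later extraction preserves what earlier ones achieved.\<close>

lemma finite_common_subsequence:
  fixes P :: "'a \<Rightarrow> (nat \<Rightarrow> nat) \<Rightarrow> bool"
  assumes "finite I"
    and ex: "\<And>i (r :: nat \<Rightarrow> nat). i \<in> I \<Longrightarrow> strict_mono r \<Longrightarrow> \<exists>r'. strict_mono r' \<and> P i (r \<circ> r')"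
    and sub: "\<And>i (r :: nat \<Rightarrow> nat) r'. i \<in> I \<Longrightarrow> P i r \<Longrightarrow> strict_mono r' \<Longrightarrow> P i (r \<circ> r')"
  obtains r where "strict_mono r" "\<And>i. i \<in> I \<Longrightarrow> P i r"
proof -
  have "\<exists>r. strict_mono r \<and> (\<forall>i\<in>I. P i r)"
    using assms
  proof (induction I rule: finite_induct)
    case empty
    show ?case by (intro exI[of _ id]) (auto simp: strict_mono_def)
  next
    case (insert i I)
    then obtain r where r: "strict_mono r" "\<forall>i\<in>I. P i r" by blast
    obtain r' where r': "strict_mono r'" "P i (r \<circ> r')" using insert.prems(1)[of i r] r by blast
    have "\<forall>j\<in>insert i I. P j (r \<circ> r')" using r' r insert.prems(2) by blast
    then show ?case using r r' strict_mono_o by blast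
  qed
  then show ?thesis using that by blast
qed

text \<open>Tent functions of radius \<open>e\<close> around a finite net, divided by their sum,
  which is positive because every point lies in some ball of the net.\<close>

lemma partition_of_unity_compact:
  fixes K :: "'a::metric_space set"
  assumes "compact K" "0 < (e::real)"
  obtains F and \<psi> :: "'a \<Rightarrow> 'a \<Rightarrow> real" where "finite F" "F \<subseteq> K" "\<And>p. p \<in> F \<Longrightarrow> continuous_on K (\<psi> p)"
    "\<And>p x. x \<in> K \<Longrightarrow> 0 \<le> \<psi> p x" "\<And>x. x \<in> K \<Longrightarrow> (\<Sum>p\<in>F. \<psi> p x) = 1"
    "\<And>p x. x \<in> K \<Longrightarrow> \<psi> p x \<noteq> 0 \<Longrightarrow> dist p x < e"
proof -
  obtain F where F: "finite F" "F \<subseteq> K" "K \<subseteq> (\<Union>p\<in>F. ball p e)"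
    by (rule compactE_image[OF assms(1), of K "\<lambda>p. ball p e"]) (use assms(2) in auto)
  define t where "t p x = max 0 (e - dist p x)" for p x :: 'a
  define s where "s x = (\<Sum>p\<in>F. t p x)" for x
  have s: "0 < s x" if "x \<in> K" for x
  proof -
    have "x \<in> (\<Union>p\<in>F. ball p e)" using F(3) that by blast
    then obtain p where "p \<in> F" "dist p x < e" by auto
    then show ?thesis unfolding s_def using F(1) by (intro sum_pos2[of F p]) (auto simp: t_def)
  qed
  show ?thesis
  proof (rule that[of F "\<lambda>p x. t p x / s x", OF F(1,2)])
    show "continuous_on K (\<lambda>x. t p x / s x)" for p
      using s unfolding s_def t_def by (intro continuous_intros) (auto simp: less_imp_neq[symmetric])
    show "0 \<le> t p x / s x" if "x \<in> K" for p x using s[OF that] by (simp add: t_def)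
    show "(\<Sum>p\<in>F. t p x / s x) = 1" if "x \<in> K" for x
      using s[OF that] by (simp flip: sum_divide_distrib add: s_def)
    show "dist p x < e" if "t p x / s x \<noteq> 0" for p x
      using that by (auto simp: t_def max_def split: if_splits)
  qed
qed

section \<open>Measures with square integrable divergence\<close>

lemma L2_space_diff:
  assumes "u \<in> L2_space \<Omega>" "v \<in> L2_space \<Omega>"
  shows "(\<lambda>x. u x - v x) \<in> L2_space \<Omega>"
proof -
  have [measurable]: "u \<in> borel_measurable (lebesgue_on \<Omega>)" "v \<in> borel_measurable (lebesgue_on \<Omega>)"
    using assms by (auto simp: L2_space_def)
  have "integrable (lebesgue_on \<Omega>) (\<lambda>x. (u x - v x)\<^sup>2)"
  proof (rule Bochner_Integration.integrable_bound[of _ "\<lambda>x. 2 * (u x)\<^sup>2 + 2 * (v x)\<^sup>2"])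
    have "(a - b)\<^sup>2 \<le> 2 * a\<^sup>2 + 2 * b\<^sup>2" for a b :: real
      using zero_le_power2[of "a + b"] by (simp add: power2_eq_square algebra_simps)
    then show "AE x in lebesgue_on \<Omega>. norm ((u x - v x)\<^sup>2) \<le> norm (2 * (u x)\<^sup>2 + 2 * (v x)\<^sup>2)"
      by (intro AE_I2) auto
  qed (use assms in \<open>auto simp: L2_space_def\<close>)
  then show ?thesis by (auto simp: L2_space_def)
qed

lemma L2_space_mult_integrable:
  assumes "u \<in> L2_space \<Omega>" "v \<in> L2_space \<Omega>"
  shows "integrable (lebesgue_on \<Omega>) (\<lambda>x. u x * v x)"
proof -
  have [measurable]: "u \<in> borel_measurable (lebesgue_on \<Omega>)" "v \<in> borel_measurable (lebesgue_on \<Omega>)"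
    using assms by (auto simp: L2_space_def)
  show ?thesis
  proof (rule Bochner_Integration.integrable_bound[of _ "\<lambda>x. (u x)\<^sup>2 + (v x)\<^sup>2"])
    have "\<bar>a * b\<bar> \<le> a\<^sup>2 + b\<^sup>2" for a b :: real
    proof -
      have "2 * (\<bar>a\<bar> * \<bar>b\<bar>) \<le> a\<^sup>2 + b\<^sup>2"
        using sum_squares_bound[of "\<bar>a\<bar>" "\<bar>b\<bar>"] by (simp add: mult.assoc)
      moreover have "0 \<le> \<bar>a\<bar> * \<bar>b\<bar>" by simp
      ultimately show ?thesis unfolding abs_mult by linarith
    qed
    then show "AE x in lebesgue_on \<Omega>. norm (u x * v x) \<le> norm ((u x)\<^sup>2 + (v x)\<^sup>2)"
      by (intro AE_I2) auto
  qed (use assms in \<open>auto simp: L2_space_def\<close>)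
qed

text \<open>Cauchy--Schwarz against the constant 1: the mean square deviation from \<open>c\<close>
  is nonnegative, and \<open>c\<close> is taken to be the mean value \<open>?I / ?m\<close>.\<close>

lemma square_integral_le:
  fixes h :: "'a \<Rightarrow> real"
  assumes "finite_measure M" "h \<in> borel_measurable M" "integrable M (\<lambda>x. (h x)\<^sup>2)"
  shows "(\<integral>x. h x \<partial>M)\<^sup>2 \<le> measure M (space M) * (\<integral>x. (h x)\<^sup>2 \<partial>M)"
proof -
  interpret finite_measure M by fact
  let ?m = "measure M (space M)" and ?I = "\<integral>x. h x \<partial>M" and ?J = "\<integral>x. (h x)\<^sup>2 \<partial>M"
  have h: "integrable M h"
  proof (rule Bochner_Integration.integrable_bound[of _ "\<lambda>x. 1 + (h x)\<^sup>2"])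
    have "\<bar>a\<bar> \<le> 1 + a\<^sup>2" for a :: real
      using sum_squares_bound[of 1 "\<bar>a\<bar>"] by simp
    then show "AE x in M. norm (h x) \<le> norm (1 + (h x)\<^sup>2)" by (intro AE_I2) auto
  qed (use assms in auto)
  have q: "0 \<le> ?J - 2 * c * ?I + c\<^sup>2 * ?m" for c
  proof -
    have "0 \<le> (\<integral>x. (h x - c)\<^sup>2 \<partial>M)" by simp
    also have "(\<integral>x. (h x - c)\<^sup>2 \<partial>M) = (\<integral>x. (h x)\<^sup>2 - 2 * c * h x + c\<^sup>2 \<partial>M)"
      by (simp add: power2_eq_square algebra_simps)
    also have "\<dots> = ?J - 2 * c * ?I + c\<^sup>2 * ?m" using h assms by simp
    finally show ?thesis .
  qed
  show ?thesis
  proof (cases "?m = 0")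
    case True
    then have "emeasure M (space M) = 0" by (simp add: emeasure_eq_measure)
    then have "AE x in M. h x = 0" by (auto simp: eventually_ae_filter null_sets_def intro!: exI[of _ "space M"])
    then have "?I = 0" using assms(2) integral_cong_AE[of h M "\<lambda>_. 0"] by simp
    then show ?thesis using True by simp
  next
    case False
    then have m: "0 < ?m" by (simp add: zero_less_measure_iff measure_nonneg less_le)
    have "0 \<le> ?m * (?J - 2 * (?I / ?m) * ?I + (?I / ?m)\<^sup>2 * ?m)" using q[of "?I / ?m"] m by simp
    also have "\<dots> = ?m * ?J - ?I\<^sup>2" using m by (simp add: power2_eq_square field_simps)
    finally show ?thesis by simp
  qed
qed

context convex_domain
begin

lemma continuous_L2_space:
  assumes "continuous_on (closure \<Omega>) u" shows "u \<in> L2_space \<Omega>"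
  using continuous_closure_measurable[OF assms] continuous_integrable[of "\<lambda>x. (u x)\<^sup>2"] assms
  by (auto simp: L2_space_def intro!: continuous_intros)

lemma L2_space_integrable:
  assumes "u \<in> L2_space \<Omega>" shows "integrable (lebesgue_on \<Omega>) u"
  using L2_space_mult_integrable[OF assms continuous_L2_space[of "\<lambda>_. 1"]] by simp

text \<open>Cauchy--Schwarz in time bounds the square of the time integral by the length of the
  interval times the time integral of the square, and Fubini makes the latter integrable in
  space.\<close>

lemma time_mean_L2_space:
  assumes f: "f \<in> L2_time_space T \<Omega>" and ab: "0 \<le> a" "b \<le> T"
  shows "(\<lambda>x. (\<integral>s. f s x \<partial>lebesgue_on {a<..<b}) / c) \<in> L2_space \<Omega>"
proof -
  let ?A = "lebesgue_on {0<..<T}" and ?B = "lebesgue_on \<Omega>"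
  interpret A: finite_measure ?A by (rule finite_measure_lebesgue_on) (simp add: lmeasurable_open)
  interpret B: finite_measure ?B by (rule finite_measure_dom)
  interpret AB: pair_sigma_finite ?A ?B by unfold_locales
  have fm[measurable]: "(\<lambda>(t, x). f t x) \<in> borel_measurable (?A \<Otimes>\<^sub>M ?B)"
    and f2: "integrable (?A \<Otimes>\<^sub>M ?B) (\<lambda>(t, x). (f t x)\<^sup>2)"
    using f by (auto simp: L2_time_space_def)
  have I[measurable]: "{a<..<b} \<in> sets ?A"
    using ab by (auto simp: sets_restrict_space_iff)
  \<comment> \<open>Writing the integral over the whole time interval with an indicator makes the
    joint measurability of \<open>f\<close> applicable.\<close>
  define h where "h x = (\<integral>s. indicator {a<..<b} s * f s x \<partial>?A)" for x
  have eq: "(\<integral>s. f s x \<partial>lebesgue_on {a<..<b}) = h x" for x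
  proof -
    have "(\<integral>s. f s x \<partial>lebesgue_on {a<..<b}) = (\<integral>s. indicator {a<..<b} s *\<^sub>R f s x \<partial>lebesgue)"
      by (subst integral_restrict_space) auto
    also have "\<dots> = (\<integral>s. indicator {0<..<T} s *\<^sub>R (indicator {a<..<b} s * f s x) \<partial>lebesgue)"
      using ab by (intro Bochner_Integration.integral_cong) (auto simp: indicator_def)
    also have "\<dots> = h x" unfolding h_def by (subst integral_restrict_space) auto
    finally show ?thesis .
  qed
  have swap: "(\<lambda>(x, s). f s x) \<in> borel_measurable (?B \<Otimes>\<^sub>M ?A)"
    using measurable_comp[OF measurable_pair_swap' fm] by (simp add: o_def split_beta)
  have hm[measurable]: "h \<in> borel_measurable ?B"
    unfolding h_def
  proof (rule A.borel_measurable_lebesgue_integral)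
    show "(\<lambda>(x, s). indicator {a<..<b} s * f s x) \<in> borel_measurable (?B \<Otimes>\<^sub>M ?A)"
      using swap unfolding split_beta by measurable
  qed
  have AEi: "AE x in ?B. integrable ?A (\<lambda>s. (f s x)\<^sup>2)" using AB.AE_integrable_snd[OF f2] .
  have int2: "integrable ?B (\<lambda>x. \<integral>s. (f s x)\<^sup>2 \<partial>?A)" using AB.integrable_snd[OF f2] .
  have le: "AE x in ?B. (h x)\<^sup>2 \<le> measure ?A (space ?A) * (\<integral>s. (f s x)\<^sup>2 \<partial>?A)"
    using AEi AE_space
  proof eventually_elim
    case (elim x)
    have [measurable]: "(\<lambda>s. f s x) \<in> borel_measurable ?A"
      using measurable_Pair2[OF swap elim(2)] by simp
    have i: "integrable ?A (\<lambda>s. (indicator {a<..<b} s * f s x)\<^sup>2)"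
    proof (rule Bochner_Integration.integrable_bound[OF elim(1)])
      show "(\<lambda>s. (indicator {a<..<b} s * f s x)\<^sup>2) \<in> borel_measurable ?A" by measurable
    qed (auto simp: indicator_def)
    have "(h x)\<^sup>2 \<le> measure ?A (space ?A) * (\<integral>s. (indicator {a<..<b} s * f s x)\<^sup>2 \<partial>?A)"
      unfolding h_def by (rule square_integral_le[OF A.finite_measure_axioms _ i]) measurable
    also have "\<dots> \<le> measure ?A (space ?A) * (\<integral>s. (f s x)\<^sup>2 \<partial>?A)"
      using i elim(1) by (intro mult_left_mono integral_mono) (auto simp: indicator_def)
    finally show ?case .
  qed
  have "integrable ?B (\<lambda>x. (h x)\<^sup>2)"
  proof (rule Bochner_Integration.integrable_bound[OF integrable_mult_right[OF int2]])
    show "AE x in ?B. norm ((h x)\<^sup>2) \<le> norm (measure ?A (space ?A) * (\<integral>s. (f s x)\<^sup>2 \<partial>?A))"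
      using le by eventually_elim (auto intro: order_trans[OF _ abs_ge_self])
  qed measurable
  then have "integrable ?B (\<lambda>x. (h x / c)\<^sup>2)" by (simp add: power_divide)
  then show ?thesis unfolding eq L2_space_def by simp
qed

text \<open>Two divergences are indistinguishable by test functions; the fundamental lemma then
  makes the choice in \<open>measure_div\<close> immaterial under integrals.\<close>

lemma has_measure_div_AE_eq:
  assumes "has_measure_div \<Omega> v u" "has_measure_div \<Omega> v u'"
  shows "AE x in lebesgue_on \<Omega>. u x = u' x"
proof -
  have L2: "u \<in> L2_space \<Omega>" "u' \<in> L2_space \<Omega>" using assms by (auto simp: has_measure_div_def)
  have i: "integrable (lebesgue_on \<Omega>) u" "integrable (lebesgue_on \<Omega>) u'" using L2 L2_space_integrable by auto
  have "AE x in lebesgue_on \<Omega>. u x - u' x = 0"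
  proof (rule AE_zero_if_orthogonal_C1_compact[OF open_dom bounded_dom])
    show "integrable (lebesgue_on \<Omega>) (\<lambda>x. u x - u' x)" using i by simp
    fix \<phi> assume \<phi>: "\<phi> \<in> C1_compact \<Omega>"
    have c: "continuous_on (closure \<Omega>) \<phi>"
      using C1_compactE[OF \<phi>] by (metis continuous_on_subset subset_UNIV)
    have "L2_inner \<Omega> u \<phi> = L2_inner \<Omega> u' \<phi>"
      using assms \<phi> by (auto simp: has_measure_div_def)
    then show "(\<integral>x. (u x - u' x) * \<phi> x \<partial>lebesgue_on \<Omega>) = 0"
      using integrable_mult_continuous[OF i(1) c] integrable_mult_continuous[OF i(2) c]
      by (simp add: L2_inner_def left_diff_distrib)
  qed
  then show ?thesis by eventually_elim simp
qed

lemma measure_div: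
  assumes "has_measure_div \<Omega> v u"
  shows "has_measure_div \<Omega> v (measure_div \<Omega> v)" "AE x in lebesgue_on \<Omega>. measure_div \<Omega> v x = u x"
proof -
  show "has_measure_div \<Omega> v (measure_div \<Omega> v)"
    unfolding measure_div_def by (rule someI[of "has_measure_div \<Omega> v", OF assms])
  from has_measure_div_AE_eq[OF this assms] show "AE x in lebesgue_on \<Omega>. measure_div \<Omega> v x = u x" .
qed

lemma L2_inner_measure_div:
  assumes "has_measure_div \<Omega> v u" "\<eta> \<in> L2_space \<Omega>"
  shows "L2_inner \<Omega> (measure_div \<Omega> v) \<eta> = L2_inner \<Omega> u \<eta>"
proof -
  have "has_measure_div \<Omega> v (measure_div \<Omega> v)" using measure_div(1)[OF assms(1)] .
  then have [measurable]: "measure_div \<Omega> v \<in> borel_measurable (lebesgue_on \<Omega>)"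
    "u \<in> borel_measurable (lebesgue_on \<Omega>)" "\<eta> \<in> borel_measurable (lebesgue_on \<Omega>)"
    using assms by (auto simp: has_measure_div_def L2_space_def)
  show ?thesis unfolding L2_inner_def
    by (rule integral_cong_AE) (use measure_div(2)[OF assms(1)] in auto)
qed

lemma has_measure_div_diff:
  assumes v: "v \<in> vector_radon_measures (closure \<Omega>)" "has_measure_div \<Omega> v u"
    and v': "v' \<in> vector_radon_measures (closure \<Omega>)" "has_measure_div \<Omega> v' u'"
  shows "has_measure_div \<Omega> (v - v') (\<lambda>x. u x - u' x)"
  unfolding has_measure_div_def
proof (intro conjI ballI)
  have L2: "u \<in> L2_space \<Omega>" "u' \<in> L2_space \<Omega>" using v v' by (auto simp: has_measure_div_def)
  then show "(\<lambda>x. u x - u' x) \<in> L2_space \<Omega>" by (rule L2_space_diff)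
  fix \<phi> assume \<phi>: "\<phi> \<in> C1_compact \<Omega>"
  have c: "continuous_on (closure \<Omega>) \<phi>"
    using C1_compactE[OF \<phi>] by (metis continuous_on_subset subset_UNIV)
  have "pairing (v - v') (grad \<phi>) = pairing v (grad \<phi>) - pairing v' (grad \<phi>)"
    by (simp add: pairing_def sum_subtractf)
  also have "\<dots> = - (L2_inner \<Omega> u \<phi> - L2_inner \<Omega> u' \<phi>)"
    using v v' \<phi> by (simp add: has_measure_div_def)
  also have "L2_inner \<Omega> u \<phi> - L2_inner \<Omega> u' \<phi> = L2_inner \<Omega> (\<lambda>x. u x - u' x) \<phi>"
    using integrable_mult_continuous[OF L2_space_integrable c] L2
    by (simp add: L2_inner_def left_diff_distrib)
  finally show "pairing (v - v') (grad \<phi>) = - L2_inner \<Omega> (\<lambda>x. u x - u' x) \<phi>" .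
qed

text \<open>For a test function in place of \<open>w\<close> the left side is
  \<open>- \<langle>v, \<nabla>w\<rangle>\<close>, so that \<open>|\<nabla>w| \<le> M\<close> would
  make \<open>- \<nabla>w\<close> a competitor in the supremum that defines the total variation. The
  approximation satisfies this bound up to the factor \<open>l\<close>, which tends to 1.\<close>

lemma measure_div_le_total_variation:
  fixes w M :: "real ^ 'n \<Rightarrow> real"
  assumes v: "v \<in> vector_radon_measures (closure \<Omega>)" "has_measure_div \<Omega> v u"
    and w: "continuous_on (closure \<Omega>) w" "\<And>x. x \<in> frontier \<Omega> \<Longrightarrow> w x = 0"
    and M: "continuous_on (closure \<Omega>) M" "0 < k0" "\<And>x. x \<in> closure \<Omega> \<Longrightarrow> k0 \<le> M x"
    and loc: "\<And>x y B. x \<in> closure \<Omega> \<Longrightarrow> y \<in> closure \<Omega> \<Longrightarrow> 0 \<le> B \<Longrightarrow>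
      (\<And>z. z \<in> closed_segment x y \<Longrightarrow> M z \<le> B) \<Longrightarrow> \<bar>w x - w y\<bar> \<le> B * norm (x - y)"
  shows "L2_inner \<Omega> u w \<le> total_variation (closure \<Omega>) v M"
proof -
  let ?K = "closure \<Omega>" and ?tv = "total_variation (closure \<Omega>) v M"
  have M0: "0 \<le> M x" if "x \<in> ?K" for x using M(2) M(3)[OF that] by linarith
  have ui: "integrable (lebesgue_on \<Omega>) u" using v by (auto simp: has_measure_div_def intro: L2_space_integrable)
  have step: "L2_inner \<Omega> u w \<le> (1 + e) * (1 + e / k0) * ?tv + e * (\<integral>x. \<bar>u x\<bar> \<partial>lebesgue_on \<Omega>)" if e: "0 < e" for e
  proof -
    obtain \<phi> where \<phi>: "\<phi> \<in> C1_compact \<Omega>" "\<And>x. x \<in> ?K \<Longrightarrow> \<bar>\<phi> x - w x\<bar> \<le> e"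
      "\<And>x. x \<in> ?K \<Longrightarrow> norm (grad \<phi> x) \<le> (1 + e) * (M x + e)"
      using C1_compact_approx[OF w(2) M(1) M0 loc e] by blast
    have c: "continuous_on ?K \<phi>" "continuous_on ?K (grad \<phi>)"
      using C1_compactE[OF \<phi>(1)] by (metis continuous_on_subset subset_UNIV)+
    \<comment> \<open>Since \<open>M \<ge> k0\<close>, the bound \<open>(1 + e) * (M + e)\<close> is
      at most \<open>l * M\<close>: a purely multiplicative error can be divided out of the
      field.\<close>
    define l where "l = (1 + e) * (1 + e / k0)"
    have l: "0 < l" using e M(2) by (auto simp: l_def intro!: mult_pos_pos add_pos_pos)
    have gl: "norm ((- 1 / l) *\<^sub>R grad \<phi> x) \<le> M x" if "x \<in> ?K" for x
    proof -
      have "e \<le> (e / k0) * M x" using M(2) M(3)[OF that] e by (simp add: field_simps)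
      then have "M x + e \<le> (1 + e / k0) * M x" by (simp add: algebra_simps)
      then have "(1 + e) * (M x + e) \<le> (1 + e) * ((1 + e / k0) * M x)" using e by (intro mult_left_mono) auto
      then have "norm (grad \<phi> x) \<le> l * M x" using \<phi>(3)[OF that] by (simp add: l_def mult.assoc)
      then show ?thesis using l by (simp add: field_simps)
    qed
    have "pairing v (\<lambda>x. (- 1 / l) *\<^sub>R grad \<phi> x) \<le> ?tv"
      using dom_ne gl c by (intro pairing_le_total_variation v compact_closure_dom M0 M(1) continuous_intros) auto
    then have "- (1 / l) * pairing v (grad \<phi>) \<le> ?tv"
      using pairing_scale[OF v(1) c(2), of "- 1 / l"] by simp
    then have "L2_inner \<Omega> u \<phi> / l \<le> ?tv"
      using v(2) \<phi>(1) by (simp add: has_measure_div_def)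
    then have 1: "L2_inner \<Omega> u \<phi> \<le> l * ?tv" using l by (simp add: field_simps)
    have i: "integrable (lebesgue_on \<Omega>) (\<lambda>x. u x * w x)" "integrable (lebesgue_on \<Omega>) (\<lambda>x. u x * \<phi> x)"
      using integrable_mult_continuous[OF ui] w(1) c(1) by auto
    have "L2_inner \<Omega> u w - L2_inner \<Omega> u \<phi> = (\<integral>x. u x * w x - u x * \<phi> x \<partial>lebesgue_on \<Omega>)"
      using i by (simp add: L2_inner_def)
    also have "\<dots> \<le> (\<integral>x. e * \<bar>u x\<bar> \<partial>lebesgue_on \<Omega>)"
    proof (rule integral_mono)
      fix x assume "x \<in> space (lebesgue_on \<Omega>)"
      then have "\<bar>\<phi> x - w x\<bar> \<le> e" using \<phi>(2) dom_subset_closure by auto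
      then have "\<bar>u x\<bar> * \<bar>w x - \<phi> x\<bar> \<le> \<bar>u x\<bar> * e" by (intro mult_left_mono) auto
      then show "u x * w x - u x * \<phi> x \<le> e * \<bar>u x\<bar>"
        by (metis abs_ge_self abs_mult mult.commute order_trans right_diff_distrib)
    qed (use i ui in auto)
    also have "\<dots> = e * (\<integral>x. \<bar>u x\<bar> \<partial>lebesgue_on \<Omega>)" by simp
    finally show ?thesis using 1 unfolding l_def by linarith
  qed
  define \<epsilon> where "\<epsilon> k = inverse (real (Suc k))" for k
  have \<epsilon>: "\<epsilon> \<longlonglongrightarrow> 0" "\<And>k. 0 < \<epsilon> k" unfolding \<epsilon>_def by (rule LIMSEQ_inverse_real_of_nat, simp)
  have "(\<lambda>k. (1 + \<epsilon> k) * (1 + \<epsilon> k / k0) * ?tv + \<epsilon> k * (\<integral>x. \<bar>u x\<bar> \<partial>lebesgue_on \<Omega>))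
      \<longlonglongrightarrow> (1 + 0) * (1 + 0 / k0) * ?tv + 0 * (\<integral>x. \<bar>u x\<bar> \<partial>lebesgue_on \<Omega>)"
    using M(2) by (intro tendsto_intros \<epsilon>) auto
  from LIMSEQ_le_const[OF this] show ?thesis using step[OF \<epsilon>(2)] by auto
qed

text \<open>Partitions of unity on finer and finer scales are countably many test functions that
  approximate every continuous function uniformly.\<close>

lemma vague_compactness:
  fixes Q :: "nat \<Rightarrow> real ^ 'n \<Rightarrow> real"
  assumes Q: "\<And>j. integrable (lebesgue_on \<Omega>) (Q j)" "\<And>j. (\<integral>x. \<bar>Q j x\<bar> \<partial>lebesgue_on \<Omega>) \<le> C"
  obtains r \<mu> where "strict_mono r" "\<mu> \<in> radon_measures (closure \<Omega>)"
    "\<And>\<eta>. continuous_on (closure \<Omega>) \<eta> \<Longrightarrow> (\<lambda>j. \<integral>x. Q (r j) x * \<eta> x \<partial>lebesgue_on \<Omega>) \<longlonglongrightarrow> \<mu> \<eta>"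
proof -
  let ?M = "lebesgue_on \<Omega>" and ?K = "closure \<Omega>"
  have C0: "0 \<le> C" by (rule order_trans[OF _ Q(2)[of 0]]) simp
  have bnd: "\<bar>\<integral>x. Q j x * \<eta> x \<partial>?M\<bar> \<le> C * b" if \<eta>: "continuous_on ?K \<eta>" "\<And>x. x \<in> ?K \<Longrightarrow> \<bar>\<eta> x\<bar> \<le> b" for j \<eta> b
  proof -
    have b0: "0 \<le> b"
    proof -
      obtain x where "x \<in> \<Omega>" using dom_ne by auto
      then show ?thesis using \<eta>(2)[OF dom_subset_closure, of x] by linarith
    qed
    have "\<bar>\<integral>x. Q j x * \<eta> x \<partial>?M\<bar> \<le> (\<integral>x. \<bar>Q j x * \<eta> x\<bar> \<partial>?M)" by (rule integral_abs_bound)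
    also have "\<dots> \<le> (\<integral>x. b * \<bar>Q j x\<bar> \<partial>?M)"
    proof (rule integral_mono)
      show "\<bar>Q j x * \<eta> x\<bar> \<le> b * \<bar>Q j x\<bar>" if "x \<in> space ?M" for x
        using mult_left_mono[OF \<eta>(2)[OF dom_subset_closure], of x "\<bar>Q j x\<bar>"] that by (simp add: abs_mult mult.commute)
    qed (use integrable_mult_continuous[OF Q(1) \<eta>(1)] Q in auto)
    also have "\<dots> \<le> b * C" using Q(2) b0 by (simp add: mult_left_mono)
    finally show ?thesis by (simp add: mult.commute)
  qed
  have "\<exists>F \<psi>. finite F \<and> F \<subseteq> ?K \<and> (\<forall>p\<in>F. continuous_on ?K (\<psi> p)) \<and> (\<forall>p. \<forall>x\<in>?K. 0 \<le> \<psi> p x) \<and>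
     (\<forall>x\<in>?K. (\<Sum>p\<in>F. \<psi> p x) = (1::real)) \<and> (\<forall>p. \<forall>x\<in>?K. \<psi> p x \<noteq> 0 \<longrightarrow> dist p x < inverse (real (Suc k)))" for k
  proof (rule partition_of_unity_compact[OF compact_closure_dom, of "inverse (real (Suc k))"])
    fix F and \<psi> :: "real ^ 'n \<Rightarrow> real ^ 'n \<Rightarrow> real"
    assume "finite F" "F \<subseteq> ?K" "\<And>p. p \<in> F \<Longrightarrow> continuous_on ?K (\<psi> p)"
      "\<And>p x. x \<in> ?K \<Longrightarrow> 0 \<le> \<psi> p x" "\<And>x. x \<in> ?K \<Longrightarrow> (\<Sum>p\<in>F. \<psi> p x) = 1"
      "\<And>p x. x \<in> ?K \<Longrightarrow> \<psi> p x \<noteq> 0 \<Longrightarrow> dist p x < inverse (real (Suc k))"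
    then show ?thesis by (intro exI[of _ F] exI[of _ \<psi>]) simp
  qed simp
  then obtain F \<psi> where F: "\<And>k. finite (F k)" "\<And>k. F k \<subseteq> ?K"
    and \<psi>: "\<And>k p. p \<in> F k \<Longrightarrow> continuous_on ?K (\<psi> k p)" "\<And>k p x. x \<in> ?K \<Longrightarrow> 0 \<le> \<psi> k p x"
      "\<And>k x. x \<in> ?K \<Longrightarrow> (\<Sum>p\<in>F k. \<psi> k p x) = (1::real)"
      "\<And>k p x. x \<in> ?K \<Longrightarrow> \<psi> k p x \<noteq> 0 \<Longrightarrow> dist p x < inverse (real (Suc k))"
    by metis
  have \<psi>1: "\<bar>\<psi> k p x\<bar> \<le> 1" if "x \<in> ?K" "p \<in> F k" for k p x
    using member_le_sum[of p "F k" "\<lambda>p. \<psi> k p x"] F(1) \<psi>(2,3)[OF that(1)] that(2) by auto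
  define I where "I = (SIGMA k:UNIV. F k)"
  have "countable I" unfolding I_def using F(1) by (auto intro: countable_finite)
  then obtain r :: "nat \<Rightarrow> nat" where r: "strict_mono r"
    "\<And>i. i \<in> I \<Longrightarrow> \<exists>l. (\<lambda>j. \<integral>x. Q (r j) x * \<psi> (fst i) (snd i) x \<partial>?M) \<longlonglongrightarrow> l"
  proof (rule function_convergent_subsequence[of I "\<lambda>j i. \<integral>x. Q j x * \<psi> (fst i) (snd i) x \<partial>?M" C])
    fix j i assume "i \<in> I"
    then show "norm (\<integral>x. Q j x * \<psi> (fst i) (snd i) x \<partial>?M) \<le> C"
      using bnd[of "\<psi> (fst i) (snd i)" 1 j] \<psi>(1) \<psi>1 by (auto simp: I_def)
  next
    fix k :: "nat \<Rightarrow> nat"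
    assume "strict_mono k" "\<And>i. i \<in> I \<Longrightarrow> \<exists>l. (\<lambda>j. \<integral>x. Q (k j) x * \<psi> (fst i) (snd i) x \<partial>?M) \<longlonglongrightarrow> l"
    then show thesis by (rule that)
  qed
  have conv: "convergent (\<lambda>j. \<integral>x. Q (r j) x * \<eta> x \<partial>?M)" if \<eta>: "continuous_on ?K \<eta>" for \<eta>
  proof -
    have "Cauchy (\<lambda>j. \<integral>x. Q (r j) x * \<eta> x \<partial>?M)"
    proof (rule metric_CauchyI)
      fix e :: real assume e: "0 < e"
      define e' where "e' = e / (4 * (C + 1))"
      have e': "0 < e'" using e C0 by (simp add: e'_def)
      have Ce': "C * e' \<le> e / 4"
      proof -
        have "a \<noteq> 0 \<Longrightarrow> a * (e / (4 * a)) = e / 4" for a by simp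
        from this[of "C + 1"] have "(C + 1) * e' = e / 4" using C0 unfolding e'_def by linarith
        then show ?thesis using e' by (simp add: algebra_simps)
      qed
      have "uniformly_continuous_on ?K \<eta>" using compact_uniformly_continuous[OF \<eta> compact_closure_dom] .
      then obtain \<delta> where \<delta>: "0 < \<delta>" "\<And>x y. x \<in> ?K \<Longrightarrow> y \<in> ?K \<Longrightarrow> dist y x < \<delta> \<Longrightarrow> dist (\<eta> y) (\<eta> x) < e'"
        using e' unfolding uniformly_continuous_on_def by metis
      obtain k where k: "inverse (real (Suc k)) < \<delta>" using reals_Archimedean[OF \<delta>(1)] by auto
      \<comment> \<open>The values of \<open>\<eta>\<close> at the net points, spread by the
        partition of unity. This is a finite combination of functions along which the subsequence
        already converges.\<close>
      define \<zeta> where "\<zeta> x = (\<Sum>p\<in>F k. \<eta> p * \<psi> k p x)" for x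
      have \<zeta>c: "continuous_on ?K \<zeta>" unfolding \<zeta>_def using \<psi>(1) by (intro continuous_intros)
      have \<eta>\<zeta>: "\<bar>\<eta> x - \<zeta> x\<bar> \<le> e'" if x: "x \<in> ?K" for x
      proof -
        have "\<eta> x = (\<Sum>p\<in>F k. \<eta> x * \<psi> k p x)" using \<psi>(3)[OF x, of k] by (simp flip: sum_distrib_left)
        then have "\<eta> x - \<zeta> x = (\<Sum>p\<in>F k. (\<eta> x - \<eta> p) * \<psi> k p x)"
          by (simp add: \<zeta>_def left_diff_distrib sum_subtractf)
        also have "\<bar>\<dots>\<bar> \<le> (\<Sum>p\<in>F k. \<bar>(\<eta> x - \<eta> p) * \<psi> k p x\<bar>)" by (rule sum_abs)
        also have "\<dots> \<le> (\<Sum>p\<in>F k. e' * \<psi> k p x)"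
        proof (rule sum_mono)
          fix p assume p: "p \<in> F k"
          show "\<bar>(\<eta> x - \<eta> p) * \<psi> k p x\<bar> \<le> e' * \<psi> k p x"
          proof (cases "\<psi> k p x = 0")
            case False
            have "dist p x < \<delta>" using \<psi>(4)[OF x False] k by linarith
            then have "dist (\<eta> p) (\<eta> x) < e'" using \<delta>(2)[OF x] F(2) p by blast
            then show ?thesis using \<psi>(2)[OF x, of k p]
              by (auto simp: abs_mult dist_real_def abs_minus_commute intro!: mult_right_mono)
          qed simp
        qed
        also have "\<dots> = e'" using \<psi>(3)[OF x, of k] by (simp flip: sum_distrib_left)
        finally show ?thesis .
      qed
      have near: "\<bar>(\<integral>x. Q j x * \<eta> x \<partial>?M) - (\<integral>x. Q j x * \<zeta> x \<partial>?M)\<bar> \<le> e / 4" for j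
      proof -
        have "(\<integral>x. Q j x * \<eta> x \<partial>?M) - (\<integral>x. Q j x * \<zeta> x \<partial>?M) = (\<integral>x. Q j x * (\<eta> x - \<zeta> x) \<partial>?M)"
          using integrable_mult_continuous[OF Q(1) \<eta>] integrable_mult_continuous[OF Q(1) \<zeta>c]
          by (simp add: right_diff_distrib)
        also have "\<bar>\<dots>\<bar> \<le> C * e'" using \<eta> \<zeta>c \<eta>\<zeta> by (intro bnd continuous_intros) auto
        finally show ?thesis using Ce' by linarith
      qed
      have "convergent (\<lambda>j. \<integral>x. Q (r j) x * \<zeta> x \<partial>?M)"
      proof -
        have "(\<integral>x. Q j x * \<zeta> x \<partial>?M) = (\<Sum>p\<in>F k. \<eta> p * (\<integral>x. Q j x * \<psi> k p x \<partial>?M))" for j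
        proof -
          have "(\<integral>x. Q j x * \<zeta> x \<partial>?M) = (\<integral>x. (\<Sum>p\<in>F k. \<eta> p * (Q j x * \<psi> k p x)) \<partial>?M)"
            by (simp add: \<zeta>_def sum_distrib_left mult.left_commute)
          also have "\<dots> = (\<Sum>p\<in>F k. \<integral>x. \<eta> p * (Q j x * \<psi> k p x) \<partial>?M)"
            using integrable_mult_continuous[OF Q(1) \<psi>(1)] by (intro Bochner_Integration.integral_sum) auto
          finally show ?thesis by simp
        qed
        moreover have "convergent (\<lambda>j. \<Sum>p\<in>F k. \<eta> p * (\<integral>x. Q (r j) x * \<psi> k p x \<partial>?M))"
        proof (rule convergent_sum)
          fix p assume "p \<in> F k"
          then have "(k, p) \<in> I" by (simp add: I_def)
          from r(2)[OF this] have "convergent (\<lambda>j. \<integral>x. Q (r j) x * \<psi> k p x \<partial>?M)" by (simp add: convergent_def)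
          then show "convergent (\<lambda>j. \<eta> p * (\<integral>x. Q (r j) x * \<psi> k p x \<partial>?M))"
            by (intro convergent_mult convergent_const)
        qed
        ultimately show ?thesis by simp
      qed
      then have "Cauchy (\<lambda>j. \<integral>x. Q (r j) x * \<zeta> x \<partial>?M)" by (rule convergent_Cauchy)
      then obtain n0 where n0: "\<And>m n. n0 \<le> m \<Longrightarrow> n0 \<le> n \<Longrightarrow>
          dist (\<integral>x. Q (r m) x * \<zeta> x \<partial>?M) (\<integral>x. Q (r n) x * \<zeta> x \<partial>?M) < e / 4"
        using e by (meson metric_CauchyD zero_less_divide_iff zero_less_numeral)
      show "\<exists>n0. \<forall>m\<ge>n0. \<forall>n\<ge>n0. dist (\<integral>x. Q (r m) x * \<eta> x \<partial>?M) (\<integral>x. Q (r n) x * \<eta> x \<partial>?M) < e"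
      proof (intro exI allI impI)
        fix m n assume "n0 \<le> m" "n0 \<le> n"
        from n0[OF this] near[of "r m"] near[of "r n"] e
        show "dist (\<integral>x. Q (r m) x * \<eta> x \<partial>?M) (\<integral>x. Q (r n) x * \<eta> x \<partial>?M) < e"
          unfolding dist_real_def by linarith
      qed
    qed
    then show ?thesis by (rule real_Cauchy_convergent)
  qed
  define \<mu> where "\<mu> \<eta> = lim (\<lambda>j. \<integral>x. Q (r j) x * \<eta> x \<partial>?M)" for \<eta>
  have \<mu>: "(\<lambda>j. \<integral>x. Q (r j) x * \<eta> x \<partial>?M) \<longlonglongrightarrow> \<mu> \<eta>" if "continuous_on ?K \<eta>" for \<eta>
    using conv[OF that] unfolding \<mu>_def by (simp add: convergent_LIMSEQ_iff)
  have "\<mu> \<in> radon_measures ?K"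
    unfolding radon_measures_def
  proof (intro CollectI conjI allI impI exI)
    fix \<eta> \<zeta> :: "real ^ 'n \<Rightarrow> real" assume c: "continuous_on ?K \<eta>" "continuous_on ?K \<zeta>"
    have "(\<lambda>j. \<integral>x. Q (r j) x * (\<eta> x + \<zeta> x) \<partial>?M) \<longlonglongrightarrow> \<mu> \<eta> + \<mu> \<zeta>"
      using tendsto_add[OF \<mu>[OF c(1)] \<mu>[OF c(2)]] integrable_mult_continuous[OF Q(1) c(1)]
        integrable_mult_continuous[OF Q(1) c(2)] by (simp add: distrib_left)
    then show "\<mu> (\<lambda>x. \<eta> x + \<zeta> x) = \<mu> \<eta> + \<mu> \<zeta>"
      using \<mu>[OF continuous_on_add[OF c]] by (rule LIMSEQ_unique[rotated])
  next
    fix c and \<eta> :: "real ^ 'n \<Rightarrow> real" assume \<eta>: "continuous_on ?K \<eta>"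
    have "(\<lambda>j. \<integral>x. Q (r j) x * (c * \<eta> x) \<partial>?M) \<longlonglongrightarrow> c * \<mu> \<eta>"
      using tendsto_mult_left[OF \<mu>[OF \<eta>], of c] by (simp add: mult.left_commute)
    then show "\<mu> (\<lambda>x. c * \<eta> x) = c * \<mu> \<eta>"
      using \<mu>[OF continuous_on_mult_left[OF \<eta>, of c]] by (rule LIMSEQ_unique[rotated])
  next
    fix \<eta> :: "real ^ 'n \<Rightarrow> real" assume \<eta>: "continuous_on ?K \<eta>"
    have "bounded (\<eta> ` ?K)" using compact_closure_dom \<eta> by (intro compact_imp_bounded compact_continuous_image)
    then have bdd: "bdd_above ((\<lambda>x. \<bar>\<eta> x\<bar>) ` ?K)" unfolding bounded_iff bdd_above_def by force
    show "\<bar>\<mu> \<eta>\<bar> \<le> C * (SUP x\<in>?K. \<bar>\<eta> x\<bar>)"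
      by (rule LIMSEQ_le_const2[OF tendsto_rabs[OF \<mu>[OF \<eta>]]])
        (use bnd[OF \<eta> cSUP_upper[OF _ bdd]] in auto)
  qed
  then show ?thesis using that r(1) \<mu> by blast
qed

end

text \<open>A competitor that differs from \<open>Q\<close> on a single element localises the
  inequality. The values \<open>2 *\<^sub>R Q x\<close> and 0 give the equality from both sides; it
  then reduces the inequality to \<open>0 \<le> m x * norm c + G x \<bullet> c\<close>, and
  \<open>c = - G x\<close> gives the gradient bound. Two opposite unit vectors give
  \<open>0 \<le> m x\<close>, which settles \<open>G x = 0\<close>.\<close>

lemma (in convex_mesh) variational_inequality_elementwise:
  fixes m :: "real ^ 'n \<Rightarrow> real" and G Q :: "real ^ 'n \<Rightarrow> real ^ 'n"
  assumes m: "\<And>\<sigma>. \<sigma> \<in> \<T> \<Longrightarrow> m constant_on \<sigma>" and G: "\<And>\<sigma>. \<sigma> \<in> \<T> \<Longrightarrow> G constant_on \<sigma>" and Q: "Q \<in> S_h \<T>"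
    and VI: "\<And>v. v \<in> S_h \<T> \<Longrightarrow> L2_inner \<Omega> m (\<lambda>x. norm (v x) - norm (Q x)) + L2_inner \<Omega> G (\<lambda>x. v x - Q x) \<ge> 0"
    and x: "\<sigma> \<in> \<T>" "x \<in> \<sigma>"
  shows "norm (G x) \<le> m x" "m x * norm (Q x) + G x \<bullet> Q x = 0"
proof -
  define p where "p \<sigma>' = (SOME y. y \<in> \<sigma>')" for \<sigma>' :: "(real ^ 'n) set"
  have p: "p \<sigma>' \<in> \<sigma>'" if "\<sigma>' \<in> \<T>" for \<sigma>'
    unfolding p_def using elem_simplex(7)[OF that] by (simp add: some_in_eq)
  have const: "f y = f z" if "f constant_on \<sigma>'" "y \<in> \<sigma>'" "z \<in> \<sigma>'" for f :: "real ^ 'n \<Rightarrow> 'b" and \<sigma>' y z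
    using that by (auto simp: constant_on_def)
  have Qc: "Q constant_on \<sigma>'" if "\<sigma>' \<in> \<T>" for \<sigma>' using Q that by (simp add: S_h_def)
  have key: "0 \<le> m x * (norm c - norm (Q x)) + G x \<bullet> (c - Q x)" for c
  proof -
    define v where "v y = (if y \<in> \<sigma> then c else Q y)" for y
    have v: "v y = (if \<sigma>' = \<sigma> then c else Q y)" if "\<sigma>' \<in> \<T>" "y \<in> \<sigma>'" for \<sigma>' y
      using elem_eq[OF that(1) x(1) that(2)] that by (auto simp: v_def)
    have vc: "v constant_on \<sigma>'" if "\<sigma>' \<in> \<T>" for \<sigma>'
      using v[OF that] Qc[OF that] by (auto simp: constant_on_def)
    then have "v \<in> S_h \<T>" by (simp add: S_h_def)
    let ?f = "\<lambda>y. m y * (norm (v y) - norm (Q y)) + G y \<bullet> (v y - Q y)"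
    let ?f1 = "\<lambda>y. m y * (norm (v y) - norm (Q y))" and ?f2 = "\<lambda>y. G y \<bullet> (v y - Q y)"
    have c1: "?f1 y = ?f1 (p \<sigma>')" "?f2 y = ?f2 (p \<sigma>')" if "\<sigma>' \<in> \<T>" "y \<in> \<sigma>'" for \<sigma>' y
      using const[OF m[OF that(1)] that(2) p[OF that(1)]] const[OF G[OF that(1)] that(2) p[OF that(1)]]
        const[OF Qc[OF that(1)] that(2) p[OF that(1)]] const[OF vc[OF that(1)] that(2) p[OF that(1)]] by simp_all
    have "L2_inner \<Omega> m (\<lambda>x. norm (v x) - norm (Q x)) = (\<Sum>\<sigma>'\<in>\<T>. measure lebesgue \<sigma>' * ?f1 (p \<sigma>'))"
      using has_bochner_integral_integral_eq[OF piecewise_const_integral[of ?f1 "\<lambda>\<sigma>'. ?f1 (p \<sigma>')", OF c1(1)]]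
      by (simp add: L2_inner_def)
    moreover have "L2_inner \<Omega> G (\<lambda>x. v x - Q x) = (\<Sum>\<sigma>'\<in>\<T>. measure lebesgue \<sigma>' * ?f2 (p \<sigma>'))"
      using has_bochner_integral_integral_eq[OF piecewise_const_integral[of ?f2 "\<lambda>\<sigma>'. ?f2 (p \<sigma>')", OF c1(2)]]
      by (simp add: L2_inner_def)
    ultimately have "0 \<le> (\<Sum>\<sigma>'\<in>\<T>. measure lebesgue \<sigma>' * ?f (p \<sigma>'))"
      using VI[OF \<open>v \<in> S_h \<T>\<close>] by (simp add: sum.distrib distrib_left)
    also have "\<dots> = (\<Sum>\<sigma>'\<in>\<T>. if \<sigma>' = \<sigma> then measure lebesgue \<sigma> * ?f (p \<sigma>) else 0)"
    proof (rule sum.cong[OF refl])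
      fix \<sigma>' assume \<sigma>': "\<sigma>' \<in> \<T>"
      show "measure lebesgue \<sigma>' * ?f (p \<sigma>') = (if \<sigma>' = \<sigma> then measure lebesgue \<sigma> * ?f (p \<sigma>) else 0)"
      proof (cases "\<sigma>' = \<sigma>")
        case False
        then have "v (p \<sigma>') = Q (p \<sigma>')" using v[OF \<sigma>' p[OF \<sigma>']] by simp
        then show ?thesis using False by simp
      qed simp
    qed
    also have "\<dots> = measure lebesgue \<sigma> * ?f (p \<sigma>)" using finite_mesh x by simp
    finally have "0 \<le> ?f (p \<sigma>)"
      using elem_measure_pos[OF x(1)] by (simp add: zero_le_mult_iff)
    then have "0 \<le> ?f x" using c1[OF x] by simp
    then show ?thesis using x by (simp add: v_def)
  qed
  have "0 \<le> m x * norm (Q x) + G x \<bullet> Q x" using key[of "2 *\<^sub>R Q x"] by (simp add: algebra_simps)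
  moreover have "0 \<le> - (m x * norm (Q x) + G x \<bullet> Q x)" using key[of 0] by simp
  ultimately show eq: "m x * norm (Q x) + G x \<bullet> Q x = 0" by linarith
  have "G x \<bullet> G x \<le> m x * norm (G x)"
    using key[of "- G x"] eq by (simp add: inner_diff_right algebra_simps)
  then have le: "norm (G x) * norm (G x) \<le> m x * norm (G x)" by (simp add: dot_square_norm power2_eq_square)
  have "0 \<le> m x"
  proof -
    obtain i :: 'n where True by simp
    have "0 \<le> m x * norm (axis i 1 :: real ^ 'n) + G x \<bullet> axis i 1" "0 \<le> m x * norm (- axis i 1 :: real ^ 'n) + G x \<bullet> (- axis i 1)"
      using key[of "axis i 1"] key[of "- axis i 1"] eq by (simp_all add: inner_diff_right algebra_simps)
    then show ?thesis by simp
  qed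
  then show "norm (G x) \<le> m x" using le by (cases "G x = 0") auto
qed

section \<open>The limit of one time step\<close>

text \<open>The clamped form uses only Lipschitz operations, so continuity, bounds and difference
  estimates follow without the three cases.\<close>

lemma ramp_eq:
  assumes "0 < \<epsilon>"
  shows "ramp k0 \<epsilon> k1 w s = k1 + (k0 - k1) * max 0 (min 1 ((s - w) / \<epsilon>))"
  using assms by (auto simp: ramp_def max_def min_def field_simps)

lemma ramp_bounds:
  assumes "0 < \<epsilon>" "k0 \<le> k1"
  shows "k0 \<le> ramp k0 \<epsilon> k1 w s" "ramp k0 \<epsilon> k1 w s \<le> k1"
proof -
  define c where "c = max 0 (min 1 ((s - w) / \<epsilon>))"
  have c: "0 \<le> c" "c \<le> 1" by (auto simp: c_def)
  have eq: "ramp k0 \<epsilon> k1 w s = k1 - (k1 - k0) * c"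
    unfolding ramp_eq[OF assms(1)] c_def by (simp add: algebra_simps)
  have *: "0 \<le> (k1 - k0) * c" using c assms by simp
  have **: "(k1 - k0) * c \<le> k1 - k0" using mult_left_mono[OF c(2), of "k1 - k0"] assms by simp
  show "k0 \<le> ramp k0 \<epsilon> k1 w s" unfolding eq le_diff_eq using ** by (simp add: algebra_simps)
  show "ramp k0 \<epsilon> k1 w s \<le> k1" unfolding eq using * by linarith
qed

text \<open>The difference is split so that the slope factor contains only \<open>k1'\<close>. With
  the limit data in the primed place this factor is bounded independently of the mesh.\<close>

lemma ramp_diff:
  assumes "0 < \<epsilon>"
  shows "\<bar>ramp k0 \<epsilon> k1 w s - ramp k0 \<epsilon> k1' w' s'\<bar> \<le> \<bar>k1 - k1'\<bar> + \<bar>k0 - k1'\<bar> * ((\<bar>w - w'\<bar> + \<bar>s - s'\<bar>) / \<epsilon>)"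
proof -
  define c where "c = max 0 (min 1 ((s - w) / \<epsilon>))"
  define c' where "c' = max 0 (min 1 ((s' - w') / \<epsilon>))"
  have c: "0 \<le> c" "c \<le> 1" by (auto simp: c_def)
  have "\<bar>c - c'\<bar> \<le> \<bar>(s - w) / \<epsilon> - (s' - w') / \<epsilon>\<bar>"
    unfolding c_def c'_def by (auto simp: max_def min_def)
  also have "\<dots> = \<bar>(s - w) - (s' - w')\<bar> / \<epsilon>"
    using assms by (simp flip: diff_divide_distrib)
  also have "\<dots> \<le> (\<bar>w - w'\<bar> + \<bar>s - s'\<bar>) / \<epsilon>"
    using assms by (intro divide_right_mono) auto
  finally have cc: "\<bar>c - c'\<bar> \<le> (\<bar>w - w'\<bar> + \<bar>s - s'\<bar>) / \<epsilon>" .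
  have "ramp k0 \<epsilon> k1 w s - ramp k0 \<epsilon> k1' w' s' = (k1 - k1') * (1 - c) + (k0 - k1') * (c - c')"
    unfolding ramp_eq[OF assms] c_def c'_def by (simp add: algebra_simps)
  also have "\<bar>\<dots>\<bar> \<le> \<bar>k1 - k1'\<bar> * (1 - c) + \<bar>k0 - k1'\<bar> * \<bar>c - c'\<bar>"
    using c by (intro order_trans[OF abs_triangle_ineq]) (simp add: abs_mult)
  also have "\<dots> \<le> \<bar>k1 - k1'\<bar> * 1 + \<bar>k0 - k1'\<bar> * ((\<bar>w - w'\<bar> + \<bar>s - s'\<bar>) / \<epsilon>)"
    using c cc by (intro add_mono mult_left_mono) auto
  finally show ?thesis by simp
qed

lemma constant_on_comb:
  "f constant_on S \<Longrightarrow> g constant_on S \<Longrightarrow> (\<lambda>x. h (f x) (g x)) constant_on S"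
  unfolding constant_on_def by (elim exE) (metis (no_types, lifting))

text \<open>At level 0 the iterate agrees with the nodal interpolant only on the closure, which
  determines the gradient inside.\<close>

lemma grad_cong_open:
  fixes f g :: "real ^ 'n \<Rightarrow> real"
  assumes "open S" "x \<in> S" "\<And>y. y \<in> S \<Longrightarrow> f y = g y"
  shows "grad f x = grad g x"
proof -
  have "GDERIV v x :> D" if "GDERIV u x :> D" "\<And>y. y \<in> S \<Longrightarrow> u y = v y" for u v :: "real ^ 'n \<Rightarrow> real" and D
    using that(1) unfolding gderiv_def
    by (rule has_derivative_transform_within_open[OF _ assms(1,2) that(2)])
  then have "GDERIV f x :> D \<longleftrightarrow> GDERIV g x :> D" for D
    using assms(3) by metis
  then show ?thesis by (simp add: grad_def)
qed

lemma uniform_limit_subseq: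
  fixes f :: "nat \<Rightarrow> 'a \<Rightarrow> 'b::metric_space"
  assumes "uniform_limit S f l sequentially" "strict_mono r"
  shows "uniform_limit S (\<lambda>j. f (r j)) l sequentially"
  using assms(1) eventually_subseq[OF assms(2)] unfolding uniform_limit_iff by blast

context convex_mesh
begin

lemma piecewise_const_integrable:
  fixes f :: "real ^ 'n \<Rightarrow> 'b::{banach,second_countable_topology}"
  assumes "\<And>\<sigma>. \<sigma> \<in> \<T> \<Longrightarrow> f constant_on \<sigma>"
  shows "integrable (lebesgue_on \<Omega>) f"
proof -
  have "\<exists>c. \<forall>x\<in>\<sigma>. f x = c" if "\<sigma> \<in> \<T>" for \<sigma>
    using assms[OF that] by (auto simp: constant_on_def)
  then obtain c where "\<And>\<sigma> x. \<sigma> \<in> \<T> \<Longrightarrow> x \<in> \<sigma> \<Longrightarrow> f x = c \<sigma>" by metis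
  from piecewise_const_integral[of f c, OF this] show ?thesis by (simp add: has_bochner_integral_iff)
qed

lemma elem_mean_const: "\<sigma> \<in> \<T> \<Longrightarrow> elem_mean \<T> v constant_on \<sigma>"
  using elem_mean_eq by (auto simp: constant_on_def)

lemma M_eps_h_const:
  assumes "\<sigma> \<in> \<T>"
  shows "M_eps_h \<Omega> \<T> k0 \<epsilon> w0 (elem_mean \<T> u) constant_on \<sigma>"
proof -
  note c = grad_piecewise_const[OF nodal_interp(1)[of w0] assms]
    elem_mean_const[OF assms, of "nodal_interp \<Omega> \<T> w0"] elem_mean_const[OF assms, of u]
  have "(\<lambda>x. (grad (nodal_interp \<Omega> \<T> w0) x, elem_mean \<T> (nodal_interp \<Omega> \<T> w0) x)) constant_on \<sigma>"
    using constant_on_comb[OF c(1,2), of Pair] .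
  from constant_on_comb[OF this c(3), of "\<lambda>(a, b) c. ramp k0 \<epsilon> (max k0 (norm a)) b c"]
  show ?thesis by (simp add: M_eps_h_def[abs_def])
qed

lemma U_h_cong:
  assumes "u \<in> U_h \<Omega> \<T>" "\<And>x. x \<in> closure \<Omega> \<Longrightarrow> v x = u x"
  shows "v \<in> U_h \<Omega> \<T>"
proof -
  have "continuous_on (closure \<Omega>) v" using U_h_continuous[OF assms(1)] assms(2) by (simp cong: continuous_on_cong)
  moreover have "\<exists>a b. \<forall>x\<in>\<sigma>. v x = a \<bullet> x + b" if "\<sigma> \<in> \<T>" for \<sigma>
  proof -
    have "\<forall>x\<in>\<sigma>. v x = u x" using assms(2) elem_subset[OF that] dom_subset_closure by blast
    then show ?thesis using assms(1) that by (auto simp: U_h_def)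
  qed
  ultimately show ?thesis by (simp add: U_h_def)
qed

end

lemma (in convex_domain) M_eps_continuous:
  assumes "0 < \<epsilon>" "C1_closure \<Omega> w0 g" "continuous_on (closure \<Omega>) u"
  shows "continuous_on (closure \<Omega>) (M_eps k0 \<epsilon> w0 g u)"
  unfolding M_eps_def[abs_def] ramp_eq[OF assms(1)] using assms
  by (auto simp: C1_closure_def intro!: continuous_intros)

lemma (in mesh_sequence) M_eps_h_conv:
  assumes pos: "0 < \<epsilon>" and w0: "C1_closure \<Omega> w0 g"
    and u: "\<And>j. continuous_on (closure \<Omega>) (u j)" "continuous_on (closure \<Omega>) v"
    and lim: "uniform_limit (closure \<Omega>) u v sequentially" and e: "0 < e"
  shows "\<forall>\<^sub>F j in sequentially. \<forall>\<sigma>\<in>\<T> j. \<forall>x\<in>\<sigma>.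
    \<bar>M_eps_h \<Omega> (\<T> j) k0 \<epsilon> w0 (elem_mean (\<T> j) (u j)) x - M_eps k0 \<epsilon> w0 g v x\<bar> \<le> e"
proof -
  have gc: "continuous_on (closure \<Omega>) g" and w0c: "continuous_on (closure \<Omega>) w0"
    using w0 by (auto simp: C1_closure_def)
  obtain D where D: "0 \<le> D" "\<And>x. x \<in> closure \<Omega> \<Longrightarrow> norm (g x) \<le> D" using continuous_bounded[OF gc] by blast
  define L where "L = \<bar>k0\<bar> + \<bar>k0\<bar> + D"
  have L: "0 \<le> L" using D by (simp add: L_def)
  \<comment> \<open>Chosen so that the bound from \<open>ramp_diff\<close>, with all three errors at
    most \<open>c\<close> and slope factor at most \<open>L\<close>, adds up to exactly
    \<open>e\<close>.\<close>
  define c where "c = e / (1 + 2 * L / \<epsilon>)"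
  have den: "0 < 1 + 2 * L / \<epsilon>" using L pos by (simp add: add_pos_nonneg)
  then have c: "0 < c" using e by (simp add: c_def)
  have ce: "c + L * ((c + c) / \<epsilon>) = e"
  proof -
    have "c + L * ((c + c) / \<epsilon>) = c * (1 + 2 * L / \<epsilon>)" by (simp add: algebra_simps)
    also have "\<dots> = e" using den by (simp add: c_def)
    finally show ?thesis .
  qed
  have nc: "continuous_on (closure \<Omega>) (nodal_interp \<Omega> (\<T> j) w0)" for j
    using convex_mesh.U_h_continuous[OF mesh_at convex_mesh.nodal_interp(1)[OF mesh_at]] .
  show ?thesis
    using nodal_interp_conv(2)[OF w0 c] elem_mean_conv[OF nc w0c nodal_interp_conv(1)[OF w0] c]
      elem_mean_conv[OF u lim c]
  proof eventually_elim
    case (elim j)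
    show ?case
    proof (intro ballI)
      fix \<sigma> x assume \<sigma>: "\<sigma> \<in> \<T> j" "x \<in> \<sigma>"
      have x: "x \<in> closure \<Omega>" using elem_closure \<sigma> by blast
      let ?G = "grad (nodal_interp \<Omega> (\<T> j) w0) x"
      have "\<bar>max k0 (norm ?G) - max k0 (norm (g x))\<bar> \<le> norm (?G - g x)"
        using norm_triangle_ineq3[of ?G "g x"] by (auto simp: max_def)
      then have 1: "\<bar>max k0 (norm ?G) - max k0 (norm (g x))\<bar> \<le> c" using elim(1) \<sigma> by force
      have 2: "\<bar>k0 - max k0 (norm (g x))\<bar> \<le> L" using D(2)[OF x] D(1) by (auto simp: L_def max_def)
      have 3: "\<bar>elem_mean (\<T> j) (nodal_interp \<Omega> (\<T> j) w0) x - w0 x\<bar> \<le> c" "\<bar>elem_mean (\<T> j) (u j) x - v x\<bar> \<le> c"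
        using elim(2,3) \<sigma> by blast+
      have "\<bar>M_eps_h \<Omega> (\<T> j) k0 \<epsilon> w0 (elem_mean (\<T> j) (u j)) x - M_eps k0 \<epsilon> w0 g v x\<bar>
        \<le> \<bar>max k0 (norm ?G) - max k0 (norm (g x))\<bar> + \<bar>k0 - max k0 (norm (g x))\<bar> *
          ((\<bar>elem_mean (\<T> j) (nodal_interp \<Omega> (\<T> j) w0) x - w0 x\<bar> + \<bar>elem_mean (\<T> j) (u j) x - v x\<bar>) / \<epsilon>)"
        unfolding M_eps_h_def M_eps_def by (rule ramp_diff[OF pos])
      also have "\<dots> \<le> c + L * ((c + c) / \<epsilon>)"
        using 1 2 3 pos L by (intro add_mono mult_mono divide_right_mono) auto
      finally show "\<bar>M_eps_h \<Omega> (\<T> j) k0 \<epsilon> w0 (elem_mean (\<T> j) (u j)) x - M_eps k0 \<epsilon> w0 g v x\<bar> \<le> e"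
        using ce by simp
    qed
  qed
qed

text \<open>One time level: primes mark the previous level, \<open>F\<close> is the mean load, and \<open>m\<close>, \<open>M\<close> stand for
  \<open>M\<^sub>\<epsilon>\<^sup>h(P\<^sup>hW)\<close> and \<open>M\<^sub>\<epsilon>(w)\<close>.\<close>

locale discrete_step = mesh_sequence \<Omega> \<T> d \<kappa> for \<Omega> :: "(real ^ 'n) set" and \<T> d \<kappa> +
  fixes k0 \<tau> :: real and F w w' M :: "real ^ 'n \<Rightarrow> real"
    and W W' m :: "nat \<Rightarrow> real ^ 'n \<Rightarrow> real" and Q :: "nat \<Rightarrow> real ^ 'n \<Rightarrow> real ^ 'n"
  assumes W: "\<And>j. W j \<in> U_h0 \<Omega> (\<T> j)"
    and limW: "uniform_limit (closure \<Omega>) W w sequentially" and w: "continuous_on (closure \<Omega>) w"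
    and limW': "uniform_limit (closure \<Omega>) W' w' sequentially" and w': "continuous_on (closure \<Omega>) w'"
    and F: "F \<in> L2_space \<Omega>" and Q: "\<And>j. Q j \<in> S_h (\<T> j)"
    and equation: "\<And>j \<eta>. \<eta> \<in> U_h0 \<Omega> (\<T> j) \<Longrightarrow>
      lumped_inner (\<T> j) (\<lambda>x. (W j x - W' j x) / \<tau>) \<eta> - L2_inner \<Omega> (Q j) (grad \<eta>) = L2_inner \<Omega> F \<eta>"
    and inequality: "\<And>j v. v \<in> S_h (\<T> j) \<Longrightarrow>
      L2_inner \<Omega> (m j) (\<lambda>x. norm (v x) - norm (Q j x)) + L2_inner \<Omega> (grad (W j)) (\<lambda>x. v x - Q j x) \<ge> 0"
    and m_const: "\<And>j \<sigma>. \<sigma> \<in> \<T> j \<Longrightarrow> m j constant_on \<sigma>"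
    and m_ge: "0 < k0" "\<And>j x. k0 \<le> m j x"
    and m_conv: "\<And>e. 0 < e \<Longrightarrow> \<forall>\<^sub>F j in sequentially. \<forall>\<sigma>\<in>\<T> j. \<forall>x\<in>\<sigma>. \<bar>m j x - M x\<bar> \<le> e"
    and M: "continuous_on (closure \<Omega>) M" "\<And>x. x \<in> closure \<Omega> \<Longrightarrow> k0 \<le> M x"
begin

lemma W_U_h: "W j \<in> U_h \<Omega> (\<T> j)"
  using W by (simp add: U_h0_def)

lemma W_continuous: "continuous_on (closure \<Omega>) (W j)"
  using convex_mesh.U_h_continuous[OF mesh_at W_U_h] .

lemma Q_const: "\<sigma> \<in> \<T> j \<Longrightarrow> Q j constant_on \<sigma>"
  using Q by (simp add: S_h_def)

lemma grad_const: "\<sigma> \<in> \<T> j \<Longrightarrow> grad (W j) constant_on \<sigma>"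
  using convex_mesh.grad_piecewise_const[OF mesh_at W_U_h] .

lemma flux_law:
  assumes "\<sigma> \<in> \<T> j" "x \<in> \<sigma>"
  shows "norm (grad (W j) x) \<le> m j x" "m j x * norm (Q j x) + grad (W j) x \<bullet> Q j x = 0"
  using convex_mesh.variational_inequality_elementwise[OF mesh_at m_const grad_const Q inequality assms] by auto

lemma w_zero: "x \<in> frontier \<Omega> \<Longrightarrow> w x = 0"
proof -
  assume x: "x \<in> frontier \<Omega>"
  then have "x \<in> closure \<Omega>" by (simp add: frontier_def)
  then have "(\<lambda>j. W j x) \<longlonglongrightarrow> w x" using tendsto_uniform_limitI[OF limW] by blast
  moreover have "W j x = 0" for j using W[of j] x by (simp add: U_h0_def W1inf_0_def)
  ultimately show "w x = 0" by (simp add: LIMSEQ_const_iff)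
qed

lemma w_segment_bound:
  assumes "x \<in> closure \<Omega>" "y \<in> closure \<Omega>" "0 \<le> B" "\<And>z. z \<in> closed_segment x y \<Longrightarrow> M z \<le> B"
  shows "\<bar>w x - w y\<bar> \<le> B * norm (x - y)"
proof (rule segment_bound_limit[OF W_U_h limW M(1) _ assms])
  fix e :: real assume "0 < e"
  from m_conv[OF this]
  show "\<forall>\<^sub>F j in sequentially. \<forall>\<sigma>\<in>\<T> j. \<forall>x\<in>\<sigma>. norm (grad (W j) x) \<le> M x + e"
    by eventually_elim (use flux_law(1) in force)
qed

lemma Q_integrable: "integrable (lebesgue_on \<Omega>) (Q j)" "integrable (lebesgue_on \<Omega>) (\<lambda>x. norm (Q j x))"
  "integrable (lebesgue_on \<Omega>) (\<lambda>x. Q j x $ i)"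
  using convex_mesh.piecewise_const_integrable[OF mesh_at Q_const, of j]
  by (auto intro: integrable_bounded_linear[OF bounded_linear_vec_nth])

lemma m_Q_integrable: "integrable (lebesgue_on \<Omega>) (\<lambda>x. norm (Q j x) * m j x)"
  by (rule convex_mesh.piecewise_const_integrable[OF mesh_at])
    (rule constant_on_comb[where h="\<lambda>a b. norm a * b", OF Q_const m_const])

text \<open>The flux law identifies \<open>(m, |Q|)\<close> with \<open>- (Q, \<nabla>W)\<close>,
  and \<open>W j\<close> is itself an admissible test function in the discrete equation.\<close>

lemma energy: "(\<integral>x. norm (Q j x) * m j x \<partial>lebesgue_on \<Omega>)
    = L2_inner \<Omega> F (W j) - lumped_inner (\<T> j) (\<lambda>x. (W j x - W' j x) / \<tau>) (W j)"
proof -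
  have "(\<integral>x. norm (Q j x) * m j x \<partial>lebesgue_on \<Omega>) = (\<integral>x. - (Q j x \<bullet> grad (W j) x) \<partial>lebesgue_on \<Omega>)"
  proof (rule integral_cong_AE)
    have "(\<lambda>x. - (Q j x \<bullet> grad (W j) x)) constant_on \<sigma>" if "\<sigma> \<in> \<T> j" for \<sigma>
      by (rule constant_on_comb[where h="\<lambda>a b. - (a \<bullet> b)", OF Q_const[OF that] grad_const[OF that]])
    then show "(\<lambda>x. - (Q j x \<bullet> grad (W j) x)) \<in> borel_measurable (lebesgue_on \<Omega>)"
      using convex_mesh.piecewise_const_integrable[OF mesh_at] by blast
    show "AE x in lebesgue_on \<Omega>. norm (Q j x) * m j x = - (Q j x \<bullet> grad (W j) x)"
      using convex_mesh.AE_mesh[OF mesh_at, of j]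
    proof eventually_elim
      case (elim x)
      then obtain \<sigma> where "\<sigma> \<in> \<T> j" "x \<in> \<sigma>" by auto
      from flux_law(2)[OF this] show ?case by (simp add: inner_commute mult.commute)
    qed
  qed (use m_Q_integrable in auto)
  also have "\<dots> = - L2_inner \<Omega> (Q j) (grad (W j))" by (simp add: L2_inner_def)
  also have "\<dots> = L2_inner \<Omega> F (W j) - lumped_inner (\<T> j) (\<lambda>x. (W j x - W' j x) / \<tau>) (W j)"
    using equation[OF W, of j] by linarith
  finally show ?thesis .
qed

text \<open>The divergence that the limit equation prescribes. It depends only on the load and on
  the limits of the iterates, so it is available before any limit of the fluxes.\<close>

definition divq :: "real ^ 'n \<Rightarrow> real" where
  "divq x = F x - (w x - w' x) / \<tau>"

lemma incr_continuous: "continuous_on (closure \<Omega>) (\<lambda>x. (w x - w' x) / \<tau>)"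
  unfolding divide_inverse by (intro continuous_intros w w')

lemma incr_limit: "uniform_limit (closure \<Omega>) (\<lambda>j x. (W j x - W' j x) / \<tau>) (\<lambda>x. (w x - w' x) / \<tau>) sequentially"
  using bounded_linear.uniform_limit[OF bounded_linear_divide uniform_limit_minus[OF limW limW']] .

lemma divq_L2: "divq \<in> L2_space \<Omega>"
  unfolding divq_def[abs_def] by (rule L2_space_diff[OF F continuous_L2_space[OF incr_continuous]])

lemma L2_inner_divq:
  assumes "\<eta> \<in> L2_space \<Omega>"
  shows "L2_inner \<Omega> divq \<eta> = L2_inner \<Omega> F \<eta> - L2_inner \<Omega> (\<lambda>x. (w x - w' x) / \<tau>) \<eta>"
  using L2_space_mult_integrable[OF F assms] L2_space_mult_integrable[OF continuous_L2_space[OF incr_continuous] assms]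
  unfolding L2_inner_def divq_def inner_real_def left_diff_distrib by (rule Bochner_Integration.integral_diff)

text \<open>Used twice: with the iterates themselves for the energy, and with nodal interpolants of
  a test function for the divergence of the limit flux.\<close>

lemma load_limit:
  assumes "\<And>j. continuous_on (closure \<Omega>) (\<eta> j)" "continuous_on (closure \<Omega>) \<zeta>"
    "uniform_limit (closure \<Omega>) \<eta> \<zeta> sequentially"
  shows "(\<lambda>j. L2_inner \<Omega> F (\<eta> j) - lumped_inner (\<T> j) (\<lambda>x. (W j x - W' j x) / \<tau>) (\<eta> j)) \<longlonglongrightarrow> L2_inner \<Omega> divq \<zeta>"
proof -
  have "(\<lambda>j. L2_inner \<Omega> F (\<eta> j)) \<longlonglongrightarrow> L2_inner \<Omega> F \<zeta>"
    unfolding L2_innerI by (rule tendsto_integral_uniform_limit[OF L2_space_integrable[OF F] assms])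
  from tendsto_diff[OF this lumped_conv[OF incr_continuous assms(2) incr_limit assms(3)]]
  show ?thesis by (simp add: L2_inner_divq[OF continuous_L2_space[OF assms(2)]])
qed

lemma energy_limit:
  "(\<lambda>j. \<integral>x. norm (Q j x) * m j x \<partial>lebesgue_on \<Omega>) \<longlonglongrightarrow> L2_inner \<Omega> divq w"
  unfolding energy by (rule load_limit[OF W_continuous w limW])

text \<open>The convergent energies are bounded, and the lower bound \<open>k0\<close> of the weight
  makes them control the L1 norm.\<close>

lemma Q_bounded: "\<exists>C. \<forall>j. (\<integral>x. norm (Q j x) \<partial>lebesgue_on \<Omega>) \<le> C"
proof -
  have "Bseq (\<lambda>j. \<integral>x. norm (Q j x) * m j x \<partial>lebesgue_on \<Omega>)"
    using energy_limit by (intro convergent_imp_Bseq) (auto simp: convergent_def)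
  then obtain C where C: "\<And>j. \<bar>\<integral>x. norm (Q j x) * m j x \<partial>lebesgue_on \<Omega>\<bar> \<le> C"
    by (auto simp: Bseq_def)
  have "(\<integral>x. norm (Q j x) \<partial>lebesgue_on \<Omega>) \<le> C / k0" for j
  proof -
    have "(\<integral>x. norm (Q j x) * k0 \<partial>lebesgue_on \<Omega>) \<le> (\<integral>x. norm (Q j x) * m j x \<partial>lebesgue_on \<Omega>)"
      using Q_integrable m_Q_integrable m_ge by (intro integral_mono) (auto intro!: mult_left_mono)
    also have "\<dots> \<le> C" using C[of j] by linarith
    finally show ?thesis using m_ge(1) by (simp add: field_simps)
  qed
  then show ?thesis by blast
qed

lemma Q_component_bounded:
  assumes "\<And>j. (\<integral>x. norm (Q j x) \<partial>lebesgue_on \<Omega>) \<le> C"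
  shows "(\<integral>x. \<bar>Q j x $ i\<bar> \<partial>lebesgue_on \<Omega>) \<le> C"
proof (rule order_trans[OF _ assms[of j]])
  show "(\<integral>x. \<bar>Q j x $ i\<bar> \<partial>lebesgue_on \<Omega>) \<le> (\<integral>x. norm (Q j x) \<partial>lebesgue_on \<Omega>)"
    using Q_integrable by (intro integral_mono) (auto intro: component_le_norm_cart)
qed

text \<open>Replaces the mesh-dependent weight by the fixed continuous one, as semicontinuity
  compares the fluxes against a single weight; L1-boundedness of \<open>Q\<close> makes the
  replacement harmless.\<close>

lemma tendsto_M_Q: "(\<lambda>j. \<integral>x. norm (Q j x) * M x \<partial>lebesgue_on \<Omega>) \<longlonglongrightarrow> L2_inner \<Omega> divq w"
proof -
  obtain C where C: "\<And>j. (\<integral>x. norm (Q j x) \<partial>lebesgue_on \<Omega>) \<le> C" using Q_bounded by blast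
  have "(\<lambda>j. (\<integral>x. norm (Q j x) * m j x \<partial>lebesgue_on \<Omega>) - (\<integral>x. norm (Q j x) * M x \<partial>lebesgue_on \<Omega>)) \<longlonglongrightarrow> 0"
  proof (rule tendsto_integral_uniform[OF Q_integrable(2) _ m_Q_integrable M(1)])
    show "(\<integral>x. \<bar>norm (Q j x)\<bar> \<partial>lebesgue_on \<Omega>) \<le> C" for j using C by simp
    fix e :: real assume "0 < e"
    from m_conv[OF this] show "\<forall>\<^sub>F j in sequentially. AE x in lebesgue_on \<Omega>. \<bar>m j x - M x\<bar> \<le> e"
    proof eventually_elim
      case (elim j)
      show ?case using convex_mesh.AE_mesh[OF mesh_at, of j] by eventually_elim (use elim in blast)
    qed
  qed
  from tendsto_diff[OF energy_limit this] show ?thesis by simp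
qed

context
  fixes q :: "'n vmeasure"
  assumes q: "q \<in> vector_radon_measures (closure \<Omega>)"
    and vague: "vague_conv (closure \<Omega>) (\<lambda>j. L1_vmeasure \<Omega> (Q j)) q"
begin

lemma pairing_limit:
  assumes "continuous_on (closure \<Omega>) \<phi>"
  shows "(\<lambda>j. \<Sum>i\<in>UNIV. \<integral>x. Q j x $ i * \<phi> x $ i \<partial>lebesgue_on \<Omega>) \<longlonglongrightarrow> pairing q \<phi>"
  unfolding pairing_def
proof (rule tendsto_sum)
  fix i :: 'n
  have "continuous_on (closure \<Omega>) (\<lambda>x. \<phi> x $ i)" using assms by (intro continuous_intros)
  then show "(\<lambda>j. \<integral>x. Q j x $ i * \<phi> x $ i \<partial>lebesgue_on \<Omega>) \<longlonglongrightarrow> (q $ i) (\<lambda>x. \<phi> x $ i)"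
    using vague by (simp add: vague_conv_def L1_vmeasure_def)
qed

lemma inner_Q_eq_sum:
  assumes "\<And>i. integrable (lebesgue_on \<Omega>) (\<lambda>x. Q j x $ i * \<phi> x $ i)"
  shows "(\<integral>x. Q j x \<bullet> \<phi> x \<partial>lebesgue_on \<Omega>) = (\<Sum>i\<in>UNIV. \<integral>x. Q j x $ i * \<phi> x $ i \<partial>lebesgue_on \<Omega>)"
  unfolding inner_vec_def inner_real_def using assms by (rule Bochner_Integration.integral_sum)

text \<open>A test function enters the discrete equation through its nodal interpolant. The
  gradients of the interpolants converge uniformly on the elements, which is strong enough against
  fluxes that are bounded only in L1.\<close>

lemma has_measure_div_limit: "has_measure_div \<Omega> q divq"
  unfolding has_measure_div_def
proof (intro conjI ballI divq_L2)
  fix \<phi> assume \<phi>: "\<phi> \<in> C1_compact \<Omega>"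
  note C1 = C1_compact_C1_closure[OF \<phi>]
  have c: "continuous_on (closure \<Omega>) \<phi>" "continuous_on (closure \<Omega>) (grad \<phi>)" using C1 by (auto simp: C1_closure_def)
  define \<eta> where "\<eta> j = nodal_interp \<Omega> (\<T> j) \<phi>" for j
  have \<eta>0: "\<eta> j \<in> U_h0 \<Omega> (\<T> j)" for j
    unfolding \<eta>_def by (rule convex_mesh.nodal_interp_C1_compact[OF mesh_at \<phi>])
  then have \<eta>: "\<eta> j \<in> U_h \<Omega> (\<T> j)" for j by (simp add: U_h0_def)
  have \<eta>c: "continuous_on (closure \<Omega>) (\<eta> j)" for j using convex_mesh.U_h_continuous[OF mesh_at \<eta>] .
  note conv = nodal_interp_conv[OF C1, folded \<eta>_def]
  have "L2_inner \<Omega> F (\<eta> j) - lumped_inner (\<T> j) (\<lambda>x. (W j x - W' j x) / \<tau>) (\<eta> j)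
      = - L2_inner \<Omega> (Q j) (grad (\<eta> j))" for j
    using equation[OF \<eta>0, of j] by linarith
  then have 1: "(\<lambda>j. - L2_inner \<Omega> (Q j) (grad (\<eta> j))) \<longlonglongrightarrow> L2_inner \<Omega> divq \<phi>"
    using load_limit[OF \<eta>c c(1) conv(1)] by simp
  obtain C where C: "\<And>j. (\<integral>x. norm (Q j x) \<partial>lebesgue_on \<Omega>) \<le> C" using Q_bounded by blast
  have int: "integrable (lebesgue_on \<Omega>) (\<lambda>x. Q j x $ i * grad (\<eta> j) x $ i)" for i j
  proof (rule convex_mesh.piecewise_const_integrable[OF mesh_at])
    fix \<sigma> assume "\<sigma> \<in> \<T> j"
    then show "(\<lambda>x. Q j x $ i * grad (\<eta> j) x $ i) constant_on \<sigma>"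
      by (intro constant_on_comb[where h="\<lambda>a b. a $ i * b $ i"] Q_const
        convex_mesh.grad_piecewise_const[OF mesh_at \<eta>])
  qed
  have "(\<lambda>j. (\<integral>x. Q j x $ i * grad (\<eta> j) x $ i \<partial>lebesgue_on \<Omega>) - (\<integral>x. Q j x $ i * grad \<phi> x $ i \<partial>lebesgue_on \<Omega>)) \<longlonglongrightarrow> 0" for i
  proof (rule tendsto_integral_uniform[OF Q_integrable(3) Q_component_bounded[OF C] int])
    show "continuous_on (closure \<Omega>) (\<lambda>x. grad \<phi> x $ i)" using c by (intro continuous_intros)
    fix e :: real assume "0 < e"
    from conv(2)[OF this]
    show "\<forall>\<^sub>F j in sequentially. AE x in lebesgue_on \<Omega>. \<bar>grad (\<eta> j) x $ i - grad \<phi> x $ i\<bar> \<le> e"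
    proof eventually_elim
      case (elim j)
      show ?case using convex_mesh.AE_mesh[OF mesh_at, of j]
      proof eventually_elim
        case (elim x)
        then have "norm (grad (\<eta> j) x - grad \<phi> x) \<le> e"
          using \<open>\<forall>\<sigma>\<in>\<T> j. \<forall>x\<in>\<sigma>. norm (grad (\<eta> j) x - grad \<phi> x) \<le> e\<close> by blast
        then show ?case using component_le_norm_cart[of "grad (\<eta> j) x - grad \<phi> x" i] by simp
      qed
    qed
  qed
  then have "(\<lambda>j. \<Sum>i\<in>UNIV. (\<integral>x. Q j x $ i * grad (\<eta> j) x $ i \<partial>lebesgue_on \<Omega>)
      - (\<integral>x. Q j x $ i * grad \<phi> x $ i \<partial>lebesgue_on \<Omega>)) \<longlonglongrightarrow> (\<Sum>i\<in>(UNIV :: 'n set). 0)"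
    by (intro tendsto_sum)
  then have "(\<lambda>j. L2_inner \<Omega> (Q j) (grad (\<eta> j)) - (\<Sum>i\<in>UNIV. \<integral>x. Q j x $ i * grad \<phi> x $ i \<partial>lebesgue_on \<Omega>)) \<longlonglongrightarrow> 0"
    by (simp add: L2_inner_def inner_Q_eq_sum[OF int] sum_subtractf)
  from tendsto_add[OF this pairing_limit[OF c(2)]]
  have "(\<lambda>j. L2_inner \<Omega> (Q j) (grad (\<eta> j))) \<longlonglongrightarrow> pairing q (grad \<phi>)" by simp
  from LIMSEQ_unique[OF tendsto_minus[OF this] 1]
  show "pairing q (grad \<phi>) = - L2_inner \<Omega> divq \<phi>" by simp
qed

text \<open>For each admissible field \<open>(Q, \<phi>) \<le> (|Q|, M)\<close>, and both sides
  converge; the supremum is taken only afterwards. The fields need not vanish on the boundary, so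
  mass that concentrates there is counted.\<close>

lemma total_variation_limit_le: "total_variation (closure \<Omega>) q M \<le> L2_inner \<Omega> divq w"
proof (rule total_variation_le[OF q])
  show "closure \<Omega> \<noteq> {}" using dom_ne by simp
  show M0: "0 \<le> M x" if "x \<in> closure \<Omega>" for x using M(2)[OF that] m_ge(1) by linarith
  fix \<phi> :: "real ^ 'n \<Rightarrow> real ^ 'n"
  assume \<phi>: "continuous_on (closure \<Omega>) \<phi>" "\<And>x. x \<in> closure \<Omega> \<Longrightarrow> norm (\<phi> x) \<le> M x"
  have int: "integrable (lebesgue_on \<Omega>) (\<lambda>x. Q j x $ i * \<phi> x $ i)" for i j
    using \<phi>(1) by (intro integrable_mult_continuous Q_integrable continuous_intros)
  have "(\<Sum>i\<in>UNIV. \<integral>x. Q j x $ i * \<phi> x $ i \<partial>lebesgue_on \<Omega>) \<le> (\<integral>x. norm (Q j x) * M x \<partial>lebesgue_on \<Omega>)" for j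
    unfolding inner_Q_eq_sum[OF int, symmetric]
  proof (rule integral_mono)
    show "integrable (lebesgue_on \<Omega>) (\<lambda>x. Q j x \<bullet> \<phi> x)"
      unfolding inner_vec_def inner_real_def by (intro Bochner_Integration.integrable_sum int)
    show "integrable (lebesgue_on \<Omega>) (\<lambda>x. norm (Q j x) * M x)"
      by (intro integrable_mult_continuous Q_integrable M(1))
    fix x assume "x \<in> space (lebesgue_on \<Omega>)"
    then have "norm (\<phi> x) \<le> M x" using \<phi>(2) dom_subset_closure by simp
    then have "norm (Q j x) * norm (\<phi> x) \<le> norm (Q j x) * M x" by (intro mult_left_mono) auto
    then show "Q j x \<bullet> \<phi> x \<le> norm (Q j x) * M x"
      using norm_cauchy_schwarz[of "Q j x" "\<phi> x"] by linarith
  qed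
  then show "pairing q \<phi> \<le> L2_inner \<Omega> divq w"
    by (intro LIMSEQ_le[OF pairing_limit[OF \<phi>(1)] tendsto_M_Q]) auto
qed

lemma inequality_limit:
  assumes v: "v \<in> V_M \<Omega>"
  shows "total_variation (closure \<Omega>) v M - total_variation (closure \<Omega>) q M
    - L2_inner \<Omega> (measure_div \<Omega> (v - q)) w \<ge> 0"
proof -
  obtain u where u: "v \<in> vector_radon_measures (closure \<Omega>)" "has_measure_div \<Omega> v u"
    using v by (auto simp: V_M_def)
  have uL: "u \<in> L2_space \<Omega>" using u(2) by (simp add: has_measure_div_def)
  note wL = continuous_L2_space[OF w]
  have "L2_inner \<Omega> (measure_div \<Omega> (v - q)) w = L2_inner \<Omega> (\<lambda>x. u x - divq x) w"
    by (rule L2_inner_measure_div[OF has_measure_div_diff[OF u q has_measure_div_limit] wL])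
  also have "\<dots> = L2_inner \<Omega> u w - L2_inner \<Omega> divq w"
    using L2_space_mult_integrable[OF uL wL] L2_space_mult_integrable[OF divq_L2 wL]
    unfolding L2_inner_def inner_real_def left_diff_distrib by (rule Bochner_Integration.integral_diff)
  also have "\<dots> \<le> total_variation (closure \<Omega>) v M - total_variation (closure \<Omega>) q M"
  proof -
    have "L2_inner \<Omega> u w \<le> total_variation (closure \<Omega>) v M"
      by (rule measure_div_le_total_variation[OF u w w_zero M(1) m_ge(1) M(2) w_segment_bound]; blast)
    then show ?thesis using total_variation_limit_le by linarith
  qed
  finally show ?thesis by linarith
qed

lemma equation_limit:
  assumes "\<eta> \<in> L2_space \<Omega>"
  shows "L2_inner \<Omega> (\<lambda>x. (w x - w' x) / \<tau>) \<eta> + L2_inner \<Omega> (measure_div \<Omega> q) \<eta> = L2_inner \<Omega> F \<eta>"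
  using L2_inner_measure_div[OF has_measure_div_limit assms] L2_inner_divq[OF assms] by simp

end

end

section \<open>The theorem\<close>

text \<open>A negative essential supremum would put a norm below a negative number almost
  everywhere, which is impossible on a set of positive measure.\<close>

lemma (in convex_domain) Linf_norm_nonneg: "0 \<le> Linf_norm \<Omega> u"
proof (rule ccontr)
  assume *: "\<not> 0 \<le> Linf_norm \<Omega> u"
  have "AE x in lebesgue_on \<Omega>. ereal (norm (u x)) \<le> Linf_norm \<Omega> u"
    unfolding Linf_norm_def by (rule esssup_AE)
  then have "AE x in lebesgue_on \<Omega>. False"
    by eventually_elim (use * in \<open>meson ereal_less_eq(5) norm_ge_zero order_trans\<close>)
  moreover have "\<not> negligible \<Omega>" using open_dom dom_ne by (rule open_not_negligible)
  then have "\<not> (AE x in lebesgue_on \<Omega>. False)"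
    using lebesgue_dom by (simp add: AE_iff_null_sets[of "\<Omega>" "lebesgue_on \<Omega>", simplified] AE_restrict_space_iff
      negligible_iff_null_sets AE_iff_null_sets)
  ultimately show False by blast
qed

lemma (in convex_domain) Linf_norm_tendsto_zero:
  assumes meas: "\<And>j. u j \<in> borel_measurable (lebesgue_on \<Omega>)"
    and lim: "\<And>e. 0 < e \<Longrightarrow> \<forall>\<^sub>F j in sequentially. AE x in lebesgue_on \<Omega>. norm (u j x) \<le> e"
  shows "(\<lambda>j. Linf_norm \<Omega> (u j)) \<longlonglongrightarrow> 0"
proof (rule order_tendstoI)
  fix a :: ereal assume "a < 0"
  then show "\<forall>\<^sub>F j in sequentially. a < Linf_norm \<Omega> (u j)"
    using Linf_norm_nonneg by (intro always_eventually allI) (rule order_less_le_trans)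
next
  fix a :: ereal assume "0 < a"
  then obtain e where e: "0 < ereal e" "ereal e < a" using ereal_dense2 by blast
  then have "0 < e" by simp
  from lim[OF this] show "\<forall>\<^sub>F j in sequentially. Linf_norm \<Omega> (u j) < a"
  proof eventually_elim
    case (elim j)
    then have "Linf_norm \<Omega> (u j) \<le> ereal e"
      unfolding Linf_norm_def using meas by (intro esssup_I) auto
    then show ?case using e(2) by (rule order_le_less_trans)
  qed
qed

theorem theorem3p1:
  fixes \<Omega> :: "(real ^ 'n) set"
    and T k0 \<epsilon> :: real
    and f :: "real \<Rightarrow> real ^ 'n \<Rightarrow> real"
    and w0 :: "real ^ 'n \<Rightarrow> real"
    and Dw0 :: "real ^ 'n \<Rightarrow> real ^ 'n"
    and N :: nat
    and t :: "nat \<Rightarrow> real"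
    and H :: "real set"
    and \<T> :: "real \<Rightarrow> (real ^ 'n) set set"
    and W :: "real \<Rightarrow> nat \<Rightarrow> real ^ 'n \<Rightarrow> real"
    and Q :: "real \<Rightarrow> nat \<Rightarrow> real ^ 'n \<Rightarrow> real ^ 'n"
  assumes dim: "CARD('n) \<in> {1, 2}"
    and domain: "convex_polygonal_domain \<Omega>"
    and pos: "T > 0" "k0 > 0" "\<epsilon> > 0"
    and f_L2: "f \<in> L2_time_space T \<Omega>"
    and f_nonneg: "AE (s, x) in lebesgue_on {0<..<T} \<Otimes>\<^sub>M lebesgue_on \<Omega>. f s x \<ge> 0"
    and w0_W: "w0 \<in> W1inf_0 \<Omega>"
    and w0_C1: "C1_closure \<Omega> w0 Dw0"
    and w0_normal: "\<forall>x \<nu>. outward_unit_normal \<Omega> x \<nu> \<longrightarrow> Dw0 x \<bullet> \<nu> < k0"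
    and times: "time_partition T N t"
    and meshes: "regular_mesh_family \<Omega> H \<T>"
    and discrete: "\<forall>h\<in>H. solves_Q_A \<Omega> (\<T> h) k0 \<epsilon> w0 N t f (W h) (Q h)"
  shows "\<exists>(hs :: nat \<Rightarrow> real) (w :: nat \<Rightarrow> real ^ 'n \<Rightarrow> real) (q :: nat \<Rightarrow> 'n vmeasure).
    (\<forall>j. hs j \<in> H) \<and> hs \<longlonglongrightarrow> 0 \<and>
    solves_Q_tau \<Omega> k0 \<epsilon> w0 Dw0 N t f w q \<and>
    (\<forall>n\<in>{0..N}. weak_star_Linf \<Omega> (\<lambda>j. grad (W (hs j) n)) (weak_grad \<Omega> (w n))) \<and>
    (\<forall>n\<in>{0..N}. uniform_limit (closure \<Omega>) (\<lambda>j. W (hs j) n) (w n) sequentially) \<and>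
    (\<forall>n\<in>{0..N}. (\<lambda>j. Linf_norm \<Omega> (\<lambda>x.
        M_eps_h \<Omega> (\<T> (hs j)) k0 \<epsilon> w0 (elem_mean (\<T> (hs j)) (W (hs j) n)) x
          - M_eps k0 \<epsilon> w0 Dw0 (w n) x)) \<longlonglongrightarrow> 0) \<and>
    (\<forall>n\<in>{1..N}. vague_conv (closure \<Omega>) (\<lambda>j. L1_vmeasure \<Omega> (Q (hs j) n)) (q n))"
proof -
  interpret convex_domain \<Omega> by unfold_locales (rule domain)
  let ?K = "closure \<Omega>"
  define m where "m h n = M_eps_h \<Omega> (\<T> h) k0 \<epsilon> w0 (elem_mean (\<T> h) (W h n))" for h n
  define F where "F = time_mean t f"
  obtain \<kappa> where \<kappa>: "0 < \<kappa>" "\<And>h \<sigma>. h \<in> H \<Longrightarrow> \<sigma> \<in> \<T> h \<Longrightarrow> \<exists>x. ball x (\<kappa> * diameter \<sigma>) \<subseteq> \<sigma>"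
    using meshes by (auto simp: regular_mesh_family_def)
  have mesh: "simplicial_mesh \<Omega> (\<T> h)" "mesh_size (\<T> h) = h" if "h \<in> H" for h
    using meshes that by (auto simp: regular_mesh_family_def)
  have cm: "convex_mesh \<Omega> (\<T> h)" if "h \<in> H" for h using mesh(1)[OF that] by unfold_locales
  have ms: "mesh_sequence \<Omega> (\<lambda>j. \<T> (hs j)) hs \<kappa>" if "\<And>j. hs j \<in> H" "hs \<longlonglongrightarrow> 0" for hs
  proof unfold_locales
    fix j \<sigma> assume \<sigma>: "\<sigma> \<in> \<T> (hs j)"
    have "finite (\<T> (hs j))" using mesh(1)[OF that(1)] by (simp add: simplicial_mesh_def)
    then show "diameter \<sigma> \<le> hs j"
      using mesh(2)[OF that(1)[of j]] \<sigma> by (metis Max_ge finite_imageI image_eqI mesh_size_def)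
  qed (use that mesh \<kappa>(1) \<kappa>(2)[OF that(1)] in blast)+
  have step_pos: "0 < time_step t n" if "n \<in> {1..N}" for n
    using times that by (cases n) (auto simp: time_partition_def time_step_def)
  have t_mono: "t i \<le> t j" if "i \<le> j" "j \<le> N" for i j
    using that
  proof (induction rule: dec_induct)
    case (step k)
    then have "t k < t (Suc k)" using times by (auto simp: time_partition_def)
    then show ?case using step by simp
  qed simp
  have F_L2: "F n \<in> L2_space \<Omega>" if "n \<in> {1..N}" for n
  proof -
    have "0 \<le> t (n - 1)" "t n \<le> T"
      using t_mono[of 0 "n - 1"] t_mono[of n N] times that by (auto simp: time_partition_def)
    from time_mean_L2_space[OF f_L2 this] show ?thesis unfolding F_def time_mean_def .
  qed
  have sol0: "W h 0 x = nodal_interp \<Omega> (\<T> h) w0 x" if "h \<in> H" "x \<in> ?K" for h x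
    using discrete that by (auto simp: solves_Q_A_def)
  have sol: "W h n \<in> U_h0 \<Omega> (\<T> h)" "Q h n \<in> S_h (\<T> h)"
    "\<And>\<eta>. \<eta> \<in> U_h0 \<Omega> (\<T> h) \<Longrightarrow> lumped_inner (\<T> h) (\<lambda>x. (W h n x - W h (n - 1) x) / time_step t n) \<eta>
       - L2_inner \<Omega> (Q h n) (grad \<eta>) = L2_inner \<Omega> (F n) \<eta>"
    "\<And>v. v \<in> S_h (\<T> h) \<Longrightarrow> L2_inner \<Omega> (m h n) (\<lambda>x. norm (v x) - norm (Q h n x))
       + L2_inner \<Omega> (grad (W h n)) (\<lambda>x. v x - Q h n x) \<ge> 0"
    if "h \<in> H" "n \<in> {1..N}" for h n
    using discrete that unfolding solves_Q_A_def m_def F_def by blast+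
  have WU: "W h n \<in> U_h \<Omega> (\<T> h)" if "h \<in> H" "n \<le> N" for h n
  proof (cases "n = 0")
    case True
    then show ?thesis
      using convex_mesh.U_h_cong[OF cm[OF that(1)] convex_mesh.nodal_interp(1)[OF cm[OF that(1)]] sol0[OF that(1)]] by simp
  next
    case False
    then show ?thesis using sol(1)[OF that(1), of n] that by (auto simp: U_h0_def)
  qed
  have Wc: "continuous_on ?K (W h n)" if "h \<in> H" "n \<le> N" for h n
    using convex_mesh.U_h_continuous[OF cm[OF that(1)] WU[OF that]] .
  have m_const: "m h n constant_on \<sigma>" if "h \<in> H" "\<sigma> \<in> \<T> h" for h n \<sigma>
    unfolding m_def by (rule convex_mesh.M_eps_h_const[OF cm[OF that(1)] that(2)])
  have m_ge: "k0 \<le> m h n x" for h n x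
    unfolding m_def M_eps_h_def by (rule ramp_bounds) (use pos in auto)
  have w0c: "continuous_on ?K w0" and Dw0c: "continuous_on ?K Dw0" using w0_C1 by (auto simp: C1_closure_def)
  obtain D where D: "0 \<le> D" "\<And>x. x \<in> ?K \<Longrightarrow> norm (Dw0 x) \<le> D" using continuous_bounded[OF Dw0c] by blast
  \<comment> \<open>\<open>D + 1\<close> bounds the gradients of the interpolated initial datum once
    they are within 1 of \<open>Dw0\<close>.\<close>
  define C where "C = max k0 (D + 1)"
  have C0: "0 \<le> C" using D by (simp add: C_def)
  obtain h0 where h0: "\<And>j. h0 j \<in> H" "h0 \<longlonglongrightarrow> 0"
    using meshes by (auto simp: regular_mesh_family_def islimpt_sequential)
  obtain j0 where j0: "\<And>j \<sigma> x. j0 \<le> j \<Longrightarrow> \<sigma> \<in> \<T> (h0 j) \<Longrightarrow> x \<in> \<sigma> \<Longrightarrow>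
      norm (grad (nodal_interp \<Omega> (\<T> (h0 j)) w0) x - Dw0 x) \<le> 1"
    using mesh_sequence.nodal_interp_conv(2)[OF ms[OF h0] w0_C1 zero_less_one]
    unfolding eventually_sequentially by blast
  \<comment> \<open>Dropping the first \<open>j0\<close> meshes makes the bound hold for every
    index, as the later lemmas require it.\<close>
  define h1 where "h1 j = h0 (j + j0)" for j
  have h1: "h1 j \<in> H" "h1 \<longlonglongrightarrow> 0" for j
    using h0 LIMSEQ_ignore_initial_segment[OF h0(2), of j0] by (auto simp: h1_def[abs_def])
  have interp_bound: "norm (grad (nodal_interp \<Omega> (\<T> (h1 j)) w0) x) \<le> D + 1"
    if "\<sigma> \<in> \<T> (h1 j)" "x \<in> \<sigma>" for j \<sigma> x
  proof -
    have "x \<in> \<Omega>" using convex_mesh.elem_subset[OF cm[OF h1(1)] that(1)] that(2) by blast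
    then have "norm (Dw0 x) \<le> D" using D(2) dom_subset_closure by blast
    moreover have "norm (grad (nodal_interp \<Omega> (\<T> (h1 j)) w0) x - Dw0 x) \<le> 1"
      using j0[of "j + j0" \<sigma> x] that by (simp add: h1_def)
    ultimately show ?thesis using norm_triangle_sub[of "grad (nodal_interp \<Omega> (\<T> (h1 j)) w0) x" "Dw0 x"] by linarith
  qed
  have grad_bound: "norm (grad (W (h1 j) n) x) \<le> C" if \<sigma>: "\<sigma> \<in> \<T> (h1 j)" "x \<in> \<sigma>" and n: "n \<le> N" for j \<sigma> x n
  proof (cases "n = 0")
    case True
    have "grad (W (h1 j) 0) x = grad (nodal_interp \<Omega> (\<T> (h1 j)) w0) x"
    proof (rule grad_cong_open[OF open_dom])
      show "x \<in> \<Omega>" using convex_mesh.elem_subset[OF cm[OF h1(1)] \<sigma>(1)] \<sigma>(2) by blast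
    qed (use sol0[OF h1(1)] dom_subset_closure in blast)
    then show ?thesis using interp_bound[OF \<sigma>] True by (simp add: C_def)
  next
    case False
    then have n1: "n \<in> {1..N}" using n by simp
    have "norm (grad (W (h1 j) n) x) \<le> m (h1 j) n x"
      by (rule convex_mesh.variational_inequality_elementwise(1)[OF cm[OF h1(1)] m_const[OF h1(1)]
          convex_mesh.grad_piecewise_const[OF cm[OF h1(1)] WU[OF h1(1) n]] sol(2)[OF h1(1) n1] sol(4)[OF h1(1) n1] \<sigma>])
    \<comment> \<open>The upper value of the ramp depends only on the initial datum, so the same
      constant serves at every time level.\<close>
    also have "\<dots> \<le> max k0 (norm (grad (nodal_interp \<Omega> (\<T> (h1 j)) w0) x))"
      unfolding m_def M_eps_h_def by (rule ramp_bounds) (use pos in auto)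
    also have "\<dots> \<le> C" using interp_bound[OF \<sigma>] by (auto simp: C_def)
    finally show ?thesis .
  qed
  have W_lip: "\<bar>W (h1 j) n x - W (h1 j) n y\<bar> \<le> C * norm (x - y)" if "n \<le> N" "x \<in> ?K" "y \<in> ?K" for j n x y
    using convex_mesh.U_h_segment_bound[OF cm[OF h1(1)] WU[OF h1(1) that(1)] that(2,3) C0] grad_bound that(1) by blast
  \<comment> \<open>A frontier point, where every iterate from level 1 on vanishes, turns the common
    Lipschitz constant into a uniform bound.\<close>
  have "\<Omega> \<noteq> UNIV" using bounded_dom not_bounded_UNIV by metis
  then obtain z where z: "z \<in> frontier \<Omega>"
    using frontier_not_empty[OF dom_ne] by blast
  then have zK: "z \<in> ?K" by (simp add: frontier_def)
  \<comment> \<open>Only levels 1 to \<open>N\<close> need compactness; level 0 converges along any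
    mesh sequence as a nodal interpolant.\<close>
  obtain r1 where r1: "strict_mono r1" "\<And>n. n \<in> {1..N} \<Longrightarrow>
      \<exists>g. continuous_on ?K g \<and> uniform_limit ?K (\<lambda>j. W (h1 (r1 j)) n) g sequentially"
  proof (rule finite_common_subsequence[of "{1..N}"
        "\<lambda>n r. \<exists>g. continuous_on ?K g \<and> uniform_limit ?K (\<lambda>j. W (h1 (r j)) n) g sequentially"])
    fix n and r :: "nat \<Rightarrow> nat" assume n: "n \<in> {1..N}"
    have bounded: "norm (W (h1 (r j)) n x) \<le> C * diameter ?K" if "x \<in> ?K" for j x
    proof -
      have "W (h1 (r j)) n z = 0" using sol(1)[OF h1(1) n] z by (simp add: U_h0_def W1inf_0_def)
      then have "\<bar>W (h1 (r j)) n x\<bar> \<le> C * norm (x - z)" using W_lip[of n x z "r j"] n that zK by simp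
      also have "\<dots> \<le> C * diameter ?K"
        using diameter_bounded_bound[of ?K x z] that zK compact_closure_dom C0
        by (intro mult_left_mono) (auto simp: dist_norm compact_imp_bounded)
      finally show ?thesis by simp
    qed
    have equicont: "\<exists>d>0. \<forall>j y. y \<in> ?K \<and> norm (x - y) < d \<longrightarrow> norm (W (h1 (r j)) n x - W (h1 (r j)) n y) < e"
      if "x \<in> ?K" "0 < e" for x e
    proof (intro exI[of _ "e / (C + 1)"] conjI allI impI)
      show "0 < e / (C + 1)" using that C0 by simp
      fix j y assume y: "y \<in> ?K \<and> norm (x - y) < e / (C + 1)"
      have "\<bar>W (h1 (r j)) n x - W (h1 (r j)) n y\<bar> \<le> C * norm (x - y)" using W_lip n that y by simp
      also have "\<dots> \<le> (C + 1) * norm (x - y)" by (intro mult_right_mono) auto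
      also have "\<dots> < e" using y C0 by (simp add: field_simps)
      finally show "norm (W (h1 (r j)) n x - W (h1 (r j)) n y) < e" by simp
    qed
    show "\<exists>r'. strict_mono r' \<and> (\<exists>g. continuous_on ?K g \<and>
        uniform_limit ?K (\<lambda>j. W (h1 ((r \<circ> r') j)) n) g sequentially)"
    proof (rule Arzela_Ascoli[OF compact_closure_dom bounded equicont])
      fix g and r' :: "nat \<Rightarrow> nat"
      assume g: "continuous_on ?K g" "strict_mono r'"
        "\<And>e. 0 < e \<Longrightarrow> \<exists>N'. \<forall>j x. j \<ge> N' \<and> x \<in> ?K \<longrightarrow> norm (W (h1 (r (r' j))) n x - g x) < e"
      have "uniform_limit ?K (\<lambda>j. W (h1 (r (r' j))) n) g sequentially"
        unfolding uniform_limit_sequentially_iff dist_norm using g(3) by blast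
      then show ?thesis using g(1,2) by (auto simp: o_def)
    qed
  next
    fix n and r r' :: "nat \<Rightarrow> nat"
    assume "\<exists>g. continuous_on ?K g \<and> uniform_limit ?K (\<lambda>j. W (h1 (r j)) n) g sequentially" "strict_mono r'"
    then show "\<exists>g. continuous_on ?K g \<and> uniform_limit ?K (\<lambda>j. W (h1 ((r \<circ> r') j)) n) g sequentially"
      unfolding o_def using uniform_limit_subseq by blast
  qed (use that in auto)
  then obtain g where g: "\<And>n. n \<in> {1..N} \<Longrightarrow> continuous_on ?K (g n)"
    "\<And>n. n \<in> {1..N} \<Longrightarrow> uniform_limit ?K (\<lambda>j. W (h1 (r1 j)) n) (g n) sequentially" by metis
  define h2 where "h2 = h1 \<circ> r1"
  have h2: "h2 j \<in> H" "h2 \<longlonglongrightarrow> 0" for j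
    using h1 LIMSEQ_subseq_LIMSEQ[OF h1(2) r1(1)] by (auto simp: h2_def)
  define w where "w n = (if n = 0 then w0 else g n)" for n
  have wc: "continuous_on ?K (w n)" if "n \<le> N" for n using w0c g(1)[of n] that by (auto simp: w_def)
  have W_lim: "uniform_limit ?K (\<lambda>j. W (h2 j) n) (w n) sequentially" if "n \<le> N" for n
  proof (cases "n = 0")
    case True
    have "uniform_limit ?K (\<lambda>j. nodal_interp \<Omega> (\<T> (h2 j)) w0) w0 sequentially"
      by (rule mesh_sequence.nodal_interp_conv(1)[OF ms[OF h2] w0_C1])
    then show ?thesis using sol0[OF h2(1)] True unfolding uniform_limit_iff by (simp add: w_def)
  next
    case False
    then show ?thesis using g(2)[of n] that by (simp add: w_def h2_def)
  qed
  define M where "M n = M_eps k0 \<epsilon> w0 Dw0 (w n)" for n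
  have Mc: "continuous_on ?K (M n)" if "n \<le> N" for n
    unfolding M_def by (rule M_eps_continuous[OF pos(3) w0_C1 wc[OF that]])
  have M_ge: "k0 \<le> M n x" for n x
    unfolding M_def M_eps_def by (rule ramp_bounds) (use pos in auto)
  have sub: "mesh_sequence \<Omega> (\<lambda>j. \<T> (h2 (r j))) (\<lambda>j. h2 (r j)) \<kappa>" if "strict_mono r" for r
    using h2 LIMSEQ_subseq_LIMSEQ[OF h2(2) that] by (intro ms) (auto simp: o_def)
  have sub_lim: "uniform_limit ?K (\<lambda>j. W (h2 (r j)) n) (w n) sequentially" if "strict_mono r" "n \<le> N" for r n
    by (rule uniform_limit_subseq[OF W_lim[OF that(2)] that(1)])
  have m_conv: "\<forall>\<^sub>F j in sequentially. \<forall>\<sigma>\<in>\<T> (h2 (r j)). \<forall>x\<in>\<sigma>. \<bar>m (h2 (r j)) n x - M n x\<bar> \<le> e"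
    if "strict_mono r" "n \<le> N" "0 < e" for r n e
    unfolding m_def M_def
    by (rule mesh_sequence.M_eps_h_conv[OF sub[OF that(1)] pos(3) w0_C1 Wc[OF h2(1) that(2)] wc[OF that(2)]
        sub_lim[OF that(1,2)] that(3)])
  \<comment> \<open>Stated for an arbitrary further subsequence, since it serves three times: for
    integrability with the identity, for the L1 bound during extraction, and for the limit along the
    final subsequence.\<close>
  have step: "discrete_step \<Omega> (\<lambda>j. \<T> (h2 (r j))) (\<lambda>j. h2 (r j)) \<kappa> k0 (time_step t n) (F n) (w n) (w (n - 1)) (M n)
      (\<lambda>j. W (h2 (r j)) n) (\<lambda>j. W (h2 (r j)) (n - 1)) (\<lambda>j. m (h2 (r j)) n) (\<lambda>j. Q (h2 (r j)) n)"
    if r: "strict_mono r" and n: "n \<in> {1..N}" for r n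
    by (intro discrete_step.intro[OF sub[OF r]] discrete_step_axioms.intro)
      (use n r sol[OF h2(1) n] sub_lim wc F_L2 m_const[OF h2(1)] pos m_ge m_conv Mc M_ge in auto)
  have int_Q: "integrable (lebesgue_on \<Omega>) (\<lambda>x. Q (h2 j) n x $ i)" if "n \<in> {1..N}" for j n i
    using discrete_step.Q_integrable(3)[OF step[OF strict_mono_id that]] by simp
  \<comment> \<open>Compactness is available for scalar measures, so the extraction runs over all
    pairs of a time level and a component.\<close>
  obtain r2 where r2: "strict_mono r2" "\<And>p. p \<in> {1..N} \<times> (UNIV :: 'n set) \<Longrightarrow>
      \<exists>\<mu>\<in>radon_measures ?K. \<forall>\<eta>. continuous_on ?K \<eta> \<longrightarrow>
        (\<lambda>j. \<integral>x. Q (h2 (r2 j)) (fst p) x $ snd p * \<eta> x \<partial>lebesgue_on \<Omega>) \<longlonglongrightarrow> \<mu> \<eta>"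
  proof (rule finite_common_subsequence[of "{1..N} \<times> (UNIV :: 'n set)" "\<lambda>p r.
      \<exists>\<mu>\<in>radon_measures ?K. \<forall>\<eta>. continuous_on ?K \<eta> \<longrightarrow>
        (\<lambda>j. \<integral>x. Q (h2 (r j)) (fst p) x $ snd p * \<eta> x \<partial>lebesgue_on \<Omega>) \<longlonglongrightarrow> \<mu> \<eta>"])
    fix p :: "nat \<times> 'n" and r :: "nat \<Rightarrow> nat"
    assume "p \<in> {1..N} \<times> UNIV" and r: "strict_mono r"
    then have n: "fst p \<in> {1..N}" by auto
    obtain B where B: "\<And>j. (\<integral>x. norm (Q (h2 (r j)) (fst p) x) \<partial>lebesgue_on \<Omega>) \<le> B"
      using discrete_step.Q_bounded[OF step[OF r n]] by blast
    show "\<exists>r'. strict_mono r' \<and> (\<exists>\<mu>\<in>radon_measures ?K. \<forall>\<eta>. continuous_on ?K \<eta> \<longrightarrow>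
        (\<lambda>j. \<integral>x. Q (h2 ((r \<circ> r') j)) (fst p) x $ snd p * \<eta> x \<partial>lebesgue_on \<Omega>) \<longlonglongrightarrow> \<mu> \<eta>)"
    proof (rule vague_compactness[of "\<lambda>j x. Q (h2 (r j)) (fst p) x $ snd p", OF int_Q[OF n]
          discrete_step.Q_component_bounded[OF step[OF r n] B]])
      fix r' :: "nat \<Rightarrow> nat" and \<mu>
      assume "strict_mono r'" "\<mu> \<in> radon_measures ?K" "\<And>\<eta>. continuous_on ?K \<eta> \<Longrightarrow>
        (\<lambda>j. \<integral>x. Q (h2 (r (r' j))) (fst p) x $ snd p * \<eta> x \<partial>lebesgue_on \<Omega>) \<longlonglongrightarrow> \<mu> \<eta>"
      then show ?thesis unfolding o_def by blast
    qed
  next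
    fix p :: "nat \<times> 'n" and r r' :: "nat \<Rightarrow> nat"
    assume "\<exists>\<mu>\<in>radon_measures ?K. \<forall>\<eta>. continuous_on ?K \<eta> \<longrightarrow>
        (\<lambda>j. \<integral>x. Q (h2 (r j)) (fst p) x $ snd p * \<eta> x \<partial>lebesgue_on \<Omega>) \<longlonglongrightarrow> \<mu> \<eta>"
      and r': "strict_mono r'"
    then obtain \<mu> where \<mu>: "\<mu> \<in> radon_measures ?K" "\<And>\<eta>. continuous_on ?K \<eta> \<Longrightarrow>
        (\<lambda>j. \<integral>x. Q (h2 (r j)) (fst p) x $ snd p * \<eta> x \<partial>lebesgue_on \<Omega>) \<longlonglongrightarrow> \<mu> \<eta>" by blast
    show "\<exists>\<mu>\<in>radon_measures ?K. \<forall>\<eta>. continuous_on ?K \<eta> \<longrightarrow>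
        (\<lambda>j. \<integral>x. Q (h2 ((r \<circ> r') j)) (fst p) x $ snd p * \<eta> x \<partial>lebesgue_on \<Omega>) \<longlonglongrightarrow> \<mu> \<eta>"
      using \<mu>(1) LIMSEQ_subseq_LIMSEQ[OF \<mu>(2) r'] by (auto simp: o_def)
  qed (use that in auto)
  define \<mu> where "\<mu> n i = (SOME \<mu>. \<mu> \<in> radon_measures ?K \<and> (\<forall>\<eta>. continuous_on ?K \<eta> \<longrightarrow>
      (\<lambda>j. \<integral>x. Q (h2 (r2 j)) n x $ i * \<eta> x \<partial>lebesgue_on \<Omega>) \<longlonglongrightarrow> \<mu> \<eta>))" for n i
  have \<mu>: "\<mu> n i \<in> radon_measures ?K" "continuous_on ?K \<eta> \<Longrightarrow>
      (\<lambda>j. \<integral>x. Q (h2 (r2 j)) n x $ i * \<eta> x \<partial>lebesgue_on \<Omega>) \<longlonglongrightarrow> \<mu> n i \<eta>" if "n \<in> {1..N}" for n i \<eta>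
  proof -
    have "\<exists>\<mu>. \<mu> \<in> radon_measures ?K \<and> (\<forall>\<eta>. continuous_on ?K \<eta> \<longrightarrow>
      (\<lambda>j. \<integral>x. Q (h2 (r2 j)) n x $ i * \<eta> x \<partial>lebesgue_on \<Omega>) \<longlonglongrightarrow> \<mu> \<eta>)"
      using r2(2)[of "(n, i)"] that by auto
    from someI_ex[OF this, folded \<mu>_def]
    show "\<mu> n i \<in> radon_measures ?K" "continuous_on ?K \<eta> \<Longrightarrow>
      (\<lambda>j. \<integral>x. Q (h2 (r2 j)) n x $ i * \<eta> x \<partial>lebesgue_on \<Omega>) \<longlonglongrightarrow> \<mu> n i \<eta>" by blast+
  qed
  define hs where "hs j = h2 (r2 j)" for j
  define q :: "nat \<Rightarrow> 'n vmeasure" where "q n = (\<chi> i. \<mu> n i)" for n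
  have q: "q n \<in> vector_radon_measures ?K" if "n \<in> {1..N}" for n
    using \<mu>(1)[OF that] by (simp add: vector_radon_measures_def q_def)
  have vague: "vague_conv ?K (\<lambda>j. L1_vmeasure \<Omega> (Q (hs j) n)) (q n)" if "n \<in> {1..N}" for n
    using \<mu>(2)[OF that] by (simp add: vague_conv_def L1_vmeasure_def q_def hs_def)
  note st = step[OF r2(1), folded hs_def]
  note S = sub[OF r2(1), folded hs_def]
  have hsH: "hs j \<in> H" and hs0: "hs \<longlonglongrightarrow> 0" for j
    using h2 LIMSEQ_subseq_LIMSEQ[OF h2(2) r2(1)] by (auto simp: hs_def[abs_def] o_def)
  have gb: "norm (grad (W (hs j) n) x) \<le> C" if "n \<le> N" "\<sigma> \<in> \<T> (hs j)" "x \<in> \<sigma>" for n j \<sigma> x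
    using grad_bound that by (simp add: hs_def h2_def)
  have hs_lim: "uniform_limit ?K (\<lambda>j. W (hs j) n) (w n) sequentially" if "n \<le> N" for n
    using sub_lim[OF r2(1) that] by (simp add: hs_def)
  note ws = mesh_sequence.grad_weak_star[OF S WU[OF hsH] hs_lim wc C0 gb]
  have "solves_Q_tau \<Omega> k0 \<epsilon> w0 Dw0 N t f w q"
    unfolding solves_Q_tau_def
  proof (intro conjI ballI)
    show "w 0 x = w0 x" for x by (simp add: w_def)
    fix n assume n: "n \<in> {1..N}"
    note n' = discrete_step.has_measure_div_limit[OF st[OF n] q[OF n] vague[OF n]]
    show "w n \<in> W1inf_0 \<Omega>"
      using ws(1)[of n] wc[of n] discrete_step.w_zero[OF st[OF n]] n by (auto simp: W1inf_0_def)
    show "q n \<in> V_M \<Omega>" using q[OF n] n' by (auto simp: V_M_def)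
    show "L2_inner \<Omega> (\<lambda>x. (w n x - w (n - 1) x) / time_step t n) \<eta> + L2_inner \<Omega> (measure_div \<Omega> (q n)) \<eta>
        = L2_inner \<Omega> (time_mean t f n) \<eta>" if "\<eta> \<in> L2_space \<Omega>" for \<eta>
      using discrete_step.equation_limit[OF st[OF n] q[OF n] vague[OF n] that] by (simp add: F_def)
    show "0 \<le> total_variation ?K v (M_eps k0 \<epsilon> w0 Dw0 (w n)) - total_variation ?K (q n) (M_eps k0 \<epsilon> w0 Dw0 (w n))
        - L2_inner \<Omega> (measure_div \<Omega> (v - q n)) (w n)" if "v \<in> V_M \<Omega>" for v
      using discrete_step.inequality_limit[OF st[OF n] q[OF n] vague[OF n] that] by (simp add: M_def)
  qed
  moreover have "weak_star_Linf \<Omega> (\<lambda>j. grad (W (hs j) n)) (weak_grad \<Omega> (w n))" if "n \<in> {0..N}" for n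
    using ws(2)[of n] that by simp
  moreover have "(\<lambda>j. Linf_norm \<Omega> (\<lambda>x. m (hs j) n x - M n x)) \<longlonglongrightarrow> 0" if "n \<in> {0..N}" for n
  proof (rule Linf_norm_tendsto_zero)
    have n: "n \<le> N" using that by simp
    show "(\<lambda>x. m (hs j) n x - M n x) \<in> borel_measurable (lebesgue_on \<Omega>)" for j
      using convex_mesh.piecewise_const_measurable[OF cm[OF hsH] m_const[OF hsH]] continuous_closure_measurable[OF Mc[OF n]]
      by (intro borel_measurable_diff)
    fix e :: real assume "0 < e"
    from m_conv[OF r2(1) n this, folded hs_def]
    show "\<forall>\<^sub>F j in sequentially. AE x in lebesgue_on \<Omega>. norm (m (hs j) n x - M n x) \<le> e"
    proof eventually_elim
      case (elim j)
      show ?case using convex_mesh.AE_mesh[OF cm[OF hsH], of j] by eventually_elim (use elim in auto)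
    qed
  qed
  ultimately show ?thesis
    using hsH hs0 hs_lim vague unfolding m_def M_def
    by (intro exI[of _ hs] exI[of _ w] exI[of _ q] conjI ballI) auto
qed

end
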